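(* Let $(R,\mathfrak m,k)$ be a complete Noetherian local ring, and let $E=E_R(k)$. Let $\alpha$ be a functorial submodule selector (i.e. a preradical) on the class $\mathcal A$ of Artinian $R$-modules, and let $\alpha_f$ be its finitistic version. Let $\mathrm{cl}$ (resp. $\mathrm{cl}_f$) be the operation such that $L^{\mathrm{cl}}_M/L=\alpha(M/L)$ (resp. $L^{\mathrm{cl}_f}_M/L=\alpha_f(M/L)$) whenever $L\subseteq M$ and $M/L$ is Artinian. Assume that $\mathrm{cl}$ and $\mathrm{cl}_f$ are closure operations. Let $I$ be any ideal of $R$. Then \begin{align*} \alpha^{\smile}(I)&=\operatorname{ann}_R\big((\operatorname{ann}_E I)^{\mathrm{cl}}_E\big)=\bigcap_{M\in\mathcal A}\operatorname{ann}_R\big((\operatorname{ann}_M I)^{\mathrm{cl}}_M\big)\\ &\subseteq(\alpha_f)^{\smile}(I)=\operatorname{ann}_R\big((\operatorname{ann}_E I)^{\mathrm{cl}_f}_E\big)=\bigcap_{M\subseteq E\text{ f.g.}}\operatorname{ann}_R\big((\operatorname{ann}_M I)^{\mathrm{cl}}_M\big)\\ &=\bigcap_{\lambda(M)<\infty}\operatorname{ann}_R\big((\operatorname{ann}_M I)^{\mathrm{cl}}_M\big)\\ &\subseteq\bigcap_{\lambda(R/J)<\infty}\operatorname{ann}_R\big((\operatorname{ann}_{R/J}I)^{\mathrm{cl}}_{R/J}\big)=\bigcap_{\lambda(R/J)<\infty}\big(J:(J:I)^{\mathrm{cl}}_R\big). \end{align*} Moreover, the last containment is an equality when $R$ is approximately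 Gorenstein. In that case, if $\{J_t\}_{t\ge 0}$ is a decreasing nested sequence of irreducible ideals that is cofinal with the powers of $\mathfrak m$, then $$(\alpha_f)^{\smile}(I)=\bigcap_{t\ge0}\big(J_t:(J_t:I)^{\mathrm{cl}}_R\big).$$
   Context: $\lambda$ denotes length; $(-)^\vee=\mathrm{Hom}_R(-,E)$; $\operatorname{ann}_M I=\{x\in M: Ix=0\}$; "f.g." means finitely generated; $J$ ranges over ideals of $R$ of finite colength. A submodule selector on a class $\mathcal M$ of $R$-modules (closed under submodules and quotients) is a function $\alpha:\mathcal M\to\mathcal M$ with $\alpha(M)\subseteq M$ and $\phi(\alpha(M))=\alpha(N)$ for every isomorphism $\phi:M\to N$ in $\mathcal M$. It is functorial if $g(\alpha(M))\subseteq\alpha(N)$ for every homomorphism $g:M\to N$ in $\mathcal M$. The finitistic version is $\alpha_f(N)=\bigcup\{\alpha(M):M\subseteq N\text{ finitely generated}\}$. The dual of a submodule selector $\alpha$ on a class $\mathcal M$ of Matlis-dualizable modules is the submodule selector $\alpha^{\smile}$ on $\mathcal M^\vee$ given by $\alpha^{\smile}(M)=(M^\vee/\alpha(M^\vee))^\vee$, considered as a submodule of $M^{\vee\vee}\cong M$. (Here $\mathcal M=\mathcal A$, $\mathcal M^\vee$ is the class of finitely generated modules, and the ideal $I$ is viewed as a finitely generated module.) A closure operation assigns to $L\subseteq M$ a module $L\subseteq L^{\mathrm{cl}}_M\subseteq M$ with $(L^{\mathrm{cl}}_M)^{\mathrm{cl}}_M=L^{\mathrm{cl}}_M$ and $L\subseteq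 N\subseteq M\Rightarrow L^{\mathrm{cl}}_M\subseteq N^{\mathrm{cl}}_M$. An ideal is irreducible if it is not the intersection of two strictly larger ideals. A Noetherian local ring is approximately Gorenstein if it has a decreasing sequence of irreducible $\mathfrak m$-primary ideals cofinal with the powers of $\mathfrak m$. *)

theory Defs
  imports "HOL-Algebra.Algebra" "HOL-Library.Extended_Nat"
begin

text \<open>
  A submodule of \<open>M\<close> with underlying set \<open>H\<close> is viewed as a module as \<open>M\<lparr>carrier := H\<rparr>\<close>.
  The fields \<open>mult\<close> and \<open>one\<close> of the record type \<open>module\<close> play no role for modules.
\<close>

section \<open>Modules\<close>

definition mod_hom ::
  "('a, 'r) ring_scheme \<Rightarrow> ('a, 'b) module \<Rightarrow> ('a, 'c) module \<Rightarrow> ('b \<Rightarrow> 'c) set" where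
  "mod_hom R M N = {f. f \<in> carrier M \<rightarrow> carrier N
     \<and> (\<forall>x\<in>carrier M. \<forall>y\<in>carrier M. f (x \<oplus>\<^bsub>M\<^esub> y) = f x \<oplus>\<^bsub>N\<^esub> f y)
     \<and> (\<forall>r\<in>carrier R. \<forall>x\<in>carrier M. f (r \<odot>\<^bsub>M\<^esub> x) = r \<odot>\<^bsub>N\<^esub> f x)}"

definition mod_iso ::
  "('a, 'r) ring_scheme \<Rightarrow> ('a, 'b) module \<Rightarrow> ('a, 'c) module \<Rightarrow> ('b \<Rightarrow> 'c) set" where
  "mod_iso R M N = {f \<in> mod_hom R M N. bij_betw f (carrier M) (carrier N)}"

definition regular_module :: "('a, 'r) ring_scheme \<Rightarrow> ('a, 'a) module" where
  "regular_module R = \<lparr>carrier = carrier R, monoid.mult = monoid.mult R, one = one R, ring.zero = ring.zero R,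
     ring.add = ring.add R, smult = monoid.mult R\<rparr>"

definition quotient_module ::
  "('a, 'r) ring_scheme \<Rightarrow> ('a, 'b) module \<Rightarrow> 'b set \<Rightarrow> ('a, 'b set) module" where
  "quotient_module R M L = \<lparr>carrier = a_rcosets\<^bsub>M\<^esub> L, monoid.mult = undefined, one = undefined,
     ring.zero = L, ring.add = set_add M, smult = (\<lambda>r C. \<Union>x\<in>C. L +>\<^bsub>M\<^esub> (r \<odot>\<^bsub>M\<^esub> x))\<rparr>"

text \<open>The elements of \<open>Hom(M,N)\<close> are required to be extensional, so that a
  homomorphism is determined by its values on \<open>carrier M\<close>.\<close>

definition hom_module ::
  "('a, 'r) ring_scheme \<Rightarrow> ('a, 'b) module \<Rightarrow> ('a, 'c) module \<Rightarrow> ('a, 'b \<Rightarrow> 'c) module" where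
  "hom_module R M N = \<lparr>carrier = mod_hom R M N \<inter> extensional (carrier M),
     monoid.mult = undefined, one = undefined,
     ring.zero = (\<lambda>x\<in>carrier M. \<zero>\<^bsub>N\<^esub>),
     ring.add = (\<lambda>f g. \<lambda>x\<in>carrier M. f x \<oplus>\<^bsub>N\<^esub> g x),
     smult = (\<lambda>r f. \<lambda>x\<in>carrier M. r \<odot>\<^bsub>N\<^esub> f x)\<rparr>"

definition finitely_generated :: "('a, 'r) ring_scheme \<Rightarrow> ('a, 'b) module \<Rightarrow> bool" where
  "finitely_generated R M \<longleftrightarrow> module R M
     \<and> (\<exists>A\<subseteq>carrier M. finite A \<and> carrier M = \<Inter> {N. submodule N R M \<and> A \<subseteq> N})"

definition artinian :: "('a, 'r) ring_scheme \<Rightarrow> ('a, 'b) module \<Rightarrow> bool" where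
  "artinian R M \<longleftrightarrow> module R M
     \<and> (\<forall>N. (\<forall>n::nat. submodule (N n) R M \<and> N (Suc n) \<subseteq> N n) \<longrightarrow> (\<exists>k. \<forall>n\<ge>k. N n = N k))"

text \<open>Length as the supremum of the lengths of strict chains of submodules.\<close>

definition module_length :: "('a, 'r) ring_scheme \<Rightarrow> ('a, 'b) module \<Rightarrow> enat" where
  "module_length R M = Sup {enat n | n. \<exists>C. (\<forall>i\<le>n. submodule (C i) R M)
     \<and> (\<forall>i<n. C i \<subset> C (Suc i))}"

text \<open>\<open>ann\<^sub>M I\<close>, \<open>ann\<^sub>R S\<close> for a subset \<open>S\<close> of \<open>M\<close>, and \<open>(J : I)\<close>.\<close>

definition ann_in :: "('a, 'b) module \<Rightarrow> 'a set \<Rightarrow> 'b set" where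
  "ann_in M I = {x \<in> carrier M. \<forall>r\<in>I. r \<odot>\<^bsub>M\<^esub> x = \<zero>\<^bsub>M\<^esub>}"

definition annihilator :: "('a, 'r) ring_scheme \<Rightarrow> ('a, 'b) module \<Rightarrow> 'b set \<Rightarrow> 'a set" where
  "annihilator R M S = {r \<in> carrier R. \<forall>x\<in>S. r \<odot>\<^bsub>M\<^esub> x = \<zero>\<^bsub>M\<^esub>}"

definition colon :: "('a, 'r) ring_scheme \<Rightarrow> 'a set \<Rightarrow> 'a set \<Rightarrow> 'a set" where
  "colon R J I = {r \<in> carrier R. \<forall>x\<in>I. r \<otimes>\<^bsub>R\<^esub> x \<in> J}"

section \<open>Complete local rings and injective hulls\<close>

abbreviation ideal_power :: "('a, 'r) ring_scheme \<Rightarrow> 'a set \<Rightarrow> nat \<Rightarrow> 'a set" where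
  "ideal_power R I n \<equiv> I [^]\<^bsub>ideals_set R\<^esub> n"

text \<open>The canonical map from \<open>R\<close> to the inverse limit of the \<open>R / I^n\<close> is bijective; a point of
  the limit is given by representatives \<open>x n\<close> of its components in \<open>R / I^n\<close>.\<close>

definition adically_complete :: "('a, 'r) ring_scheme \<Rightarrow> 'a set \<Rightarrow> bool" where
  "adically_complete R I \<longleftrightarrow>
     (\<forall>x. (\<forall>n. x n \<in> carrier R \<and> x (Suc n) \<ominus>\<^bsub>R\<^esub> x n \<in> ideal_power R I n) \<longrightarrow>
       (\<exists>!y. y \<in> carrier R \<and> (\<forall>n. y \<ominus>\<^bsub>R\<^esub> x n \<in> ideal_power R I n)))"

definition complete_noetherian_local :: "('a, 'r) ring_scheme \<Rightarrow> 'a set \<Rightarrow> bool" where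
  "complete_noetherian_local R m \<longleftrightarrow> cring R \<and> noetherian_ring R
     \<and> maximalideal m R \<and> (\<forall>n. maximalideal n R \<longrightarrow> n = m)
     \<and> adically_complete R m"

text \<open>The test modules range over the type of elements of \<open>E\<close>. As soon as \<open>R\<close> embeds as a set
  into that type, this amounts to injectivity against arbitrary modules, by Baer's criterion.\<close>

definition injective_module :: "('a, 'r) ring_scheme \<Rightarrow> ('a, 'u) module \<Rightarrow> bool" where
  "injective_module R E \<longleftrightarrow> module R E
     \<and> (\<forall>(A :: ('a, 'u) module) (B :: ('a, 'u) module) i g.
          module R A \<and> module R B \<and> i \<in> mod_hom R A B \<and> inj_on i (carrier A) \<and> g \<in> mod_hom R A E
          \<longrightarrow> (\<exists>h\<in>mod_hom R B E. \<forall>x\<in>carrier A. h (i x) = g x))"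

definition injective_hull ::
  "('a, 'r) ring_scheme \<Rightarrow> ('a, 'b) module \<Rightarrow> ('a, 'u) module \<Rightarrow> bool" where
  "injective_hull R K E \<longleftrightarrow> injective_module R E
     \<and> (\<exists>i\<in>mod_hom R K E. inj_on i (carrier K)
          \<and> (\<forall>N. submodule N R E \<and> N \<noteq> {\<zero>\<^bsub>E\<^esub>} \<longrightarrow> N \<inter> i ` carrier K \<noteq> {\<zero>\<^bsub>E\<^esub>}))"

section \<open>Submodule selectors on Artinian modules\<close>

text \<open>The class of Artinian modules is represented by the Artinian modules with elements in a type
  \<open>'u\<close>. If \<open>'u\<close> is infinite and \<open>R\<close> (Noetherian local) embeds into it as a set, every Artinian
  \<open>R\<close>-module has an isomorphic copy there: it is a countable union of finite length modules.\<close>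

definition artinian_modules :: "('a, 'r) ring_scheme \<Rightarrow> ('a, 'u) module set" where
  "artinian_modules R = {M. artinian R M}"

definition submodule_selector ::
  "('a, 'r) ring_scheme \<Rightarrow> (('a, 'u) module \<Rightarrow> 'u set) \<Rightarrow> bool" where
  "submodule_selector R \<alpha> \<longleftrightarrow>
     (\<forall>M\<in>artinian_modules R. submodule (\<alpha> M) R M)
     \<and> (\<forall>M\<in>artinian_modules R. \<forall>N\<in>artinian_modules R. \<forall>\<phi>\<in>mod_iso R M N. \<phi> ` \<alpha> M = \<alpha> N)"

definition functorial ::
  "('a, 'r) ring_scheme \<Rightarrow> (('a, 'u) module \<Rightarrow> 'u set) \<Rightarrow> bool" where
  "functorial R \<alpha> \<longleftrightarrow>
     (\<forall>M\<in>artinian_modules R. \<forall>N\<in>artinian_modules R. \<forall>g\<in>mod_hom R M N. g ` \<alpha> M \<subseteq> \<alpha> N)"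

definition finitistic ::
  "('a, 'r) ring_scheme \<Rightarrow> (('a, 'u) module \<Rightarrow> 'u set) \<Rightarrow> ('a, 'u) module \<Rightarrow> 'u set" where
  "finitistic R \<alpha> N =
     \<Union> {\<alpha> (N\<lparr>carrier := H\<rparr>) | H. submodule H R N \<and> finitely_generated R (N\<lparr>carrier := H\<rparr>)}"

text \<open>The value \<open>\<alpha>(N)\<close> at an Artinian module \<open>N\<close> with elements in an arbitrary type (such as a
  quotient or a dual), transported from an isomorphic copy \<open>M\<close> of \<open>N\<close> in \<open>'u\<close>. For a submodule
  selector all sets in the union coincide, by invariance under isomorphisms.\<close>

definition selector_at ::
  "('a, 'r) ring_scheme \<Rightarrow> (('a, 'u) module \<Rightarrow> 'u set) \<Rightarrow> ('a, 'v) module \<Rightarrow> 'v set" where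
  "selector_at R \<alpha> N = \<Union> {\<phi> ` \<alpha> M | M \<phi>. M \<in> artinian_modules R \<and> \<phi> \<in> mod_iso R M N}"

text \<open>\<open>cl R \<alpha> M L\<close> is the preimage of \<open>\<alpha>(M/L)\<close> in \<open>M\<close>, i.e. the submodule \<open>C\<close> of \<open>M\<close> containing
  \<open>L\<close> with \<open>C/L = \<alpha>(M/L)\<close>. It is meaningful only when \<open>M/L\<close> is Artinian.\<close>

definition cl ::
  "('a, 'r) ring_scheme \<Rightarrow> (('a, 'u) module \<Rightarrow> 'u set) \<Rightarrow> ('a, 'v) module \<Rightarrow> 'v set \<Rightarrow> 'v set" where
  "cl R \<alpha> M L = {x \<in> carrier M. L +>\<^bsub>M\<^esub> x \<in> selector_at R \<alpha> (quotient_module R M L)}"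

text \<open>Being a closure operation on the pairs \<open>L \<subseteq> M\<close> with \<open>M/L\<close> Artinian.\<close>

definition closure_operation ::
  "('a, 'r) ring_scheme \<Rightarrow> (('a, 'u) module \<Rightarrow> 'u set \<Rightarrow> 'u set) \<Rightarrow> bool" where
  "closure_operation R c \<longleftrightarrow>
     (\<forall>M L. module R M \<and> submodule L R M \<and> artinian R (quotient_module R M L) \<longrightarrow>
        submodule (c M L) R M \<and> L \<subseteq> c M L \<and> c M (c M L) = c M L
        \<and> (\<forall>N. submodule N R M \<and> L \<subseteq> N \<longrightarrow> c M L \<subseteq> c M N))"

section \<open>Matlis duals and the dual of a selector\<close>

definition biduality_map ::
  "('a, 'r) ring_scheme \<Rightarrow> ('a, 'u) module \<Rightarrow> ('a, 'v) module \<Rightarrow> 'v \<Rightarrow> ('v \<Rightarrow> 'u) \<Rightarrow> 'u" where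
  "biduality_map R E M x = (\<lambda>f\<in>carrier (hom_module R M E). f x)"

text \<open>For \<open>D = Hom(M,E)\<close> and \<open>S = \<alpha>(D)\<close>, the dual of \<open>D/S\<close> is embedded into the dual of \<open>D\<close> by
  composition with the projection \<open>D \<rightarrow> D/S\<close>, and the latter is identified with \<open>M\<close> through the
  biduality map.\<close>

definition dual_selector ::
  "('a, 'r) ring_scheme \<Rightarrow> ('a, 'u) module \<Rightarrow> (('a, 'u) module \<Rightarrow> 'u set)
     \<Rightarrow> ('a, 'v) module \<Rightarrow> 'v set" where
  "dual_selector R E \<alpha> M =
     (let D = hom_module R M E; S = selector_at R \<alpha> D in
      {x \<in> carrier M. biduality_map R E M x \<in>
         (\<lambda>\<psi>. \<lambda>f\<in>carrier D. \<psi> (S +>\<^bsub>D\<^esub> f)) ` carrier (hom_module R (quotient_module R D S) E)})"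

section \<open>Approximately Gorenstein rings\<close>

definition irreducible_ideal :: "('a, 'r) ring_scheme \<Rightarrow> 'a set \<Rightarrow> bool" where
  "irreducible_ideal R J \<longleftrightarrow> ideal J R
     \<and> \<not> (\<exists>A B. ideal A R \<and> ideal B R \<and> J \<subset> A \<and> J \<subset> B \<and> J = A \<inter> B)"

definition primary_to :: "('a, 'r) ring_scheme \<Rightarrow> 'a set \<Rightarrow> 'a set \<Rightarrow> bool" where
  "primary_to R m Q \<longleftrightarrow> ideal Q R \<and> Q \<noteq> carrier R
     \<and> (\<forall>a\<in>carrier R. \<forall>b\<in>carrier R. a \<otimes>\<^bsub>R\<^esub> b \<in> Q \<longrightarrow> a \<in> Q \<or> (\<exists>n::nat. b [^]\<^bsub>R\<^esub> n \<in> Q))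
     \<and> {a \<in> carrier R. \<exists>n::nat. a [^]\<^bsub>R\<^esub> n \<in> Q} = m"

definition cofinal_with_powers ::
  "('a, 'r) ring_scheme \<Rightarrow> 'a set \<Rightarrow> (nat \<Rightarrow> 'a set) \<Rightarrow> bool" where
  "cofinal_with_powers R m J \<longleftrightarrow>
     (\<forall>n. \<exists>t. J t \<subseteq> ideal_power R m n) \<and> (\<forall>t. \<exists>n. ideal_power R m n \<subseteq> J t)"

definition approximately_gorenstein :: "('a, 'r) ring_scheme \<Rightarrow> 'a set \<Rightarrow> bool" where
  "approximately_gorenstein R m \<longleftrightarrow>
     (\<exists>J. (\<forall>t. irreducible_ideal R (J t) \<and> primary_to R m (J t)) \<and> antimono J
        \<and> cofinal_with_powers R m J)"

end

theory Submission
  imports Defs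
begin

text \<open>
  Write \<open>C\<^sub>M\<close> for the closure of \<open>ann\<^sub>M I\<close> in \<open>M\<close>. Homomorphisms \<open>M \<rightarrow> N\<close> map \<open>ann\<^sub>M I\<close> into \<open>ann\<^sub>N I\<close>,
  so by functoriality they map \<open>C\<^sub>M\<close> into \<open>C\<^sub>N\<close>; since \<open>E\<close> is a cogenerator, an element of \<open>R\<close> kills
  \<open>C\<^sub>M\<close> as soon as it kills \<open>f(C\<^sub>M)\<close> for all \<open>f : M \<rightarrow> E\<close>. By Baer's criterion
  \<open>e \<mapsto> (x \<mapsto> x e)\<close> identifies \<open>E / ann\<^sub>E I\<close> with \<open>Hom(I, E)\<close>, which turns the dual selector into
  \<open>ann\<^sub>R C\<^sub>E\<close>. Finitely generated submodules of \<open>E / ann\<^sub>E I\<close> lift to \<open>E\<close>, which gives the finitistic version.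

  That \<open>E\<close> is Artinian rests on \<open>ann\<^sub>E (ann\<^sub>R N) = N\<close> for all submodules \<open>N\<close>: for \<open>N\<close> killed by a
  power of \<open>m\<close> this is a comparison of lengths, as both annihilator operations turn simple steps
  into simple steps, and completeness of \<open>R\<close> passes from the submodules \<open>N \<inter> ann\<^sub>E (m^n)\<close> to \<open>N\<close>.
  If \<open>J\<close> is irreducible and contains a power of \<open>m\<close>, then \<open>J = ann\<^sub>R e\<close> for some \<open>e \<in> E\<close>, and the same
  length comparison gives \<open>R / J \<cong> R e = ann\<^sub>E J\<close>. So a cofinal sequence of such \<open>J\<close> exhausts \<open>E\<close> by
  copies of the modules \<open>R / J\<close>.
\<close>

section \<open>Homomorphisms and quotients of modules\<close>

text \<open>Types shape the proof. Selectors and the test modules of \<open>injective_module\<close>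
  have elements in \<open>'u\<close>, whereas R, its ideals, the quotients R / J and E / ann I, and
  Hom(I, E) live in other types. So each of them gets an injection of its carrier into
  \<open>'u\<close>: \<open>\<iota>\<close> for R, chosen representatives for quotients, chosen
  preimages for Hom(I, E). Structure is carried along these injections by \<open>transport\<close>,
  and closures are compared through \<open>selector_at\<close>. The residue field is represented by
  one element s of E, the image of 1: m kills s, and every nonzero element of E has s as a multiple.
  Together with locality this makes the socle of E one-dimensional, which is what lets simple steps
  pass between E and R. Exact lengths are never computed. A simple step may be trivial, so a number
  of steps is only an upper bound for a length; this suffices because a strict submodule is reached
  in strictly fewer steps (\<open>steps_psubset\<close>).\<close>

lemma mod_hom_closed: "f \<in> mod_hom R M N \<Longrightarrow> x \<in> carrier M \<Longrightarrow> f x \<in> carrier N"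
  by (auto simp: mod_hom_def)

lemma mod_hom_add:
  "f \<in> mod_hom R M N \<Longrightarrow> x \<in> carrier M \<Longrightarrow> y \<in> carrier M \<Longrightarrow> f (x \<oplus>\<^bsub>M\<^esub> y) = f x \<oplus>\<^bsub>N\<^esub> f y"
  by (auto simp: mod_hom_def)

lemma mod_hom_smult:
  "f \<in> mod_hom R M N \<Longrightarrow> r \<in> carrier R \<Longrightarrow> x \<in> carrier M \<Longrightarrow> f (r \<odot>\<^bsub>M\<^esub> x) = r \<odot>\<^bsub>N\<^esub> f x"
  by (auto simp: mod_hom_def)

lemma mod_homI:
  assumes "\<And>x. x \<in> carrier M \<Longrightarrow> f x \<in> carrier N"
    and "\<And>x y. x \<in> carrier M \<Longrightarrow> y \<in> carrier M \<Longrightarrow> f (x \<oplus>\<^bsub>M\<^esub> y) = f x \<oplus>\<^bsub>N\<^esub> f y"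
    and "\<And>r x. r \<in> carrier R \<Longrightarrow> x \<in> carrier M \<Longrightarrow> f (r \<odot>\<^bsub>M\<^esub> x) = r \<odot>\<^bsub>N\<^esub> f x"
  shows "f \<in> mod_hom R M N"
  using assms by (auto simp: mod_hom_def)

lemma mod_hom_zero:
  assumes "module R M" "module R N" "f \<in> mod_hom R M N"
  shows "f \<zero>\<^bsub>M\<^esub> = \<zero>\<^bsub>N\<^esub>"
proof -
  interpret M: module R M by fact
  interpret N: module R N by fact
  have "f (\<zero>\<^bsub>R\<^esub> \<odot>\<^bsub>M\<^esub> \<zero>\<^bsub>M\<^esub>) = \<zero>\<^bsub>R\<^esub> \<odot>\<^bsub>N\<^esub> f \<zero>\<^bsub>M\<^esub>"
    by (rule mod_hom_smult[OF assms(3)]) auto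
  then show ?thesis
    using mod_hom_closed[OF assms(3)] by simp
qed

lemma mod_hom_minus:
  assumes "module R M" "module R N" "f \<in> mod_hom R M N" "x \<in> carrier M" "y \<in> carrier M"
  shows "f (x \<ominus>\<^bsub>M\<^esub> y) = f x \<ominus>\<^bsub>N\<^esub> f y"
proof -
  interpret M: module R M by fact
  interpret N: module R N by fact
  have "f (x \<ominus>\<^bsub>M\<^esub> y) \<oplus>\<^bsub>N\<^esub> f y = f ((x \<ominus>\<^bsub>M\<^esub> y) \<oplus>\<^bsub>M\<^esub> y)"
    using assms by (simp add: mod_hom_add)
  also have "(x \<ominus>\<^bsub>M\<^esub> y) \<oplus>\<^bsub>M\<^esub> y = x"
    using assms by (simp add: a_minus_def M.a_assoc M.l_neg)
  finally show ?thesis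
    using assms mod_hom_closed[OF assms(3)] N.add.inv_solve_right'[of "f (x \<ominus>\<^bsub>M\<^esub> y)" "f x" "f y"]
    by (metis M.minus_closed N.minus_eq N.add.inv_solve_right)
qed

lemma mod_hom_comp:
  "f \<in> mod_hom R M N \<Longrightarrow> g \<in> mod_hom R N P \<Longrightarrow> (\<lambda>x. g (f x)) \<in> mod_hom R M P"
  by (auto simp: mod_hom_def Pi_iff)

lemma mod_isoI:
  "f \<in> mod_hom R M N \<Longrightarrow> inj_on f (carrier M) \<Longrightarrow> f ` carrier M = carrier N \<Longrightarrow> f \<in> mod_iso R M N"
  by (auto simp: mod_iso_def bij_betw_def)

lemma mod_isoD:
  assumes "f \<in> mod_iso R M N"
  shows "f \<in> mod_hom R M N" "inj_on f (carrier M)" "f ` carrier M = carrier N"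
  using assms by (auto simp: mod_iso_def bij_betw_def)

lemma mod_iso_comp:
  "f \<in> mod_iso R M N \<Longrightarrow> g \<in> mod_iso R N P \<Longrightarrow> (\<lambda>x. g (f x)) \<in> mod_iso R M P"
  using bij_betw_trans[of f "carrier M" "carrier N" g "carrier P"]
  by (auto simp: mod_iso_def intro: mod_hom_comp simp: comp_def)

lemma mod_iso_inv:
  assumes "module R M" "f \<in> mod_iso R M N"
  shows "inv_into (carrier M) f \<in> mod_iso R N M"
proof (rule mod_isoI)
  interpret M: module R M by fact
  note f = mod_isoD[OF assms(2)]
  let ?g = "inv_into (carrier M) f"
  have g: "?g y \<in> carrier M" "f (?g y) = y" if "y \<in> carrier N" for y
    using that f(3) by (auto intro: inv_into_into f_inv_into_f)
  have *: "?g (f x) = x" if "x \<in> carrier M" for x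
    using that f by (simp add: inv_into_f_f)
  show "?g \<in> mod_hom R N M"
  proof (rule mod_homI)
    fix x y assume xy: "x \<in> carrier N" "y \<in> carrier N"
    have "?g (x \<oplus>\<^bsub>N\<^esub> y) = ?g (f (?g x \<oplus>\<^bsub>M\<^esub> ?g y))"
      using g xy by (simp add: mod_hom_add[OF f(1)])
    then show "?g (x \<oplus>\<^bsub>N\<^esub> y) = ?g x \<oplus>\<^bsub>M\<^esub> ?g y"
      using g xy by (simp add: *)
  next
    fix r y assume xy: "r \<in> carrier R" "y \<in> carrier N"
    have "?g (r \<odot>\<^bsub>N\<^esub> y) = ?g (f (r \<odot>\<^bsub>M\<^esub> ?g y))"
      using g xy by (simp add: mod_hom_smult[OF f(1)])
    then show "?g (r \<odot>\<^bsub>N\<^esub> y) = r \<odot>\<^bsub>M\<^esub> ?g y"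
      using g xy by (simp add: *)
  qed (use g in auto)
  show "inj_on ?g (carrier N)" using f(3) by (auto intro: inj_on_inv_into)
  show "?g ` carrier N = carrier M" using f by (force simp: *)
qed

text \<open>Provides the module axioms for quotients, transported copies and Hom(I, E) at once:
  equations in N lift to M along f. Preservation of zero is a separate hypothesis, since it follows
  from additivity only once N is known to be a group.\<close>

lemma surj_module:
  assumes "module R M" "f \<in> mod_hom R M N" "f ` carrier M = carrier N" "f \<zero>\<^bsub>M\<^esub> = \<zero>\<^bsub>N\<^esub>"
  shows "module R N"
proof -
  interpret M: module R M by fact
  have ex: "\<exists>x\<in>carrier M. f x = y" if "y \<in> carrier N" for y
    using that assms(3)[symmetric] by auto
  note h [simp] = mod_hom_add[OF assms(2), symmetric] mod_hom_smult[OF assms(2), symmetric]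
    mod_hom_closed[OF assms(2)] assms(4)[symmetric]
  show ?thesis
  proof (intro moduleI abelian_groupI M.R.is_cring)
    fix x y assume "x \<in> carrier N" "y \<in> carrier N"
    then show "x \<oplus>\<^bsub>N\<^esub> y \<in> carrier N" using ex[of x] ex[of y] by force
  next
    show "\<zero>\<^bsub>N\<^esub> \<in> carrier N" by simp
  next
    fix x y z assume "x \<in> carrier N" "y \<in> carrier N" "z \<in> carrier N"
    then show "x \<oplus>\<^bsub>N\<^esub> y \<oplus>\<^bsub>N\<^esub> z = x \<oplus>\<^bsub>N\<^esub> (y \<oplus>\<^bsub>N\<^esub> z)" using ex[of x] ex[of y] ex[of z]
      by (auto simp: M.a_assoc)
  next
    fix x y assume "x \<in> carrier N" "y \<in> carrier N"
    then show "x \<oplus>\<^bsub>N\<^esub> y = y \<oplus>\<^bsub>N\<^esub> x" using ex[of x] ex[of y] by (auto simp: M.a_comm)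
  next
    fix x assume "x \<in> carrier N"
    then show "\<zero>\<^bsub>N\<^esub> \<oplus>\<^bsub>N\<^esub> x = x" using ex[of x] by (auto simp del: assms(4))
  next
    fix x assume "x \<in> carrier N"
    then obtain u where u: "u \<in> carrier M" "f u = x" using ex by blast
    then have "f (\<ominus>\<^bsub>M\<^esub> u) \<oplus>\<^bsub>N\<^esub> x = \<zero>\<^bsub>N\<^esub>" by (auto simp: M.l_neg)
    then show "\<exists>y\<in>carrier N. y \<oplus>\<^bsub>N\<^esub> x = \<zero>\<^bsub>N\<^esub>" using u by (meson M.a_inv_closed h(3))
  next
    fix a x assume "a \<in> carrier R" "x \<in> carrier N"
    then show "a \<odot>\<^bsub>N\<^esub> x \<in> carrier N" using ex[of x] by auto
  next
    fix a b x assume "a \<in> carrier R" "b \<in> carrier R" "x \<in> carrier N"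
    then show "(a \<oplus>\<^bsub>R\<^esub> b) \<odot>\<^bsub>N\<^esub> x = (a \<odot>\<^bsub>N\<^esub> x) \<oplus>\<^bsub>N\<^esub> (b \<odot>\<^bsub>N\<^esub> x)" using ex[of x]
      by (auto simp: M.smult_l_distr)
  next
    fix a x y assume "a \<in> carrier R" "x \<in> carrier N" "y \<in> carrier N"
    then show "a \<odot>\<^bsub>N\<^esub> (x \<oplus>\<^bsub>N\<^esub> y) = (a \<odot>\<^bsub>N\<^esub> x) \<oplus>\<^bsub>N\<^esub> (a \<odot>\<^bsub>N\<^esub> y)" using ex[of x] ex[of y]
      by (auto simp: M.smult_r_distr)
  next
    fix a b x assume "a \<in> carrier R" "b \<in> carrier R" "x \<in> carrier N"
    then show "(a \<otimes>\<^bsub>R\<^esub> b) \<odot>\<^bsub>N\<^esub> x = a \<odot>\<^bsub>N\<^esub> (b \<odot>\<^bsub>N\<^esub> x)" using ex[of x]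
      by (auto simp: M.smult_assoc1)
  next
    fix x assume "x \<in> carrier N"
    then show "\<one>\<^bsub>R\<^esub> \<odot>\<^bsub>N\<^esub> x = x" using ex[of x] by auto
  qed
qed

section \<open>Submodules\<close>

lemma (in module) submodule_iff:
  "submodule H R M \<longleftrightarrow> H \<subseteq> carrier M \<and> \<zero>\<^bsub>M\<^esub> \<in> H \<and> (\<forall>x\<in>H. \<forall>y\<in>H. x \<oplus>\<^bsub>M\<^esub> y \<in> H)
     \<and> (\<forall>r\<in>carrier R. \<forall>x\<in>H. r \<odot>\<^bsub>M\<^esub> x \<in> H)" (is "_ \<longleftrightarrow> ?r")
proof
  assume H: "submodule H R M"
  then have "\<zero>\<^bsub>M\<^esub> \<in> H"
    using subgroup.one_closed[OF submodule.axioms(1)[OF H]] by simp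
  then show ?r using submoduleE[OF H] by auto
next
  assume r: ?r
  show "submodule H R M"
  proof (rule submoduleI)
    fix a assume "a \<in> H"
    moreover then have "\<ominus>\<^bsub>M\<^esub> a = (\<ominus> \<one>) \<odot>\<^bsub>M\<^esub> a"
      using r by (subst smult_l_minus) auto
    ultimately show "\<ominus>\<^bsub>M\<^esub> a \<in> H" using r by auto
  qed (use r in auto)
qed

lemma (in module) submoduleD:
  assumes "submodule H R M"
  shows "x \<in> H \<Longrightarrow> x \<in> carrier M" "\<zero>\<^bsub>M\<^esub> \<in> H" "x \<in> H \<Longrightarrow> y \<in> H \<Longrightarrow> x \<oplus>\<^bsub>M\<^esub> y \<in> H"
    "r \<in> carrier R \<Longrightarrow> x \<in> H \<Longrightarrow> r \<odot>\<^bsub>M\<^esub> x \<in> H" "x \<in> H \<Longrightarrow> y \<in> H \<Longrightarrow> x \<ominus>\<^bsub>M\<^esub> y \<in> H"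
  using assms submoduleE(3)[OF assms] unfolding submodule_iff by (auto simp: a_minus_def)

lemma submodule_module:
  "module R M \<Longrightarrow> submodule H R M \<Longrightarrow> module R (M\<lparr>carrier := H\<rparr>)"
  by (rule submodule.submodule_is_module)

lemma submodule_submodule:
  assumes "module R M" "submodule H R M"
  shows "submodule K R (M\<lparr>carrier := H\<rparr>) \<longleftrightarrow> submodule K R M \<and> K \<subseteq> H"
proof -
  interpret M: module R M by fact
  interpret H: module R "M\<lparr>carrier := H\<rparr>" by (rule submodule_module) fact+
  show ?thesis
    using M.submoduleE(1)[OF assms(2)] unfolding M.submodule_iff H.submodule_iff by auto
qed

lemma submodule_image:
  assumes "module R M" "module R N" "f \<in> mod_hom R M N" "submodule H R M"
  shows "submodule (f ` H) R N"
proof -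
  interpret M: module R M by fact
  interpret N: module R N by fact
  note H = assms(4)[unfolded M.submodule_iff]
  note h = mod_hom_add[OF assms(3), symmetric] mod_hom_smult[OF assms(3), symmetric]
    mod_hom_closed[OF assms(3)] mod_hom_zero[OF assms(1-3), symmetric]
  show ?thesis unfolding N.submodule_iff using H
    by (auto simp: h subset_iff)
qed

lemma submodule_vimage:
  assumes "module R M" "module R N" "f \<in> mod_hom R M N" "submodule K R N"
  shows "submodule {x \<in> carrier M. f x \<in> K} R M"
proof -
  interpret M: module R M by fact
  interpret N: module R N by fact
  note K = assms(4)[unfolded N.submodule_iff]
  note h = mod_hom_add[OF assms(3)] mod_hom_smult[OF assms(3)] mod_hom_zero[OF assms(1-3)]
  show ?thesis unfolding M.submodule_iff using K by (auto simp: h)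
qed

lemma mod_hom_restrict:
  "f \<in> mod_hom R M N \<Longrightarrow> H \<subseteq> carrier M \<Longrightarrow> f ` H \<subseteq> K \<Longrightarrow>
    f \<in> mod_hom R (M\<lparr>carrier := H\<rparr>) (N\<lparr>carrier := K\<rparr>)"
  by (auto simp: mod_hom_def Pi_iff subset_iff)

lemma mod_hom_into_submodule:
  "f \<in> mod_hom R M N \<Longrightarrow> f ` carrier M \<subseteq> K \<Longrightarrow> f \<in> mod_hom R M (N\<lparr>carrier := K\<rparr>)"
  by (auto simp: mod_hom_def Pi_iff subset_iff)

lemma mod_hom_from_submodule:
  "f \<in> mod_hom R M N \<Longrightarrow> H \<subseteq> carrier M \<Longrightarrow> f \<in> mod_hom R (M\<lparr>carrier := H\<rparr>) N"
  by (auto simp: mod_hom_def Pi_iff subset_iff)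

lemma mod_hom_id: "(\<lambda>x. x) \<in> mod_hom R M M"
  by (auto simp: mod_hom_def)

lemma submodule_ann_in:
  assumes "module R M" "I \<subseteq> carrier R"
  shows "submodule (ann_in M I) R M"
proof -
  interpret M: module R M by fact
  have "i \<odot>\<^bsub>M\<^esub> (r \<odot>\<^bsub>M\<^esub> x) = \<zero>\<^bsub>M\<^esub>"
    if "r \<in> carrier R" "x \<in> carrier M" "\<forall>r\<in>I. r \<odot>\<^bsub>M\<^esub> x = \<zero>\<^bsub>M\<^esub>" "i \<in> I" for r x i
    using that assms(2) M.smult_assoc1[of i r x] M.smult_assoc1[of r i x]
    by (auto simp: M.R.m_comm subset_iff)
  then show ?thesis unfolding M.submodule_iff ann_in_def using assms(2)
    by (auto simp: M.smult_r_distr subset_iff)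
qed

lemma ann_in_submodule:
  "H \<subseteq> carrier M \<Longrightarrow> ann_in (M\<lparr>carrier := H\<rparr>) I = ann_in M I \<inter> H"
  by (auto simp: ann_in_def)

lemma ann_in_hom:
  assumes "module R M" "module R N" "f \<in> mod_hom R M N" "I \<subseteq> carrier R" "x \<in> ann_in M I"
  shows "f x \<in> ann_in N I"
  using assms(4,5) mod_hom_zero[OF assms(1-3)] mod_hom_closed[OF assms(3)]
    mod_hom_smult[OF assms(3), symmetric] by (auto simp: ann_in_def subset_iff)

lemma (in module) minus_eq_zero_iff:
  "x \<in> carrier M \<Longrightarrow> y \<in> carrier M \<Longrightarrow> x \<ominus>\<^bsub>M\<^esub> y = \<zero>\<^bsub>M\<^esub> \<longleftrightarrow> x = y"
  using M.add.inv_solve_right'[of "\<zero>\<^bsub>M\<^esub>" x y] by (simp add: a_minus_def)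

lemma (in module) submodule_abelian_subgroup:
  assumes "submodule L R M" shows "abelian_subgroup L M"
proof (rule abelian_subgroupI3)
  show "additive_subgroup L M"
    using assms by (auto simp: additive_subgroup_def submodule_def)
  show "abelian_group M" by (rule M.abelian_group_axioms)
qed

section \<open>Cosets and quotient modules\<close>

context
  fixes R :: "('a, 'r) ring_scheme" and M :: "('a, 'b) module" and L
  assumes M: "module R M" and L: "submodule L R M"
begin

interpretation M: module R M by (rule M)

interpretation L: abelian_subgroup L M by (rule M.submodule_abelian_subgroup[OF L])

lemma rcoset_eq_iff:
  assumes "x \<in> carrier M" "y \<in> carrier M"
  shows "L +>\<^bsub>M\<^esub> x = L +>\<^bsub>M\<^esub> y \<longleftrightarrow> x \<ominus>\<^bsub>M\<^esub> y \<in> L"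
proof -
  have "L +>\<^bsub>M\<^esub> x = L +>\<^bsub>M\<^esub> y \<longleftrightarrow> x \<in> L +>\<^bsub>M\<^esub> y"
    using L.a_repr_independence'[OF _ assms(2), of x] L.a_rcos_self[OF assms(1)] by metis
  also have "\<dots> \<longleftrightarrow> x \<ominus>\<^bsub>M\<^esub> y \<in> L"
    using L.a_rcos_module[of y x] assms by (simp add: a_minus_def)
  finally show ?thesis .
qed

lemma rcoset_eq_self_iff:
  assumes "x \<in> carrier M"
  shows "L +>\<^bsub>M\<^esub> x = L \<longleftrightarrow> x \<in> L"
proof -
  have "L +>\<^bsub>M\<^esub> \<zero>\<^bsub>M\<^esub> = L" by (rule M.a_coset_add_zero[OF M.submoduleE(1)[OF L]])
  moreover have "x \<ominus>\<^bsub>M\<^esub> \<zero>\<^bsub>M\<^esub> = x" using assms by (simp add: a_minus_def)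
  ultimately show ?thesis using rcoset_eq_iff[OF assms M.zero_closed] by metis
qed

text \<open>The scalar action of \<open>quotient_module\<close> is a union over all representatives
  of a coset. All members of this union are one and the same coset, because L is stable under
  r.\<close>

lemma rcoset_smult:
  assumes "r \<in> carrier R" "x \<in> carrier M"
  shows "(\<Union>y\<in>L +>\<^bsub>M\<^esub> x. L +>\<^bsub>M\<^esub> (r \<odot>\<^bsub>M\<^esub> y)) = L +>\<^bsub>M\<^esub> (r \<odot>\<^bsub>M\<^esub> x)"
proof -
  have *: "L +>\<^bsub>M\<^esub> (r \<odot>\<^bsub>M\<^esub> y) = L +>\<^bsub>M\<^esub> (r \<odot>\<^bsub>M\<^esub> x)" if y: "y \<in> L +>\<^bsub>M\<^esub> x" for y
  proof -
    have yc: "y \<in> carrier M" using y assms(2) by (meson L.a_elemrcos_carrier)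
    have "y \<ominus>\<^bsub>M\<^esub> x \<in> L" using y yc assms(2) L.a_rcos_module[of x y] by (simp add: a_minus_def)
    then have "r \<odot>\<^bsub>M\<^esub> (y \<ominus>\<^bsub>M\<^esub> x) \<in> L" using M.submoduleE(4)[OF L] assms by auto
    then show ?thesis using assms yc
      by (subst rcoset_eq_iff) (auto simp: a_minus_def M.smult_r_distr M.smult_r_minus)
  qed
  have "L +>\<^bsub>M\<^esub> x \<noteq> {}" using L.a_rcos_self[OF assms(2)] by (metis empty_iff)
  then show ?thesis using * by (rule SUP_eq_const)
qed

lemma quotient_carrier: "carrier (quotient_module R M L) = (\<lambda>x. L +>\<^bsub>M\<^esub> x) ` carrier M"
  by (auto simp: quotient_module_def A_RCOSETS_def')

lemma quotient_proj: "(\<lambda>x. L +>\<^bsub>M\<^esub> x) \<in> mod_hom R M (quotient_module R M L)"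
  using L.a_rcos_sum rcoset_smult by (intro mod_homI) (auto simp: quotient_module_def A_RCOSETS_def')

lemma quotient_zero: "\<zero>\<^bsub>quotient_module R M L\<^esub> = L"
  by (simp add: quotient_module_def)

lemma quotient_is_module: "module R (quotient_module R M L)"
  using quotient_proj by (rule surj_module[rotated])
   (auto simp: quotient_carrier quotient_zero rcoset_eq_self_iff M.submoduleD(2)[OF L] M)

end

lemma quotient_map:
  assumes "module R M" "module R N" "submodule L R M" "g \<in> mod_hom R M N"
    and "\<And>x. x \<in> L \<Longrightarrow> g x = \<zero>\<^bsub>N\<^esub>"
  obtains h where "h \<in> mod_hom R (quotient_module R M L) N"
    "\<And>x. x \<in> carrier M \<Longrightarrow> h (L +>\<^bsub>M\<^esub> x) = g x"
proof -
  interpret M: module R M by fact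
  interpret N: module R N by fact
  \<comment> \<open>Two representatives of C differ by an element of L, which g kills, so the
    description determines a unique y.\<close>
  define h where "h C = (THE y. \<exists>x\<in>carrier M. C = L +>\<^bsub>M\<^esub> x \<and> y = g x)" for C
  have h: "h (L +>\<^bsub>M\<^esub> x) = g x" if x: "x \<in> carrier M" for x
    unfolding h_def
  proof (rule the_equality)
    fix y assume "\<exists>x'\<in>carrier M. L +>\<^bsub>M\<^esub> x = L +>\<^bsub>M\<^esub> x' \<and> y = g x'"
    then obtain x' where x': "x' \<in> carrier M" "L +>\<^bsub>M\<^esub> x = L +>\<^bsub>M\<^esub> x'" "y = g x'" by blast
    then have "x \<ominus>\<^bsub>M\<^esub> x' \<in> L" using x rcoset_eq_iff[OF assms(1,3)] by simp
    then have "g x \<ominus>\<^bsub>N\<^esub> g x' = \<zero>\<^bsub>N\<^esub>"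
      using assms(5) mod_hom_minus[OF assms(1,2,4) x x'(1)] by simp
    then have "g x = g x'" using x x' mod_hom_closed[OF assms(4)]
      by (metis N.minus_eq_zero_iff)
    then show "y = g x" using x' by simp
  qed (use x in auto)
  let ?Q = "quotient_module R M L"
  note Q = quotient_carrier[OF assms(1,3)] and p = quotient_proj[OF assms(1,3)]
  have "h \<in> mod_hom R ?Q N"
  proof (rule mod_homI)
    fix A B assume "A \<in> carrier ?Q" "B \<in> carrier ?Q"
    then obtain a b where ab: "a \<in> carrier M" "b \<in> carrier M" "A = L +>\<^bsub>M\<^esub> a" "B = L +>\<^bsub>M\<^esub> b"
      unfolding Q by auto
    then show "h (A \<oplus>\<^bsub>?Q\<^esub> B) = h A \<oplus>\<^bsub>N\<^esub> h B"
      using mod_hom_add[OF p, of a b] by (metis M.a_closed h mod_hom_add[OF assms(4)])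
  next
    fix r A assume "r \<in> carrier R" "A \<in> carrier ?Q"
    moreover then obtain a where ab: "a \<in> carrier M" "A = L +>\<^bsub>M\<^esub> a"
      unfolding Q by auto
    ultimately show "h (r \<odot>\<^bsub>?Q\<^esub> A) = r \<odot>\<^bsub>N\<^esub> h A"
      using mod_hom_smult[OF p, of r a] by (metis M.smult_closed h mod_hom_smult[OF assms(4)])
  qed (use h mod_hom_closed[OF assms(4)] in \<open>auto simp: Q\<close>)
  with h show thesis using that by blast
qed

lemma first_isomorphism:
  assumes "module R M" "module R N" "g \<in> mod_hom R M N" "g ` carrier M = carrier N"
    and "L = {x \<in> carrier M. g x = \<zero>\<^bsub>N\<^esub>}"
  obtains h where "submodule L R M" "h \<in> mod_iso R (quotient_module R M L) N"
    "\<And>x. x \<in> carrier M \<Longrightarrow> h (L +>\<^bsub>M\<^esub> x) = g x"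
proof -
  interpret M: module R M by fact
  interpret N: module R N by fact
  have L: "submodule L R M"
    using submodule_vimage[OF assms(1-3), of "{\<zero>\<^bsub>N\<^esub>}"] assms(5) N.submodule_iff by simp
  have ker: "g x = \<zero>\<^bsub>N\<^esub>" if "x \<in> L" for x using that assms(5) by simp
  obtain h where h: "h \<in> mod_hom R (quotient_module R M L) N"
    "\<And>x. x \<in> carrier M \<Longrightarrow> h (L +>\<^bsub>M\<^esub> x) = g x"
    using quotient_map[OF assms(1,2) L assms(3) ker] by metis
  have "inj_on h (carrier (quotient_module R M L))"
  proof (rule inj_onI)
    fix A B assume "A \<in> carrier (quotient_module R M L)" "B \<in> carrier (quotient_module R M L)"
      and eq: "h A = h B"
    then obtain a b where ab: "a \<in> carrier M" "b \<in> carrier M" "A = L +>\<^bsub>M\<^esub> a" "B = L +>\<^bsub>M\<^esub> b"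
      unfolding quotient_carrier[OF assms(1) L] by auto
    then have "g (a \<ominus>\<^bsub>M\<^esub> b) = \<zero>\<^bsub>N\<^esub>"
      using eq h(2) mod_hom_closed[OF assms(3)]
      by (simp add: mod_hom_minus[OF assms(1-3)] N.minus_eq_zero_iff)
    then show "A = B" using ab rcoset_eq_iff[OF assms(1) L] assms(5) by simp
  qed
  moreover have "h ` carrier (quotient_module R M L) = carrier N"
    using assms(4) h(2) unfolding quotient_carrier[OF assms(1) L] by (force simp: image_image)
  ultimately show thesis using that L h by (blast intro: mod_isoI)
qed

text \<open>The copy of M on the image of an injection j, with the operations conjugated by j. It
  brings modules built from R or from cosets into the type \<open>'u\<close>, where selectors and
  injectivity apply.\<close>

definition transport :: "('a, 'b) module \<Rightarrow> ('b \<Rightarrow> 'c) \<Rightarrow> ('a, 'c) module" where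
  "transport M j = (let i = inv_into (carrier M) j in
     \<lparr>carrier = j ` carrier M, monoid.mult = undefined, one = undefined, ring.zero = j \<zero>\<^bsub>M\<^esub>,
      ring.add = (\<lambda>x y. j (i x \<oplus>\<^bsub>M\<^esub> i y)), smult = (\<lambda>r x. j (r \<odot>\<^bsub>M\<^esub> i x))\<rparr>)"

lemma transport_iso:
  assumes "inj_on j (carrier M)" shows "j \<in> mod_iso R M (transport M j)"
  by (intro mod_isoI mod_homI) (use assms in \<open>auto simp: transport_def Let_def inv_into_f_f\<close>)

lemma transport_module:
  assumes "module R M" "inj_on j (carrier M)" shows "module R (transport M j)"
proof (rule surj_module[OF assms(1)])
  show "j \<in> mod_hom R M (transport M j)" "j ` carrier M = carrier (transport M j)"
    using mod_isoD[OF transport_iso[OF assms(2), of R]] by auto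
qed (simp add: transport_def Let_def)

section \<open>The ring as a module over itself\<close>

lemma regular_simps [simp]:
  "carrier (regular_module R) = carrier R" "\<zero>\<^bsub>regular_module R\<^esub> = \<zero>\<^bsub>R\<^esub>"
  "x \<oplus>\<^bsub>regular_module R\<^esub> y = x \<oplus>\<^bsub>R\<^esub> y" "r \<odot>\<^bsub>regular_module R\<^esub> x = r \<otimes>\<^bsub>R\<^esub> x"
  by (auto simp: regular_module_def)

lemma (in cring) regular_is_module: "module R (regular_module R)"
  by (intro moduleI abelian_groupI is_cring)
    (auto simp: a_ac l_distr r_distr m_assoc intro: add.l_inv_ex)

lemma (in cring) submodule_regular_iff: "submodule H R (regular_module R) \<longleftrightarrow> ideal H R"
proof -
  interpret M: module R "regular_module R" by (rule regular_is_module)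
  show ?thesis
  proof
    assume H: "submodule H R (regular_module R)"
    show "ideal H R"
    proof (rule idealI[OF ring_axioms])
      have "subgroup H (add_monoid (regular_module R))"
        using H by (rule submodule.axioms)
      \<comment> \<open>The two additive monoids are different records with the same carrier,
        operation and unit, and an inverse depends on nothing else.\<close>
      moreover have "inv\<^bsub>add_monoid (regular_module R)\<^esub> x = inv\<^bsub>add_monoid R\<^esub> x" for x
        by (simp add: m_inv_def)
      ultimately show "subgroup H (add_monoid R)"
        by (auto simp: subgroup_def)
      fix a x assume ax: "a \<in> H" "x \<in> carrier R"
      show "x \<otimes> a \<in> H" using M.submoduleD(4)[OF H, of x a] ax by simp
      then show "a \<otimes> x \<in> H" using M.submoduleD(1)[OF H, of a] ax m_comm[of a x] by simp
    qed
  next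
    assume H: "ideal H R"
    then show "submodule H R (regular_module R)" unfolding M.submodule_iff
      using ideal.Icarr[OF H] ideal.I_l_closed[OF H]
        additive_subgroup.a_closed[OF ideal.axioms(1)[OF H]]
        additive_subgroup.zero_closed[OF ideal.axioms(1)[OF H]] by auto
  qed
qed

section \<open>Chain conditions and length\<close>

lemma artinian_module: "artinian R M \<Longrightarrow> module R M"
  by (simp add: artinian_def)

lemma image_preimage_eq: "K \<subseteq> g ` S \<Longrightarrow> K = g ` {x \<in> S. g x \<in> K}"
  by auto

text \<open>By surjectivity a descending chain in N is the image of the chain of its preimages, so
  it is constant from the index where the preimages become constant.\<close>

lemma artinian_surj:
  assumes "artinian R M" "module R N" "g \<in> mod_hom R M N" "g ` carrier M = carrier N"
  shows "artinian R N"
  unfolding artinian_def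
proof (intro conjI allI impI assms(2))
  fix K :: "nat \<Rightarrow> _" assume K: "\<forall>n. submodule (K n) R N \<and> K (Suc n) \<subseteq> K n"
  interpret N: module R N by fact
  define P where "P n = {x \<in> carrier M. g x \<in> K n}" for n
  have "submodule (P n) R M \<and> P (Suc n) \<subseteq> P n" for n
    using K submodule_vimage[OF artinian_module[OF assms(1)] assms(2,3), of "K n"]
    unfolding P_def by auto
  then obtain k where k: "\<forall>n\<ge>k. P n = P k"
    using assms(1) unfolding artinian_def by blast
  have "K n = g ` P n" for n
    using N.submoduleE(1)[of "K n"] K assms(4) unfolding P_def by (intro image_preimage_eq) auto
  then show "\<exists>k. \<forall>n\<ge>k. K n = K k" using k by metis
qed

lemma artinian_iso:
  "artinian R M \<Longrightarrow> module R N \<Longrightarrow> g \<in> mod_iso R M N \<Longrightarrow> artinian R N"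
  using artinian_surj mod_isoD by metis

lemma artinian_submodule:
  assumes "artinian R M" "submodule H R M"
  shows "artinian R (M\<lparr>carrier := H\<rparr>)"
  using assms submodule_module[OF artinian_module[OF assms(1)] assms(2)]
    submodule_submodule[OF artinian_module[OF assms(1)] assms(2)]
  unfolding artinian_def by metis

lemma artinian_quotient:
  assumes "artinian R M" "submodule L R M"
  shows "artinian R (quotient_module R M L)"
  using assms artinian_module[OF assms(1)]
  by (intro artinian_surj[OF assms(1) quotient_is_module quotient_proj]) (auto simp: quotient_carrier)

section \<open>Spans and finite generation\<close>

definition span_of :: "('a, 'r) ring_scheme \<Rightarrow> ('a, 'b) module \<Rightarrow> 'b set \<Rightarrow> 'b set" where
  "span_of R M A = \<Inter> {N. submodule N R M \<and> A \<subseteq> N}"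

lemma span_of_least: "submodule N R M \<Longrightarrow> A \<subseteq> N \<Longrightarrow> span_of R M A \<subseteq> N"
  by (auto simp: span_of_def)

lemma span_of_superset: "A \<subseteq> span_of R M A"
  by (auto simp: span_of_def)

lemma span_of_submodule:
  assumes "module R M" "A \<subseteq> carrier M"
  shows "submodule (span_of R M A) R M"
proof -
  interpret M: module R M by fact
  show ?thesis
    unfolding span_of_def using assms(2) M.carrier_is_submodule M.submoduleD
    by (intro M.submodule_iff[THEN iffD2]) auto
qed

text \<open>The span formed in M lies in H, hence is a submodule of H, and submodules of H are
  submodules of M. So finite generation of H can be tested in the ambient module.\<close>

lemma span_of_submodule_eq:
  assumes "module R M" "submodule H R M" "A \<subseteq> H"
  shows "span_of R (M\<lparr>carrier := H\<rparr>) A = span_of R M A"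
proof
  interpret M: module R M by fact
  have "submodule (span_of R M A) R M"
    using assms M.submoduleD(1)[OF assms(2)] by (intro span_of_submodule) auto
  moreover have "span_of R M A \<subseteq> H" using assms by (intro span_of_least)
  ultimately show "span_of R (M\<lparr>carrier := H\<rparr>) A \<subseteq> span_of R M A"
    by (intro span_of_least span_of_superset) (simp add: submodule_submodule[OF assms(1,2)])
  show "span_of R M A \<subseteq> span_of R (M\<lparr>carrier := H\<rparr>) A"
    using assms by (auto simp: span_of_def submodule_submodule[OF assms(1,2)])
qed

lemma finitely_generated_iff:
  "finitely_generated R M \<longleftrightarrow> module R M \<and> (\<exists>A\<subseteq>carrier M. finite A \<and> carrier M = span_of R M A)"
  by (simp add: finitely_generated_def span_of_def)

lemma finitely_generated_submodule_iff:
  assumes "module R M" "submodule H R M"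
  shows "finitely_generated R (M\<lparr>carrier := H\<rparr>) \<longleftrightarrow> (\<exists>A\<subseteq>H. finite A \<and> H = span_of R M A)"
  using submodule_module[OF assms] span_of_submodule_eq[OF assms]
  by (auto simp: finitely_generated_iff)

lemma finitely_generated_span_of:
  assumes "module R M" "A \<subseteq> carrier M" "finite A"
  shows "finitely_generated R (M\<lparr>carrier := span_of R M A\<rparr>)"
  using finitely_generated_submodule_iff[OF assms(1) span_of_submodule[OF assms(1,2)]]
    span_of_superset[of A R M] assms(3) by metis

lemma span_of_image:
  assumes "module R M" "module R N" "g \<in> mod_hom R M N" "A \<subseteq> carrier M"
  shows "span_of R N (g ` A) = g ` span_of R M A"
proof
  show "span_of R N (g ` A) \<subseteq> g ` span_of R M A"
    using span_of_submodule[OF assms(1,4)]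
    by (intro span_of_least submodule_image[OF assms(1-3)] image_mono span_of_superset)
  interpret N: module R N by fact
  have "submodule (span_of R N (g ` A)) R N"
    using assms(4) mod_hom_closed[OF assms(3)] by (intro span_of_submodule assms) auto
  then have "submodule {x \<in> carrier M. g x \<in> span_of R N (g ` A)} R M"
    using submodule_vimage assms by blast
  then have "span_of R M A \<subseteq> {x \<in> carrier M. g x \<in> span_of R N (g ` A)}"
    by (rule span_of_least) (use assms(4) span_of_superset[of "g ` A"] in blast)
  then show "g ` span_of R M A \<subseteq> span_of R N (g ` A)" by auto
qed

lemma finitely_generated_image:
  assumes "finitely_generated R M" "module R N" "g \<in> mod_hom R M N"
  shows "finitely_generated R (N\<lparr>carrier := g ` carrier M\<rparr>)"
proof -
  obtain A where A: "module R M" "A \<subseteq> carrier M" "finite A" "carrier M = span_of R M A"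
    using assms(1) finitely_generated_iff by metis
  have "g ` carrier M = span_of R N (g ` A)"
    using span_of_image[OF A(1) assms(2,3) A(2)] A(4) by metis
  moreover have "g ` A \<subseteq> carrier N" using A(2) mod_hom_closed[OF assms(3)] by auto
  ultimately show ?thesis
    using finitely_generated_span_of[OF assms(2), of "g ` A"] A(3) by simp
qed

section \<open>Chains of submodules and finite length\<close>

definition submodule_chain ::
  "('a, 'r) ring_scheme \<Rightarrow> ('a, 'b) module \<Rightarrow> nat \<Rightarrow> (nat \<Rightarrow> 'b set) \<Rightarrow> bool" where
  "submodule_chain R M n C \<longleftrightarrow> (\<forall>i\<le>n. submodule (C i) R M) \<and> (\<forall>i<n. C i \<subset> C (Suc i))"

lemma submodule_chain_snoc:
  "submodule_chain R M n C \<Longrightarrow> submodule D R M \<Longrightarrow> C n \<subset> D \<Longrightarrow>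
    submodule_chain R M (Suc n) (C(Suc n := D))"
  by (auto simp: submodule_chain_def le_Suc_eq less_Suc_eq)

text \<open>The body of \<open>submodule_chain\<close> occurs literally in
  \<open>module_length\<close>; it is folded back first, and then only a supremum in
  \<open>enat\<close> has to be bounded.\<close>

lemma module_length_finite_iff:
  "module_length R M < \<infinity> \<longleftrightarrow> (\<exists>b. \<forall>n C. submodule_chain R M n C \<longrightarrow> n \<le> b)"
proof
  assume "module_length R M < \<infinity>"
  then obtain b where b: "module_length R M = enat b" by auto
  have "n \<le> b" if "submodule_chain R M n C" for n C
  proof -
    have "enat n \<le> module_length R M" unfolding module_length_def submodule_chain_def[symmetric]
      by (rule Sup_upper) (use that in blast)
    then show ?thesis using b by simp
  qed
  then show "\<exists>b. \<forall>n C. submodule_chain R M n C \<longrightarrow> n \<le> b" by blast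
next
  assume "\<exists>b. \<forall>n C. submodule_chain R M n C \<longrightarrow> n \<le> b"
  then obtain b where "\<forall>n C. submodule_chain R M n C \<longrightarrow> n \<le> b" by blast
  then have "module_length R M \<le> enat b" unfolding module_length_def submodule_chain_def[symmetric]
    by (intro Sup_least) auto
  also have "enat b < \<infinity>" by simp
  finally show "module_length R M < \<infinity>" .
qed

lemma unbounded_chains_infinite_length:
  assumes "\<And>b. \<exists>C. submodule_chain R M b C"
  shows "\<not> module_length R M < \<infinity>"
proof
  assume "module_length R M < \<infinity>"
  then obtain b where "\<forall>n C. submodule_chain R M n C \<longrightarrow> n \<le> b"
    unfolding module_length_finite_iff by metis
  then show False using assms[of "Suc b"] by (auto dest: spec[of _ "Suc b"])
qed

text \<open>Chains are counted upwards, so the induction produces chains with a prescribed top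
  \<open>N k\<close>: some later \<open>N n\<close> is strictly smaller, a chain ending at
  \<open>N n\<close> exists by induction, and \<open>N k\<close> is put on top.\<close>

lemma finite_length_artinian:
  assumes "module R M" "module_length R M < \<infinity>"
  shows "artinian R M"
proof (rule ccontr)
  assume "\<not> artinian R M"
  then obtain N where N: "\<forall>n::nat. submodule (N n) R M \<and> N (Suc n) \<subseteq> N n"
    and ns: "\<not> (\<exists>k. \<forall>n\<ge>k. N n = N k)"
    using assms(1) unfolding artinian_def by auto
  have anti: "N n \<subseteq> N k" if "k \<le> n" for n k
    using lift_Suc_antimono_le[of N, OF _ that] N by simp
  have "\<exists>C. submodule_chain R M b C \<and> C b = N k" for b k
  proof (induction b arbitrary: k)
    case 0
    show ?case using N by (intro exI[of _ "\<lambda>_. N k"]) (auto simp: submodule_chain_def)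
  next
    case (Suc b)
    obtain n where n: "n \<ge> k" "N n \<noteq> N k" using ns by blast
    obtain C where C: "submodule_chain R M b C" "C b = N n"
      using Suc by metis
    have "C b \<subset> N k" using n anti[OF n(1)] C(2) by simp
    then have "submodule_chain R M (Suc b) (C(Suc b := N k))"
      using submodule_chain_snoc[OF C(1)] N by simp
    then show ?case by (metis fun_upd_same)
  qed
  then show False using unbounded_chains_infinite_length assms(2) by metis
qed

text \<open>If no finite set generates M, adjoining one missing element after another gives strictly
  increasing spans, hence chains of every length.\<close>

lemma finite_length_finitely_generated:
  assumes "module R M" "module_length R M < \<infinity>"
  shows "finitely_generated R M"
proof (rule ccontr)
  assume nfg: "\<not> finitely_generated R M"
  interpret M: module R M by fact
  have ex: "\<exists>x\<in>carrier M. x \<notin> span_of R M A" if A: "finite A" "A \<subseteq> carrier M" for A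
  proof (rule ccontr)
    assume "\<not> ?thesis"
    then have "carrier M = span_of R M A"
      using M.submoduleE(1)[OF span_of_submodule[OF assms(1) A(2)]] by auto
    then show False using nfg A assms(1) unfolding finitely_generated_iff by metis
  qed
  have "\<exists>A C. finite A \<and> A \<subseteq> carrier M \<and> submodule_chain R M b C \<and> C b = span_of R M A" for b
  proof (induction b)
    case 0
    show ?case using span_of_submodule[OF assms(1), of "{}"]
      by (intro exI[of _ "{}"] exI[of _ "\<lambda>_. span_of R M {}"]) (auto simp: submodule_chain_def)
  next
    case (Suc b)
    then obtain A C where C: "finite A" "A \<subseteq> carrier M" "submodule_chain R M b C" "C b = span_of R M A"
      by metis
    obtain x where x: "x \<in> carrier M" "x \<notin> span_of R M A" using ex[OF C(1,2)] by metis
    let ?B = "insert x A"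
    have B: "submodule (span_of R M ?B) R M" using C x by (intro span_of_submodule assms) auto
    have "span_of R M A \<subseteq> span_of R M ?B"
      using span_of_superset[of ?B R M] by (intro span_of_least B) auto
    moreover have "x \<in> span_of R M ?B" using span_of_superset[of ?B R M] by auto
    ultimately have "C b \<subset> span_of R M ?B" using x C(4) by auto
    then have "submodule_chain R M (Suc b) (C(Suc b := span_of R M ?B))"
      using submodule_chain_snoc[OF C(3) B] by simp
    moreover have "finite ?B" "?B \<subseteq> carrier M" using C x by auto
    ultimately show ?case by (metis fun_upd_same)
  qed
  then show False using unbounded_chains_infinite_length assms(2) by metis
qed

text \<open>Preimages of a strict chain remain distinct, because surjectivity recovers each member
  as the image of its preimage.\<close>

lemma finite_length_surj:
  assumes "module R M" "module R N" "g \<in> mod_hom R M N" "g ` carrier M = carrier N"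
    and "module_length R M < \<infinity>"
  shows "module_length R N < \<infinity>"
proof -
  interpret N: module R N by fact
  obtain b where b: "\<forall>n C. submodule_chain R M n C \<longrightarrow> n \<le> b"
    using assms(5) unfolding module_length_finite_iff by metis
  have "n \<le> b" if C: "submodule_chain R N n C" for n C
  proof -
    let ?D = "\<lambda>i. {x \<in> carrier M. g x \<in> C i}"
    have sub: "submodule (C i) R N" if "i \<le> n" for i using C that by (simp add: submodule_chain_def)
    have im: "C i = g ` ?D i" if "i \<le> n" for i
      using N.submoduleE(1)[OF sub[OF that]] assms(4) by (intro image_preimage_eq) auto
    have "?D i \<subset> ?D (Suc i)" if "i < n" for i
    proof
      have i: "C i \<subset> C (Suc i)" using C that by (simp add: submodule_chain_def)
      then show "?D i \<subseteq> ?D (Suc i)" by auto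
      show "?D i \<noteq> ?D (Suc i)" using i im[of i] im[of "Suc i"] that
        by (metis Suc_leI less_imp_le psubset_eq)
    qed
    then have "submodule_chain R M n ?D"
      using sub submodule_vimage[OF assms(1-3)] by (simp add: submodule_chain_def)
    then show ?thesis using b by blast
  qed
  then show ?thesis unfolding module_length_finite_iff by metis
qed

section \<open>Counting simple factors over a local ring\<close>

definition adj :: "('a, 'r) ring_scheme \<Rightarrow> ('a, 'b) module \<Rightarrow> 'b set \<Rightarrow> 'b \<Rightarrow> 'b set" where
  "adj R M U e = {x \<oplus>\<^bsub>M\<^esub> r \<odot>\<^bsub>M\<^esub> e | x r. x \<in> U \<and> r \<in> carrier R}"

lemma adj_submodule:
  assumes "module R M" "submodule U R M" "e \<in> carrier M"
  shows "submodule (adj R M U e) R M" "U \<subseteq> adj R M U e" "e \<in> adj R M U e"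
proof -
  interpret M: module R M by fact
  note U = M.submoduleD[OF assms(2)]
  show "submodule (adj R M U e) R M" unfolding M.submodule_iff
  proof (intro conjI ballI)
    show "adj R M U e \<subseteq> carrier M" using U assms(3) by (auto simp: adj_def)
    show "\<zero>\<^bsub>M\<^esub> \<in> adj R M U e" using U(2) assms(3) unfolding adj_def
      by (intro CollectI exI[of _ "\<zero>\<^bsub>M\<^esub>"] exI[of _ "\<zero>\<^bsub>R\<^esub>"]) auto
  next
    fix u v assume "u \<in> adj R M U e" "v \<in> adj R M U e"
    then obtain x r y s where u: "u = x \<oplus>\<^bsub>M\<^esub> r \<odot>\<^bsub>M\<^esub> e" "x \<in> U" "r \<in> carrier R"
      and v: "v = y \<oplus>\<^bsub>M\<^esub> s \<odot>\<^bsub>M\<^esub> e" "y \<in> U" "s \<in> carrier R" unfolding adj_def by blast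
    have "u \<oplus>\<^bsub>M\<^esub> v = (x \<oplus>\<^bsub>M\<^esub> y) \<oplus>\<^bsub>M\<^esub> (r \<oplus>\<^bsub>R\<^esub> s) \<odot>\<^bsub>M\<^esub> e"
      using u v U(1) assms(3) by (simp add: M.smult_l_distr M.a_ac)
    then show "u \<oplus>\<^bsub>M\<^esub> v \<in> adj R M U e" using u v U(3) unfolding adj_def by blast
  next
    fix s u assume s: "s \<in> carrier R" "u \<in> adj R M U e"
    then obtain x r where u: "u = x \<oplus>\<^bsub>M\<^esub> r \<odot>\<^bsub>M\<^esub> e" "x \<in> U" "r \<in> carrier R" unfolding adj_def by blast
    have "s \<odot>\<^bsub>M\<^esub> u = s \<odot>\<^bsub>M\<^esub> x \<oplus>\<^bsub>M\<^esub> (s \<otimes>\<^bsub>R\<^esub> r) \<odot>\<^bsub>M\<^esub> e"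
      using u s U(1) assms(3) by (simp add: M.smult_r_distr M.smult_assoc1)
    then show "s \<odot>\<^bsub>M\<^esub> u \<in> adj R M U e" using u s U(4) unfolding adj_def by blast
  qed
  show "U \<subseteq> adj R M U e"
  proof
    fix x assume "x \<in> U"
    moreover then have "x = x \<oplus>\<^bsub>M\<^esub> \<zero>\<^bsub>R\<^esub> \<odot>\<^bsub>M\<^esub> e" using U(1) assms(3) by simp
    ultimately show "x \<in> adj R M U e" unfolding adj_def by blast
  qed
  have "e = \<zero>\<^bsub>M\<^esub> \<oplus>\<^bsub>M\<^esub> \<one>\<^bsub>R\<^esub> \<odot>\<^bsub>M\<^esub> e" using assms(3) by simp
  then show "e \<in> adj R M U e" using U(2) unfolding adj_def by blast
qed

lemma adj_least:
  assumes "module R M" "submodule Y R M" "U \<subseteq> Y" "e \<in> Y"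
  shows "adj R M U e \<subseteq> Y"
  using assms module.submoduleD[OF assms(1,2)] by (auto simp: adj_def)

text \<open>Locality in the form used in computations: a coefficient lies in m or is invertible. The
  description by a unique maximal ideal is converted to this form in
  \<open>complete_noetherian_localD\<close>.\<close>

locale local_ring = cring R for R (structure) +
  fixes m
  assumes m_ideal: "ideal m R"
    and m_Units: "\<And>a. a \<in> carrier R \<Longrightarrow> a \<notin> m \<Longrightarrow> a \<in> Units R"
    and one_notin_m: "\<one> \<notin> m"
begin

lemma m_carrier: "a \<in> m \<Longrightarrow> a \<in> carrier R"
  by (rule ideal.Icarr[OF m_ideal])

text \<open>\<open>Y / U\<close> is zero or isomorphic to \<open>R / m\<close>.\<close>

definition simple_step :: "('a, 'c) module \<Rightarrow> 'c set \<Rightarrow> 'c set \<Rightarrow> bool" where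
  "simple_step M U Y \<longleftrightarrow> submodule U R M \<and> submodule Y R M \<and> U \<subseteq> Y \<and>
     (\<exists>e\<in>Y. Y \<subseteq> adj R M U e \<and> (\<forall>a\<in>m. a \<odot>\<^bsub>M\<^esub> e \<in> U))"

text \<open>Since a simple step may be an equality, the number n bounds the length of the factor
  module from above without being determined by it.\<close>

inductive steps :: "('a, 'c) module \<Rightarrow> nat \<Rightarrow> 'c set \<Rightarrow> 'c set \<Rightarrow> bool" for M where
  steps_refl: "submodule U R M \<Longrightarrow> steps M 0 U U"
| steps_step: "steps M n U Y \<Longrightarrow> simple_step M Y Z \<Longrightarrow> steps M (Suc n) U Z"

lemma steps_submodule: "steps M n U Y \<Longrightarrow> submodule U R M \<and> submodule Y R M \<and> U \<subseteq> Y"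
  by (induction rule: steps.induct) (auto simp: simple_step_def)

lemma steps_trans: "steps M k Y Z \<Longrightarrow> steps M n U Y \<Longrightarrow> steps M (n + k) U Z"
  by (induction rule: steps.induct) (auto intro: steps_step)

text \<open>Steinitz exchange in a space of dimension at most one over R / m: if y = x + r e is
  outside U, then r is not in m because m e lies in U, so r is invertible and e can be solved
  for.\<close>

lemma adj_exchange:
  assumes "module R M" "submodule U R M" "e \<in> carrier M"
    and "\<forall>a\<in>m. a \<odot>\<^bsub>M\<^esub> e \<in> U" "y \<in> adj R M U e" "y \<notin> U"
  shows "e \<in> adj R M U y \<and> (\<forall>a\<in>m. a \<odot>\<^bsub>M\<^esub> y \<in> U)"
proof -
  interpret M: module R M by fact
  note U = M.submoduleD[OF assms(2)]
  obtain x r where y: "y = x \<oplus>\<^bsub>M\<^esub> r \<odot>\<^bsub>M\<^esub> e" "x \<in> U" "r \<in> carrier R"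
    using assms(5) unfolding adj_def by blast
  have "r \<notin> m" using y U(3) assms(4,6) by blast
  then have u: "r \<in> Units R" using m_Units y by simp
  then have i: "inv r \<in> carrier R" "inv r \<otimes> r = \<one>" by auto
  have yc: "y \<in> carrier M" using y U(1) assms(3) by simp
  have "inv r \<odot>\<^bsub>M\<^esub> y = inv r \<odot>\<^bsub>M\<^esub> x \<oplus>\<^bsub>M\<^esub> e"
    using y i U(1) assms(3) M.smult_assoc1[of "inv r" r e] by (simp add: M.smult_r_distr)
  then have "e = (\<ominus> (inv r)) \<odot>\<^bsub>M\<^esub> x \<oplus>\<^bsub>M\<^esub> inv r \<odot>\<^bsub>M\<^esub> y"
    using i y U(1) assms(3) yc
    by (simp add: M.smult_l_minus) (metis M.smult_closed M.r_neg1)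
  moreover have "(\<ominus> (inv r)) \<odot>\<^bsub>M\<^esub> x \<in> U" using i y U(4) by simp
  ultimately have "e \<in> adj R M U y" using i unfolding adj_def by blast
  moreover have "a \<odot>\<^bsub>M\<^esub> y \<in> U" if a: "a \<in> m" for a
  proof -
    have "a \<odot>\<^bsub>M\<^esub> y = a \<odot>\<^bsub>M\<^esub> x \<oplus>\<^bsub>M\<^esub> r \<odot>\<^bsub>M\<^esub> (a \<odot>\<^bsub>M\<^esub> e)"
      using m_carrier[OF a] y U(1) assms(3) M.smult_assoc1[of a r e] M.smult_assoc1[of r a e]
      by (simp add: M.smult_r_distr m_comm)
    then show ?thesis using U a m_carrier[OF a] y assms(4) by auto
  qed
  ultimately show ?thesis by blast
qed

text \<open>Either the intersection with N loses the step, or it contains some y in Y outside U. By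
  exchange y generates Y over U, and since y is in N the U-part of an element of Y \<inter> N is
  again in N.\<close>

lemma simple_step_Int:
  assumes "module R M" "simple_step M U Y" "submodule N R M"
  shows "simple_step M (U \<inter> N) (Y \<inter> N)"
proof -
  interpret M: module R M by fact
  obtain e where XY: "submodule U R M" "submodule Y R M" "U \<subseteq> Y" and e: "e \<in> Y" "Y \<subseteq> adj R M U e"
    "\<forall>a\<in>m. a \<odot>\<^bsub>M\<^esub> e \<in> U" using assms(2) unfolding simple_step_def by blast
  have ec: "e \<in> carrier M" using M.submoduleD(1)[OF XY(2) e(1)] .
  have I: "submodule (U \<inter> N) R M" "submodule (Y \<inter> N) R M"
    using XY assms(3) unfolding M.submodule_iff by auto
  note U = M.submoduleD[OF XY(1)] and N = M.submoduleD[OF assms(3)]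
  show ?thesis
  proof (cases "Y \<inter> N \<subseteq> U")
    case True
    then have "Y \<inter> N = U \<inter> N" using XY by blast
    \<comment> \<open>A trivial step, witnessed by zero.\<close>
    moreover have "simple_step M (U \<inter> N) (U \<inter> N)" unfolding simple_step_def
      using I M.submoduleD[OF I(1)] adj_submodule(2)[OF assms(1) I(1) M.zero_closed] m_carrier
      by (auto intro!: bexI[of _ "\<zero>\<^bsub>M\<^esub>"])
    ultimately show ?thesis by simp
  next
    case False
    then obtain y where y: "y \<in> Y" "y \<in> N" "y \<notin> U" by blast
    note yc = M.submoduleD(1)[OF assms(3) y(2)]
    have ya: "e \<in> adj R M U y" "\<forall>a\<in>m. a \<odot>\<^bsub>M\<^esub> y \<in> U"
      using adj_exchange[OF assms(1) XY(1) ec e(3)] y e(2) by auto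
    have "adj R M U e \<subseteq> adj R M U y"
      using adj_submodule[OF assms(1) XY(1) yc] ya(1) by (intro adj_least[OF assms(1)])
    then have Yy: "Y \<subseteq> adj R M U y" using e(2) by blast
    have "Y \<inter> N \<subseteq> adj R M (U \<inter> N) y"
    proof
      fix z assume z: "z \<in> Y \<inter> N"
      then obtain x r where xr: "z = x \<oplus>\<^bsub>M\<^esub> r \<odot>\<^bsub>M\<^esub> y" "x \<in> U" "r \<in> carrier R"
        using Yy unfolding adj_def by blast
      have "x = z \<ominus>\<^bsub>M\<^esub> r \<odot>\<^bsub>M\<^esub> y" using xr yc U(1)
        by (simp add: a_minus_def M.a_assoc M.r_neg)
      moreover have "z \<ominus>\<^bsub>M\<^esub> r \<odot>\<^bsub>M\<^esub> y \<in> N" using N(4,5) z xr(3) y by auto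
      ultimately have "x \<in> N" by simp
      then show "z \<in> adj R M (U \<inter> N) y" using xr unfolding adj_def by blast
    qed
    moreover have "\<forall>a\<in>m. a \<odot>\<^bsub>M\<^esub> y \<in> U \<inter> N" using ya N(4) y m_carrier by auto
    ultimately show ?thesis unfolding simple_step_def using I XY y by blast
  qed
qed

text \<open>Replaces additivity of length. Let Y < Y' be the last step. If Z contains Y, then Z = Y
  and the last step is saved. Otherwise Y \<inter> Z is strict in Y, so induction saves a step below
  Y, and the last step intersected with Z leads from Y \<inter> Z to Z.\<close>

lemma steps_psubset:
  assumes "module R M" "steps M n U Y" "submodule Z R M" "U \<subseteq> Z" "Z \<subset> Y"
  shows "\<exists>k<n. steps M k U Z"
  using assms(2-5)
proof (induction arbitrary: Z rule: steps.induct)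
  case (steps_refl U)
  then show ?case by blast
next
  case (steps_step n U Y Y')
  interpret M: module R M by fact
  note XY = steps_submodule[OF steps_step.hyps(1)]
  obtain e where e: "submodule Y' R M" "Y \<subseteq> Y'" "e \<in> Y'" "Y' \<subseteq> adj R M Y e" "\<forall>a\<in>m. a \<odot>\<^bsub>M\<^esub> e \<in> Y"
    using steps_step.hyps(2) unfolding simple_step_def by blast
  show ?case
  proof (cases "Y \<subseteq> Z")
    case True
    \<comment> \<open>An element of Z outside Y would generate all of Y' over Y, contradicting that
      Z is strict in Y'.\<close>
    have "Z \<subseteq> Y"
    proof (rule ccontr)
      assume "\<not> Z \<subseteq> Y"
      then obtain z where z: "z \<in> Z" "z \<notin> Y" by blast
      have "e \<in> adj R M Y z"
        using adj_exchange[OF assms(1), of Y e z] XY steps_step.prems z e M.submoduleD(1)[OF e(1,3)]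
        by blast
      moreover have "adj R M Y z \<subseteq> Z" using adj_least[OF assms(1)] steps_step.prems z True by blast
      ultimately have "adj R M Y e \<subseteq> Z" using adj_least[OF assms(1)] steps_step.prems True by blast
      then show False using e(4) steps_step.prems by blast
    qed
    then show ?thesis using True steps_step.hyps(1) by auto
  next
    case False
    have sub: "submodule (Y \<inter> Z) R M" using XY steps_step.prems(1) unfolding M.submodule_iff by auto
    obtain k where k: "k < n" "steps M k U (Y \<inter> Z)"
      using steps_step.IH[OF sub] XY steps_step.prems False by blast
    have "simple_step M (Y \<inter> Z) (Y' \<inter> Z)"
      using simple_step_Int[OF assms(1) steps_step.hyps(2) steps_step.prems(1)] .
    moreover have "Y' \<inter> Z = Z" using steps_step.prems by blast
    ultimately have "steps M (Suc k) U Z" using k steps.steps_step by metis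
    then show ?thesis using k by auto
  qed
qed

text \<open>Going down the chain from the top, every strict inclusion uses up at least one
  step.\<close>

lemma steps_chain_bound:
  assumes "module R M" "steps M n U Y" "submodule_chain R M k C" "U \<subseteq> C 0" "C k \<subseteq> Y"
  shows "k \<le> n"
  using assms(2-)
proof (induction k arbitrary: n Y)
  case (Suc k)
  have C: "submodule_chain R M k C" "submodule (C k) R M" "C k \<subset> C (Suc k)"
    using Suc.prems(2) by (auto simp: submodule_chain_def)
  have "C 0 \<subseteq> C i" if "i \<le> k" for i
    using that
  proof (induction i)
    case (Suc i)
    moreover have "C i \<subset> C (Suc i)" using Suc.prems C(1) by (simp add: submodule_chain_def)
    ultimately show ?case by auto
  qed simp
  then have "U \<subseteq> C k" using Suc.prems(3) by auto
  then obtain l where "l < n" "steps M l U (C k)"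
    using steps_psubset[OF assms(1) Suc.prems(1) C(2)] C(3) Suc.prems(4) by auto
  then show ?case using Suc.IH[of l "C k"] Suc.prems(3) C(1) by auto
qed simp

text \<open>As m Y lies in U, adjoining one generator at a time to U is a simple step each
  time.\<close>

lemma steps_of_generators:
  assumes "module R M" "submodule U R M" "submodule Y R M" "U \<subseteq> Y" "finite A" "A \<subseteq> Y"
    and "Y \<subseteq> span_of R M (U \<union> A)" "\<And>a y. a \<in> m \<Longrightarrow> y \<in> Y \<Longrightarrow> a \<odot>\<^bsub>M\<^esub> y \<in> U"
  shows "\<exists>n. steps M n U Y"
proof -
  interpret M: module R M by fact
  note Yc = M.submoduleE(1)[OF assms(3)] and Xc = M.submoduleE(1)[OF assms(2)]
  have "\<exists>n. steps M n U (span_of R M (U \<union> A))" using assms(5,6)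
  proof (induction A)
    case empty
    have "span_of R M (U \<union> {}) = U"
      using span_of_superset[of U R M] span_of_least[OF assms(2), of U] by auto
    then show ?case using steps_refl[OF assms(2)] by metis
  next
    case (insert b A)
    then obtain n where n: "steps M n U (span_of R M (U \<union> A))" by blast
    let ?S = "span_of R M (U \<union> A)" and ?T = "span_of R M (U \<union> insert b A)"
    have S: "submodule ?S R M" "submodule ?T R M"
      using insert Yc Xc by (auto intro!: span_of_submodule assms(1))
    have bc: "b \<in> carrier M" using insert Yc by auto
    have sup: "U \<union> A \<subseteq> ?S" "U \<union> insert b A \<subseteq> ?T" by (rule span_of_superset)+
    have "?S \<subseteq> ?T" using S(2) by (rule span_of_least) (use sup in auto)
    moreover have "?T \<subseteq> adj R M ?S b"
      by (rule span_of_least) (use sup adj_submodule[OF assms(1) S(1) bc] in auto)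
    moreover have "\<forall>a\<in>m. a \<odot>\<^bsub>M\<^esub> b \<in> ?S" using assms(8) insert sup by auto
    ultimately have "simple_step M ?S ?T" unfolding simple_step_def using S sup by blast
    then show ?case using n steps_step by blast
  qed
  moreover have "span_of R M (U \<union> A) = Y"
    using assms(7) span_of_least[OF assms(3), of "U \<union> A"] assms(4,6) by blast
  ultimately show ?thesis by simp
qed

end

section \<open>Selectors and closures\<close>

text \<open>Choosing a representative in each coset turns an injection of M into one of M / L, so
  quotients of modules that fit into \<open>'u\<close> fit as well.\<close>

lemma quotient_inj:
  fixes j :: "'b \<Rightarrow> 'u"
  assumes "module R M" "submodule L R M" "inj_on j (carrier M)"
  obtains j' :: "'b set \<Rightarrow> 'u" where "inj_on j' (carrier (quotient_module R M L))"
proof -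
  have "\<forall>C\<in>carrier (quotient_module R M L). \<exists>x. x \<in> carrier M \<and> L +>\<^bsub>M\<^esub> x = C"
    unfolding quotient_carrier[OF assms(1,2)] by auto
  then obtain f where f: "\<And>C. C \<in> carrier (quotient_module R M L) \<Longrightarrow> f C \<in> carrier M \<and> L +>\<^bsub>M\<^esub> f C = C"
    by metis
  have "inj_on (\<lambda>C. j (f C)) (carrier (quotient_module R M L))"
  proof (rule inj_onI)
    fix C D assume C: "C \<in> carrier (quotient_module R M L)" and D: "D \<in> carrier (quotient_module R M L)"
      and eq: "j (f C) = j (f D)"
    have "f C = f D"
      by (rule inj_onD[OF assms(3) eq conjunct1[OF f[OF C]] conjunct1[OF f[OF D]]])
    then show "C = D" using conjunct2[OF f[OF C]] conjunct2[OF f[OF D]] by metis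
  qed
  then show thesis by (rule that)
qed

text \<open>Guarantees that the union in \<open>selector_at\<close> has a member: without a copy of
  N in \<open>'u\<close> the transported value would be the empty set.\<close>

lemma artinian_copy:
  fixes j :: "'b \<Rightarrow> 'u"
  assumes "artinian R N" "inj_on j (carrier N)"
  obtains M :: "('a, 'u) module" and \<phi> where "M \<in> artinian_modules R" "\<phi> \<in> mod_iso R M N"
proof
  note N = artinian_module[OF assms(1)]
  show "transport N j \<in> artinian_modules R"
    using artinian_iso[OF assms(1) transport_module[OF N assms(2)] transport_iso[OF assms(2)]]
    by (simp add: artinian_modules_def)
  show "inv_into (carrier N) j \<in> mod_iso R (transport N j) N"
    by (rule mod_iso_inv[OF N transport_iso[OF assms(2)]])
qed

lemma artinian_modules_module: "M \<in> artinian_modules R \<Longrightarrow> module R M"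
  by (simp add: artinian_modules_def artinian_module)

lemma submodule_selectorD:
  assumes "submodule_selector R \<beta>" "M \<in> artinian_modules R"
  shows "submodule (\<beta> M) R M" "x \<in> \<beta> M \<Longrightarrow> x \<in> carrier M"
  using assms module.submoduleD(1)[OF artinian_modules_module[OF assms(2)]]
  unfolding submodule_selector_def by auto

lemma submodule_selector_iso:
  "submodule_selector R \<beta> \<Longrightarrow> M \<in> artinian_modules R \<Longrightarrow> N \<in> artinian_modules R \<Longrightarrow>
    \<phi> \<in> mod_iso R M N \<Longrightarrow> \<phi> ` \<beta> M = \<beta> N"
  unfolding submodule_selector_def by blast

lemma functorialD:
  "functorial R \<beta> \<Longrightarrow> M \<in> artinian_modules R \<Longrightarrow> N \<in> artinian_modules R \<Longrightarrow>
    g \<in> mod_hom R M N \<Longrightarrow> x \<in> \<beta> M \<Longrightarrow> g x \<in> \<beta> N"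
  unfolding functorial_def by blast

section \<open>Values of a selector at modules of any type\<close>

lemma selector_at_elem:
  "x \<in> selector_at R \<beta> N \<longleftrightarrow>
    (\<exists>M \<phi> y. M \<in> artinian_modules R \<and> \<phi> \<in> mod_iso R M N \<and> y \<in> \<beta> M \<and> x = \<phi> y)"
  unfolding selector_at_def by blast

lemma selector_atI:
  "M \<in> artinian_modules R \<Longrightarrow> \<phi> \<in> mod_iso R M N \<Longrightarrow> y \<in> \<beta> M \<Longrightarrow> \<phi> y \<in> selector_at R \<beta> N"
  unfolding selector_at_elem by blast

lemma selector_at_carrier:
  "submodule_selector R \<beta> \<Longrightarrow> x \<in> selector_at R \<beta> N \<Longrightarrow> x \<in> carrier N"
  unfolding selector_at_elem using submodule_selectorD(2) mod_isoD(1) mod_hom_closed by metis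

lemma selector_at_iso_elem:
  assumes "h \<in> mod_iso R N N'" "x \<in> selector_at R \<beta> N"
  shows "h x \<in> selector_at R \<beta> N'"
  using assms(2) mod_iso_comp[OF _ assms(1)] unfolding selector_at_elem by blast

lemma selector_at_iso_iff:
  assumes "submodule_selector R \<beta>" "module R N" "h \<in> mod_iso R N N'" "x \<in> carrier N"
  shows "h x \<in> selector_at R \<beta> N' \<longleftrightarrow> x \<in> selector_at R \<beta> N"
proof
  assume "h x \<in> selector_at R \<beta> N'"
  then have "inv_into (carrier N) h (h x) \<in> selector_at R \<beta> N"
    by (rule selector_at_iso_elem[OF mod_iso_inv[OF assms(2,3)]])
  then show "x \<in> selector_at R \<beta> N" using mod_isoD(2)[OF assms(3)] assms(4) by simp
qed (rule selector_at_iso_elem[OF assms(3)])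

lemma selector_at_self:
  assumes "submodule_selector R \<beta>" "M \<in> artinian_modules R"
  shows "selector_at R \<beta> M = \<beta> M"
proof
  show "selector_at R \<beta> M \<subseteq> \<beta> M"
    using submodule_selector_iso[OF assms(1) _ assms(2)] unfolding selector_at_def by blast
  have "(\<lambda>x. x) \<in> mod_iso R M M" by (intro mod_isoI mod_hom_id) auto
  then show "\<beta> M \<subseteq> selector_at R \<beta> M"
    using selector_atI[OF assms(2)] by auto
qed

text \<open>Conjugate f by isomorphisms with copies in \<open>'u\<close> and apply functoriality
  there. The copy of M comes with the membership of x; only the copy of N has to be built, hence the
  injection j.\<close>

lemma selector_at_hom:
  fixes j :: "'b \<Rightarrow> 'u" and \<beta> :: "('a, 'u) module \<Rightarrow> 'u set"
  assumes "submodule_selector R \<beta>" "functorial R \<beta>" "artinian R N" "inj_on j (carrier N)"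
    "f \<in> mod_hom R M N" "x \<in> selector_at R \<beta> M"
  shows "f x \<in> selector_at R \<beta> N"
proof -
  obtain M' \<phi> y where M': "M' \<in> artinian_modules R" "\<phi> \<in> mod_iso R M' M" "y \<in> \<beta> M'" "x = \<phi> y"
    using assms(6) unfolding selector_at_elem by blast
  obtain N' :: "('a, 'u) module" and \<psi> where N': "N' \<in> artinian_modules R" "\<psi> \<in> mod_iso R N' N"
    using artinian_copy[OF assms(3,4)] .
  define \<psi>' where "\<psi>' = inv_into (carrier N') \<psi>"
  note psi' = mod_iso_inv[OF artinian_modules_module[OF N'(1)] N'(2), folded \<psi>'_def]
  have "(\<lambda>z. \<psi>' (f (\<phi> z))) \<in> mod_hom R M' N'"
    using mod_hom_comp[OF mod_hom_comp[OF mod_isoD(1)[OF M'(2)] assms(5)] mod_isoD(1)[OF psi']] .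
  then have y: "\<psi>' (f x) \<in> \<beta> N'"
    using functorialD[OF assms(2) M'(1) N'(1) _ M'(3)] M'(4) by simp
  have "f x \<in> carrier N"
    using mod_hom_closed[OF assms(5) selector_at_carrier[OF assms(1,6)]] .
  then have "\<psi> (\<psi>' (f x)) = f x"
    unfolding \<psi>'_def using mod_isoD(3)[OF N'(2)] by (simp add: f_inv_into_f)
  then show ?thesis using N' y unfolding selector_at_elem by metis
qed

text \<open>Invariance under isomorphisms reduces the union over all copies to the image of the
  selector at one copy, which is a submodule.\<close>

lemma selector_at_submodule:
  fixes j :: "'b \<Rightarrow> 'u" and \<beta> :: "('a, 'u) module \<Rightarrow> 'u set"
  assumes "submodule_selector R \<beta>" "artinian R N" "inj_on j (carrier N)"
  shows "submodule (selector_at R \<beta> N) R N"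
proof -
  obtain M :: "('a, 'u) module" and \<phi> where M: "M \<in> artinian_modules R" "\<phi> \<in> mod_iso R M N"
    using artinian_copy[OF assms(2,3)] .
  note Mm = artinian_modules_module[OF M(1)]
  have "selector_at R \<beta> N = \<phi> ` \<beta> M"
  proof
    show "\<phi> ` \<beta> M \<subseteq> selector_at R \<beta> N" using selector_atI[OF M] by auto
    show "selector_at R \<beta> N \<subseteq> \<phi> ` \<beta> M"
    proof
      fix x assume x: "x \<in> selector_at R \<beta> N"
      then have "x \<in> carrier N" by (rule selector_at_carrier[OF assms(1)])
      then obtain y where y: "y \<in> carrier M" "x = \<phi> y" using mod_isoD(3)[OF M(2)] by auto
      then show "x \<in> \<phi> ` \<beta> M"
        using x selector_at_iso_iff[OF assms(1) Mm M(2) y(1)] selector_at_self[OF assms(1) M(1)] by simp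
    qed
  qed
  then show ?thesis
    using submodule_image[OF Mm artinian_module[OF assms(2)] mod_isoD(1)[OF M(2)]
        submodule_selectorD(1)[OF assms(1) M(1)]] by simp
qed

text \<open>The closure of a kernel can be read off from any surjection with that kernel, by the
  first isomorphism theorem. This is how closures in E, in its submodules, in R and in R / J are
  compared without touching the cosets in \<open>cl\<close>.\<close>

lemma cl_surj:
  assumes "submodule_selector R \<beta>" "module R M" "module R N" "g \<in> mod_hom R M N"
    and "g ` carrier M = carrier N" "L = {x \<in> carrier M. g x = \<zero>\<^bsub>N\<^esub>}" "z \<in> carrier M"
  shows "z \<in> cl R \<beta> M L \<longleftrightarrow> g z \<in> selector_at R \<beta> N"
proof -
  obtain h where L: "submodule L R M" and h: "h \<in> mod_iso R (quotient_module R M L) N"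
    "\<And>x. x \<in> carrier M \<Longrightarrow> h (L +>\<^bsub>M\<^esub> x) = g x"
    using first_isomorphism[OF assms(2-6)] by metis
  have "L +>\<^bsub>M\<^esub> z \<in> carrier (quotient_module R M L)"
    unfolding quotient_carrier[OF assms(2) L] using assms(7) by blast
  then have "h (L +>\<^bsub>M\<^esub> z) \<in> selector_at R \<beta> N \<longleftrightarrow> L +>\<^bsub>M\<^esub> z \<in> selector_at R \<beta> (quotient_module R M L)"
    by (rule selector_at_iso_iff[OF assms(1) quotient_is_module[OF assms(2) L] h(1)])
  then show ?thesis using h(2)[OF assms(7)] assms(7) by (simp add: cl_def)
qed

text \<open>The map f induces a map from M / L to N / L', to which functoriality applies. Only the
  target quotient has to be known as Artinian, since z itself provides an Artinian copy of M /
  L.\<close>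

lemma cl_hom:
  fixes j :: "'b \<Rightarrow> 'u" and \<beta> :: "('a, 'u) module \<Rightarrow> 'u set"
  assumes "submodule_selector R \<beta>" "functorial R \<beta>" "module R M" "module R N" "submodule L R M" "submodule L' R N"
    and "artinian R (quotient_module R N L')" "inj_on j (carrier N)"
    and "f \<in> mod_hom R M N" "\<And>x. x \<in> L \<Longrightarrow> f x \<in> L'" "z \<in> cl R \<beta> M L"
  shows "f z \<in> cl R \<beta> N L'"
proof -
  interpret M: module R M by fact
  let ?Q = "quotient_module R N L'"
  have z: "z \<in> carrier M" "L +>\<^bsub>M\<^esub> z \<in> selector_at R \<beta> (quotient_module R M L)"
    using assms(11) by (auto simp: cl_def)
  have fz: "f z \<in> carrier N" using mod_hom_closed[OF assms(9) z(1)] .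
  have "(\<lambda>x. L' +>\<^bsub>N\<^esub> f x) \<in> mod_hom R M ?Q"
    by (rule mod_hom_comp[OF assms(9) quotient_proj[OF assms(4,6)]])
  moreover have "L' +>\<^bsub>N\<^esub> f x = \<zero>\<^bsub>?Q\<^esub>" if "x \<in> L" for x
    using that assms(10) rcoset_eq_self_iff[OF assms(4,6)] M.submoduleD(1)[OF assms(5)]
      mod_hom_closed[OF assms(9)] quotient_zero[OF assms(4,6)] by simp
  ultimately obtain h where h: "h \<in> mod_hom R (quotient_module R M L) ?Q"
    "\<And>x. x \<in> carrier M \<Longrightarrow> h (L +>\<^bsub>M\<^esub> x) = L' +>\<^bsub>N\<^esub> f x"
    using quotient_map[OF assms(3) quotient_is_module[OF assms(4,6)] assms(5)] by blast
  obtain j' :: "'b set \<Rightarrow> 'u" where "inj_on j' (carrier ?Q)"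
    using quotient_inj[OF assms(4,6,8)] .
  then have "h (L +>\<^bsub>M\<^esub> z) \<in> selector_at R \<beta> ?Q"
    by (rule selector_at_hom[OF assms(1,2,7) _ h(1) z(2)])
  then show ?thesis using h(2)[OF z(1)] fz by (simp add: cl_def)
qed

lemma cl_superset:
  fixes j :: "'b \<Rightarrow> 'u" and \<beta> :: "('a, 'u) module \<Rightarrow> 'u set"
  assumes "submodule_selector R \<beta>" "module R M" "submodule L R M"
    and "artinian R (quotient_module R M L)" "inj_on j (carrier M)" "z \<in> L"
  shows "z \<in> cl R \<beta> M L"
proof -
  interpret M: module R M by fact
  let ?Q = "quotient_module R M L"
  obtain j' :: "'b set \<Rightarrow> 'u" where "inj_on j' (carrier ?Q)"
    using quotient_inj[OF assms(2,3,5)] .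
  then have "submodule (selector_at R \<beta> ?Q) R ?Q"
    by (rule selector_at_submodule[OF assms(1,4)])
  then have "\<zero>\<^bsub>?Q\<^esub> \<in> selector_at R \<beta> ?Q"
    by (rule module.submoduleD(2)[OF quotient_is_module[OF assms(2,3)]])
  moreover have zc: "z \<in> carrier M" using M.submoduleD(1)[OF assms(3,6)] .
  moreover have "L +>\<^bsub>M\<^esub> z = \<zero>\<^bsub>?Q\<^esub>"
    using rcoset_eq_self_iff[OF assms(2,3) zc] assms(6) quotient_zero[OF assms(2,3)] by simp
  ultimately show ?thesis by (simp add: cl_def)
qed

lemma cl_mono_selector:
  assumes "\<And>N. N \<in> artinian_modules R \<Longrightarrow> \<beta>' N \<subseteq> \<beta> N"
  shows "cl R \<beta>' M L \<subseteq> cl R \<beta> M L"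
  using assms unfolding cl_def selector_at_elem by blast

section \<open>The finitistic version of a selector\<close>

lemma artinian_modules_submodule:
  "N \<in> artinian_modules R \<Longrightarrow> submodule H R N \<Longrightarrow> N\<lparr>carrier := H\<rparr> \<in> artinian_modules R"
  by (simp add: artinian_modules_def artinian_submodule)

lemma finitistic_elem:
  "x \<in> finitistic R \<alpha> N \<longleftrightarrow>
    (\<exists>H. submodule H R N \<and> finitely_generated R (N\<lparr>carrier := H\<rparr>) \<and> x \<in> \<alpha> (N\<lparr>carrier := H\<rparr>))"
  unfolding finitistic_def by blast

lemma finitisticI:
  "submodule H R N \<Longrightarrow> finitely_generated R (N\<lparr>carrier := H\<rparr>) \<Longrightarrow> x \<in> \<alpha> (N\<lparr>carrier := H\<rparr>) \<Longrightarrow>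
    x \<in> finitistic R \<alpha> N"
  unfolding finitistic_elem by blast

context
  fixes R :: "('a, 'r) ring_scheme" and \<alpha> :: "('a, 'u) module \<Rightarrow> 'u set"
  assumes sel: "submodule_selector R \<alpha>" and fun_sel: "functorial R \<alpha>"
begin

lemma selector_submodule_mono:
  assumes "N \<in> artinian_modules R" "submodule H R N" "submodule K R N" "H \<subseteq> K"
  shows "\<alpha> (N\<lparr>carrier := H\<rparr>) \<subseteq> \<alpha> (N\<lparr>carrier := K\<rparr>)"
proof
  fix x assume x: "x \<in> \<alpha> (N\<lparr>carrier := H\<rparr>)"
  have "(\<lambda>x. x) \<in> mod_hom R (N\<lparr>carrier := H\<rparr>) (N\<lparr>carrier := K\<rparr>)"
    using assms(4) by (auto simp: mod_hom_def)
  then show "x \<in> \<alpha> (N\<lparr>carrier := K\<rparr>)"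
    by (rule functorialD[OF fun_sel artinian_modules_submodule[OF assms(1,2)]
          artinian_modules_submodule[OF assms(1,3)] _ x])
qed

lemma finitistic_le:
  assumes "N \<in> artinian_modules R" shows "finitistic R \<alpha> N \<subseteq> \<alpha> N"
proof
  fix x assume "x \<in> finitistic R \<alpha> N"
  then obtain H where H: "submodule H R N" "x \<in> \<alpha> (N\<lparr>carrier := H\<rparr>)"
    unfolding finitistic_elem by blast
  interpret N: module R N by (rule artinian_modules_module[OF assms])
  have "x \<in> \<alpha> (N\<lparr>carrier := carrier N\<rparr>)"
    using selector_submodule_mono[OF assms H(1) N.carrier_is_submodule N.submoduleE(1)[OF H(1)]] H(2)
    by (rule subsetD)
  then show "x \<in> \<alpha> N" by simp
qed

text \<open>The union is directed: submodules generated by finite sets A and B both lie in the one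
  generated by A \<union> B, and the selector grows with the submodule, so sums can be formed in a
  common value.\<close>

lemma finitistic_submodule:
  assumes "N \<in> artinian_modules R" shows "submodule (finitistic R \<alpha> N) R N"
proof -
  interpret N: module R N by (rule artinian_modules_module[OF assms])
  note mod = N.module_axioms
  have S: "submodule (\<alpha> (N\<lparr>carrier := H\<rparr>)) R N" if "submodule H R N" for H
    using submodule_selectorD(1)[OF sel artinian_modules_submodule[OF assms that]]
      submodule_submodule[OF mod that] by simp
  show ?thesis unfolding N.submodule_iff
  proof (intro conjI ballI)
    show "finitistic R \<alpha> N \<subseteq> carrier N"
      using finitistic_le[OF assms] submodule_selectorD(2)[OF sel assms] by blast
    \<comment> \<open>The span of the empty set is one member of the union, and its value contains
      zero.\<close>
    have e: "submodule (span_of R N {}) R N" "finitely_generated R (N\<lparr>carrier := span_of R N {}\<rparr>)"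
      using span_of_submodule[OF mod] finitely_generated_span_of[OF mod] by auto
    then show "\<zero>\<^bsub>N\<^esub> \<in> finitistic R \<alpha> N"
      using N.submoduleD(2)[OF S[OF e(1)]] unfolding finitistic_elem by blast
  next
    fix x y assume "x \<in> finitistic R \<alpha> N" "y \<in> finitistic R \<alpha> N"
    then obtain H K where H: "submodule H R N" "finitely_generated R (N\<lparr>carrier := H\<rparr>)" "x \<in> \<alpha> (N\<lparr>carrier := H\<rparr>)"
      and K: "submodule K R N" "finitely_generated R (N\<lparr>carrier := K\<rparr>)" "y \<in> \<alpha> (N\<lparr>carrier := K\<rparr>)"
      unfolding finitistic_elem by blast
    obtain A where A: "A \<subseteq> H" "finite A" "H = span_of R N A"
      using H(2) finitely_generated_submodule_iff[OF mod H(1)] by blast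
    obtain B where B: "B \<subseteq> K" "finite B" "K = span_of R N B"
      using K(2) finitely_generated_submodule_iff[OF mod K(1)] by blast
    define L where "L = span_of R N (A \<union> B)"
    have AB: "A \<union> B \<subseteq> carrier N" using A(1) B(1) N.submoduleE(1)[OF H(1)] N.submoduleE(1)[OF K(1)] by blast
    have L: "submodule L R N" "finitely_generated R (N\<lparr>carrier := L\<rparr>)"
      using span_of_submodule[OF mod AB] finitely_generated_span_of[OF mod AB] A B unfolding L_def by auto
    have sup: "A \<union> B \<subseteq> L" unfolding L_def by (rule span_of_superset)
    have "H \<subseteq> L" unfolding A(3) by (rule span_of_least[OF L(1)]) (use sup in blast)
    then have x: "x \<in> \<alpha> (N\<lparr>carrier := L\<rparr>)" using selector_submodule_mono[OF assms H(1) L(1)] H(3) by blast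
    have "K \<subseteq> L" unfolding B(3) by (rule span_of_least[OF L(1)]) (use sup in blast)
    then have y: "y \<in> \<alpha> (N\<lparr>carrier := L\<rparr>)" using selector_submodule_mono[OF assms K(1) L(1)] K(3) by blast
    show "x \<oplus>\<^bsub>N\<^esub> y \<in> finitistic R \<alpha> N"
      using N.submoduleD(3)[OF S[OF L(1)] x y] L unfolding finitistic_elem by blast
  next
    fix r x assume r: "r \<in> carrier R" "x \<in> finitistic R \<alpha> N"
    then obtain H where H: "submodule H R N" "finitely_generated R (N\<lparr>carrier := H\<rparr>)" "x \<in> \<alpha> (N\<lparr>carrier := H\<rparr>)"
      unfolding finitistic_elem by blast
    show "r \<odot>\<^bsub>N\<^esub> x \<in> finitistic R \<alpha> N"
      using N.submoduleD(4)[OF S[OF H(1)] r(1) H(3)] H(1,2) unfolding finitistic_elem by blast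
  qed
qed

text \<open>The image of a finitely generated submodule is finitely generated, so g restricts to a
  map between members of the two unions.\<close>

lemma finitistic_functorial: "functorial R (finitistic R \<alpha>)"
  unfolding functorial_def
proof (intro ballI subsetI)
  fix M N :: "('a, 'u) module" and g y
  assume MN: "M \<in> artinian_modules R" "N \<in> artinian_modules R" and g: "g \<in> mod_hom R M N"
    and "y \<in> g ` finitistic R \<alpha> M"
  then obtain x where x: "y = g x" "x \<in> finitistic R \<alpha> M" by blast
  note Mm = artinian_modules_module[OF MN(1)] and Nm = artinian_modules_module[OF MN(2)]
  obtain H where H: "submodule H R M" "finitely_generated R (M\<lparr>carrier := H\<rparr>)" "x \<in> \<alpha> (M\<lparr>carrier := H\<rparr>)"
    using x(2) unfolding finitistic_elem by blast
  note Hc = module.submoduleE(1)[OF Mm H(1)]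
  have gH: "submodule (g ` H) R N" using submodule_image[OF Mm Nm g H(1)] .
  moreover have "finitely_generated R (N\<lparr>carrier := g ` H\<rparr>)"
    using finitely_generated_image[OF H(2) Nm mod_hom_from_submodule[OF g Hc]] by simp
  moreover have "y \<in> \<alpha> (N\<lparr>carrier := g ` H\<rparr>)" unfolding x(1)
    by (rule functorialD[OF fun_sel artinian_modules_submodule[OF MN(1) H(1)]
          artinian_modules_submodule[OF MN(2) gH] mod_hom_restrict[OF g Hc subset_refl] H(3)])
  ultimately show "y \<in> finitistic R \<alpha> N" by (rule finitisticI)
qed

lemma finitistic_selector: "submodule_selector R (finitistic R \<alpha>)"
  unfolding submodule_selector_def
proof (intro conjI ballI finitistic_submodule)
  fix M N :: "('a, 'u) module" and \<phi>
  assume MN: "M \<in> artinian_modules R" "N \<in> artinian_modules R" and phi: "\<phi> \<in> mod_iso R M N"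
  note Mm = artinian_modules_module[OF MN(1)]
  show "\<phi> ` finitistic R \<alpha> M = finitistic R \<alpha> N"
  proof
    show "\<phi> ` finitistic R \<alpha> M \<subseteq> finitistic R \<alpha> N"
      using functorialD[OF finitistic_functorial MN mod_isoD(1)[OF phi]] by blast
    show "finitistic R \<alpha> N \<subseteq> \<phi> ` finitistic R \<alpha> M"
    proof
      fix y assume y: "y \<in> finitistic R \<alpha> N"
      then have "y \<in> carrier N"
        using finitistic_le[OF MN(2)] submodule_selectorD(2)[OF sel MN(2)] by blast
      then have "y = \<phi> (inv_into (carrier M) \<phi> y)"
        using mod_isoD(3)[OF phi] by (simp add: f_inv_into_f)
      moreover have "inv_into (carrier M) \<phi> y \<in> finitistic R \<alpha> M"
        by (rule functorialD[OF finitistic_functorial MN(2,1) mod_isoD(1)[OF mod_iso_inv[OF Mm phi]] y])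
      ultimately show "y \<in> \<phi> ` finitistic R \<alpha> M" by blast
    qed
  qed
qed

end

section \<open>Annihilators in the injective hull\<close>

text \<open>Preimages under the projection turn chains in M / L into chains in M above L, so it is
  enough to bound the latter. This applies when M itself has infinite length, as for M = R.\<close>

lemma finite_length_quotient:
  assumes "module R M" "submodule L R M"
    and "\<And>n C. submodule_chain R M n C \<Longrightarrow> L \<subseteq> C 0 \<Longrightarrow> n \<le> b"
  shows "module_length R (quotient_module R M L) < \<infinity>"
proof -
  let ?Q = "quotient_module R M L"
  note Q = quotient_is_module[OF assms(1,2)]
  interpret M: module R M by fact
  interpret Q: module R ?Q by (rule Q)
  let ?p = "\<lambda>x. L +>\<^bsub>M\<^esub> x"
  have "n \<le> b" if C: "submodule_chain R ?Q n C" for n C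
  proof -
    let ?D = "\<lambda>i. {x \<in> carrier M. ?p x \<in> C i}"
    have sub: "submodule (C i) R ?Q" if "i \<le> n" for i using C that by (simp add: submodule_chain_def)
    have im: "C i = ?p ` ?D i" if "i \<le> n" for i
      using Q.submoduleE(1)[OF sub[OF that]] quotient_carrier[OF assms(1,2)]
      by (intro image_preimage_eq) auto
    have "?D i \<subset> ?D (Suc i)" if "i < n" for i
    proof
      have i: "C i \<subset> C (Suc i)" using C that by (simp add: submodule_chain_def)
      then show "?D i \<subseteq> ?D (Suc i)" by auto
      show "?D i \<noteq> ?D (Suc i)" using i im[of i] im[of "Suc i"] that
        by (metis Suc_leI less_imp_le psubset_eq)
    qed
    then have "submodule_chain R M n ?D"
      using sub submodule_vimage[OF assms(1) Q quotient_proj[OF assms(1,2)]]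
      by (simp add: submodule_chain_def)
    moreover have "L \<subseteq> ?D 0"
    proof
      fix x assume x: "x \<in> L"
      then have xc: "x \<in> carrier M" by (rule M.submoduleD(1)[OF assms(2)])
      have "?p x = \<zero>\<^bsub>?Q\<^esub>"
        using rcoset_eq_self_iff[OF assms(1,2) xc] x quotient_zero[OF assms(1,2)] by simp
      then show "x \<in> ?D 0" using Q.submoduleD(2)[OF sub[of 0]] xc by simp
    qed
    ultimately show ?thesis by (rule assms(3))
  qed
  then show ?thesis unfolding module_length_finite_iff by metis
qed

text \<open>Zorn's lemma applies because in a Noetherian ring a nonempty chain of ideals contains
  its union.\<close>

lemma (in noetherian_ring) ideals_maximal_element:
  assumes "S \<noteq> {}" "\<And>I. I \<in> S \<Longrightarrow> ideal I R"
  obtains M where "M \<in> S" "\<And>I. I \<in> S \<Longrightarrow> M \<subseteq> I \<Longrightarrow> I = M"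
proof -
  have "\<exists>M\<in>S. \<forall>I\<in>S. M \<subseteq> I \<longrightarrow> I = M"
  proof (rule subset_Zorn)
    fix C assume C: "subset.chain S C"
    show "\<exists>U\<in>S. \<forall>I\<in>C. I \<subseteq> U"
    proof (cases "C = {}")
      case True
      then show ?thesis using assms(1) by auto
    next
      case False
      moreover have "subset.chain {I. ideal I R} C"
        using C assms(2) unfolding pred_on.chain_def by auto
      ultimately have "\<Union>C \<in> C" by (rule ideal_chain_is_trivial)
      then have "\<Union>C \<in> S" using C unfolding pred_on.chain_def by auto
      then show ?thesis by (rule bexI[rotated]) (simp add: Union_upper)
    qed
  qed
  then show thesis using that by metis
qed

lemma submodule_annihilator:
  assumes "module R M" "S \<subseteq> carrier M"
  shows "submodule (annihilator R M S) R (regular_module R)"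
proof -
  interpret M: module R M by fact
  interpret Reg: module R "regular_module R" by (rule M.R.regular_is_module)
  show ?thesis unfolding Reg.submodule_iff using assms(2)
    by (auto simp: annihilator_def M.smult_l_distr M.smult_assoc1 subset_iff)
qed

text \<open>The properties of the injective hull that suffice for duality between ideals and
  submodules of E. The element s spans the socle, \<open>essential\<close> says that every nonzero
  cyclic submodule contains it, and \<open>cogenerator\<close> says that an ideal can be separated
  from any element outside it by an element of E.\<close>

locale matlis = local_ring R m + E: module R E + noetherian_ring R
  for R :: "('a, 'r) ring_scheme" (structure) and m and E :: "('a, 'u) module" +
  fixes s
  assumes s_carrier: "s \<in> carrier E" and s_nonzero: "s \<noteq> \<zero>\<^bsub>E\<^esub>"
    and m_s: "\<And>a. a \<in> m \<Longrightarrow> a \<odot>\<^bsub>E\<^esub> s = \<zero>\<^bsub>E\<^esub>"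
    and essential: "\<And>e. e \<in> carrier E \<Longrightarrow> e \<noteq> \<zero>\<^bsub>E\<^esub> \<Longrightarrow> \<exists>r\<in>carrier R. r \<odot>\<^bsub>E\<^esub> e = s"
    and cogenerator: "\<And>K x. ideal K R \<Longrightarrow> x \<in> carrier R \<Longrightarrow> x \<notin> K \<Longrightarrow>
      \<exists>e\<in>ann_in E K. x \<odot>\<^bsub>E\<^esub> e \<noteq> \<zero>\<^bsub>E\<^esub>"
begin

abbreviation "Reg \<equiv> regular_module R"

sublocale Reg: module R Reg by (rule regular_is_module)

lemma E_module: "module R E" by (rule E.module_axioms)
lemma Reg_module: "module R Reg" by (rule Reg.module_axioms)

lemma E_smult_comm:
  "a \<in> carrier R \<Longrightarrow> b \<in> carrier R \<Longrightarrow> x \<in> carrier E \<Longrightarrow> a \<odot>\<^bsub>E\<^esub> (b \<odot>\<^bsub>E\<^esub> x) = b \<odot>\<^bsub>E\<^esub> (a \<odot>\<^bsub>E\<^esub> x)"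
  using E.smult_assoc1[of a b x] E.smult_assoc1[of b a x] m_comm[of a b] by simp

text \<open>Both elements have multiples equal to s. The multiplier of z' cannot lie in m, which
  kills z', so it is invertible and z' becomes a multiple of z.\<close>

lemma socle_simple:
  assumes "z \<in> carrier E" "z' \<in> carrier E" "\<And>a. a \<in> m \<Longrightarrow> a \<odot>\<^bsub>E\<^esub> z = \<zero>\<^bsub>E\<^esub>"
    "\<And>a. a \<in> m \<Longrightarrow> a \<odot>\<^bsub>E\<^esub> z' = \<zero>\<^bsub>E\<^esub>" "z \<noteq> \<zero>\<^bsub>E\<^esub>"
  shows "\<exists>r\<in>carrier R. z' = r \<odot>\<^bsub>E\<^esub> z"
proof (cases "z' = \<zero>\<^bsub>E\<^esub>")
  case True
  then show ?thesis using assms(1) by (intro bexI[of _ \<zero>]) auto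
next
  case False
  obtain r where r: "r \<in> carrier R" "r \<odot>\<^bsub>E\<^esub> z = s" using essential assms(1,5) by blast
  obtain r' where r': "r' \<in> carrier R" "r' \<odot>\<^bsub>E\<^esub> z' = s" using essential assms(2) False by blast
  have "r' \<notin> m" using assms(4) r' s_nonzero by auto
  then have i: "inv r' \<in> carrier R" "inv r' \<otimes> r' = \<one>" using m_Units[OF r'(1)] by auto
  have "z' = inv r' \<odot>\<^bsub>E\<^esub> (r' \<odot>\<^bsub>E\<^esub> z')"
    using i r' assms(2) E.smult_assoc1[of "inv r'" r' z'] by simp
  also have "\<dots> = (inv r' \<otimes> r) \<odot>\<^bsub>E\<^esub> z" using i r r' assms(1) by (simp add: E.smult_assoc1)
  finally show ?thesis using i r by blast
qed

section \<open>Annihilators exchange simple steps of E and of R\<close>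

lemma ideal_annihilator: "S \<subseteq> carrier E \<Longrightarrow> ideal (annihilator R E S) R"
  using submodule_annihilator[OF E_module] submodule_regular_iff by blast

lemma annihilator_ann_in:
  assumes "ideal K R" shows "annihilator R E (ann_in E K) = K"
proof
  show "annihilator R E (ann_in E K) \<subseteq> K"
    using cogenerator[OF assms] by (force simp: annihilator_def)
  show "K \<subseteq> annihilator R E (ann_in E K)"
    using ideal.Icarr[OF assms] by (auto simp: annihilator_def ann_in_def)
qed

lemma simple_step_refl:
  assumes "module R M" "submodule H R M" shows "simple_step M H H"
proof -
  interpret M: module R M by fact
  show ?thesis unfolding simple_step_def
    using assms M.submoduleD[OF assms(2)] adj_submodule(2)[OF assms M.zero_closed] m_carrier
    by (auto intro!: bexI[of _ "\<zero>\<^bsub>M\<^esub>"])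
qed

text \<open>If Y = H + R e with m e in H, then a \<mapsto> a e maps ann H into the socle, with
  kernel ann Y. As the socle is one-dimensional, any b in ann H with b e nonzero generates ann H
  over ann Y; if there is none, the two annihilators agree.\<close>

lemma annihilator_simple_step:
  assumes "simple_step E H Y"
  shows "simple_step Reg (annihilator R E Y) (annihilator R E H)"
proof -
  obtain e where HY: "submodule H R E" "submodule Y R E" "H \<subseteq> Y" and e: "e \<in> Y" "Y \<subseteq> adj R E H e"
    "\<forall>a\<in>m. a \<odot>\<^bsub>E\<^esub> e \<in> H" using assms unfolding simple_step_def by blast
  let ?K = "annihilator R E H" and ?K' = "annihilator R E Y"
  note H = E.submoduleD[OF HY(1)] and Y = E.submoduleD[OF HY(2)]
  have ec: "e \<in> carrier E" using Y(1) e by blast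
  have sub: "submodule ?K R Reg" "submodule ?K' R Reg"
    using H(1) Y(1) by (auto intro!: submodule_annihilator[OF E_module])
  have K'K: "?K' \<subseteq> ?K" using HY(3) by (auto simp: annihilator_def)
  have in_K': "a \<in> ?K'" if a: "a \<in> ?K" "a \<odot>\<^bsub>E\<^esub> e = \<zero>\<^bsub>E\<^esub>" for a
  proof -
    have ac: "a \<in> carrier R" using a by (auto simp: annihilator_def)
    have "a \<odot>\<^bsub>E\<^esub> y = \<zero>\<^bsub>E\<^esub>" if yY: "y \<in> Y" for y
    proof -
      obtain x r where "y = x \<oplus>\<^bsub>E\<^esub> r \<odot>\<^bsub>E\<^esub> e" "x \<in> H" "r \<in> carrier R"
        using subsetD[OF e(2) yY] unfolding adj_def by blast
      then show ?thesis using a ac ec H(1)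
        by (simp add: E.smult_r_distr annihilator_def E_smult_comm[of a r])
    qed
    then show ?thesis using ac by (simp add: annihilator_def)
  qed
  show ?thesis
  proof (cases "\<forall>a\<in>?K. a \<odot>\<^bsub>E\<^esub> e = \<zero>\<^bsub>E\<^esub>")
    case True
    then have "?K = ?K'" using in_K' K'K by blast
    then show ?thesis using simple_step_refl[OF Reg_module sub(1)] by simp
  next
    case False
    then obtain b where b: "b \<in> ?K" "b \<odot>\<^bsub>E\<^esub> e \<noteq> \<zero>\<^bsub>E\<^esub>" by blast
    have Kc: "a \<in> carrier R" if "a \<in> ?K" for a using that by (simp add: annihilator_def)
    have soc: "c \<odot>\<^bsub>E\<^esub> (a \<odot>\<^bsub>E\<^esub> e) = \<zero>\<^bsub>E\<^esub>" if "c \<in> m" "a \<in> ?K" for a c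
      using that e(3) ec E_smult_comm[of c a e] m_carrier by (simp add: annihilator_def)
    have "c \<odot>\<^bsub>Reg\<^esub> b \<in> ?K'" if "c \<in> m" for c
      using that b(1) soc[OF that b(1)] Reg.submoduleD(4)[OF sub(1) m_carrier[OF that] b(1)] m_carrier Kc ec
      by (intro in_K') (auto simp: E.smult_assoc1)
    moreover have "?K \<subseteq> adj R Reg ?K' b"
    proof
      fix a assume a: "a \<in> ?K"
      obtain r where r: "r \<in> carrier R" "a \<odot>\<^bsub>E\<^esub> e = r \<odot>\<^bsub>E\<^esub> (b \<odot>\<^bsub>E\<^esub> e)"
        using socle_simple[of "b \<odot>\<^bsub>E\<^esub> e" "a \<odot>\<^bsub>E\<^esub> e"] soc a b Kc ec by auto
      let ?d = "a \<oplus> (\<ominus> (r \<otimes> b))"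
      have "\<ominus> (r \<otimes> b) = (\<ominus> r) \<otimes> b" using r Kc b by (simp add: l_minus)
      then have "\<ominus> (r \<otimes> b) \<in> ?K" using Reg.submoduleD(4)[OF sub(1), of "\<ominus> r" b] b r by simp
      then have dK: "?d \<in> ?K" using Reg.submoduleD(3)[OF sub(1) a] by simp
      moreover have "?d \<odot>\<^bsub>E\<^esub> e = \<zero>\<^bsub>E\<^esub>"
        using r a b Kc ec by (simp add: E.smult_l_distr E.smult_l_minus E.smult_assoc1 E.r_neg)
      ultimately have "?d \<in> ?K'" by (rule in_K')
      moreover have "a = ?d \<oplus> r \<otimes> b" using r Kc a b by (simp add: a_assoc l_neg)
      ultimately show "a \<in> adj R Reg ?K' b" using r unfolding adj_def by auto
    qed
    ultimately show ?thesis unfolding simple_step_def using sub K'K b(1) by blast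
  qed
qed

text \<open>The mirror image of \<open>annihilator_simple_step\<close>: for K' = K + R b with m b in
  K, multiplication by b maps ann K into the socle of E, with kernel ann K'.\<close>

lemma ann_in_simple_step:
  assumes "simple_step Reg K K'"
  shows "simple_step E (ann_in E K') (ann_in E K)"
proof -
  obtain b where KK: "submodule K R Reg" "submodule K' R Reg" "K \<subseteq> K'" and b: "b \<in> K'"
    "K' \<subseteq> adj R Reg K b" "\<forall>a\<in>m. a \<otimes> b \<in> K" using assms unfolding simple_step_def by auto
  let ?Y = "ann_in E K" and ?H = "ann_in E K'"
  have Kc: "a \<in> carrier R" if "a \<in> K'" for a using Reg.submoduleD(1)[OF KK(2) that] by simp
  have sub: "submodule ?Y R E" "submodule ?H R E"
    using Kc KK(3) by (auto intro!: submodule_ann_in[OF E_module])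
  note Y = E.submoduleD[OF sub(1)]
  have HY: "?H \<subseteq> ?Y" using KK(3) by (auto simp: ann_in_def)
  have in_H: "e \<in> ?H" if e: "e \<in> ?Y" "b \<odot>\<^bsub>E\<^esub> e = \<zero>\<^bsub>E\<^esub>" for e
  proof -
    have ec: "e \<in> carrier E" using Y(1) e by blast
    have "a \<odot>\<^bsub>E\<^esub> e = \<zero>\<^bsub>E\<^esub>" if aK': "a \<in> K'" for a
    proof -
      obtain k r where kr: "a = k \<oplus> r \<otimes> b" "k \<in> K" "r \<in> carrier R"
        using subsetD[OF b(2) aK'] unfolding adj_def by auto
      then have "k \<in> carrier R" "k \<odot>\<^bsub>E\<^esub> e = \<zero>\<^bsub>E\<^esub>" using Kc KK(3) e by (auto simp: ann_in_def)
      then show ?thesis using kr e(2) ec Kc[OF b(1)] by (simp add: E.smult_l_distr E.smult_assoc1)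
    qed
    then show ?thesis using ec by (simp add: ann_in_def)
  qed
  show ?thesis
  proof (cases "\<forall>e\<in>?Y. b \<odot>\<^bsub>E\<^esub> e = \<zero>\<^bsub>E\<^esub>")
    case True
    then have "?H = ?Y" using in_H HY by blast
    then show ?thesis using simple_step_refl[OF E_module sub(1)] by simp
  next
    case False
    then obtain e where e: "e \<in> ?Y" "b \<odot>\<^bsub>E\<^esub> e \<noteq> \<zero>\<^bsub>E\<^esub>" by blast
    note bc = Kc[OF b(1)]
    have soc: "c \<odot>\<^bsub>E\<^esub> (b \<odot>\<^bsub>E\<^esub> y) = \<zero>\<^bsub>E\<^esub>" if "c \<in> m" "y \<in> ?Y" for c y
    proof -
      have "(c \<otimes> b) \<odot>\<^bsub>E\<^esub> y = \<zero>\<^bsub>E\<^esub>" using that b(3) by (simp add: ann_in_def)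
      then show ?thesis using E.smult_assoc1[of c b y] m_carrier[OF that(1)] bc Y(1)[OF that(2)] by simp
    qed
    have ec: "e \<in> carrier E" using Y(1) e by blast
    have "c \<odot>\<^bsub>E\<^esub> e \<in> ?H" if "c \<in> m" for c
      using soc[OF that e(1)] Y(4)[OF m_carrier[OF that] e(1)] E_smult_comm[OF m_carrier[OF that] bc ec]
      by (intro in_H) auto
    moreover have "?Y \<subseteq> adj R E ?H e"
    proof
      fix y assume y: "y \<in> ?Y"
      note yc = Y(1)[OF y]
      obtain r where r: "r \<in> carrier R" "b \<odot>\<^bsub>E\<^esub> y = r \<odot>\<^bsub>E\<^esub> (b \<odot>\<^bsub>E\<^esub> e)"
        using socle_simple[of "b \<odot>\<^bsub>E\<^esub> e" "b \<odot>\<^bsub>E\<^esub> y"] soc y e bc ec yc by auto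
      have "y \<ominus>\<^bsub>E\<^esub> r \<odot>\<^bsub>E\<^esub> e \<in> ?Y" using Y(4,5) y e r by auto
      moreover have "b \<odot>\<^bsub>E\<^esub> (y \<ominus>\<^bsub>E\<^esub> r \<odot>\<^bsub>E\<^esub> e) = \<zero>\<^bsub>E\<^esub>"
        using r bc ec yc E_smult_comm[OF bc r(1) ec]
        by (simp add: a_minus_def E.smult_r_distr E.smult_r_minus E.r_neg)
      ultimately have "y \<ominus>\<^bsub>E\<^esub> r \<odot>\<^bsub>E\<^esub> e \<in> ?H" by (rule in_H)
      moreover have "y = (y \<ominus>\<^bsub>E\<^esub> r \<odot>\<^bsub>E\<^esub> e) \<oplus>\<^bsub>E\<^esub> r \<odot>\<^bsub>E\<^esub> e"
        using yc ec r by (simp add: a_minus_def E.a_assoc E.l_neg)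
      ultimately show "y \<in> adj R E ?H e" using r unfolding adj_def by blast
    qed
    ultimately show ?thesis unfolding simple_step_def using sub HY e(1) by blast
  qed
qed

lemma steps_single:
  assumes "simple_step M H Y" shows "steps M 1 H Y"
proof -
  have "submodule H R M" using assms by (simp add: simple_step_def)
  from steps_step[OF steps_refl[OF this] assms] show ?thesis by simp
qed

lemma annihilator_steps:
  assumes "steps E n H Y" shows "steps Reg n (annihilator R E Y) (annihilator R E H)"
  using assms
proof (induction rule: steps.induct)
  case (steps_refl U)
  then show ?case using E.submoduleE(1) by (intro steps.steps_refl submodule_annihilator[OF E_module])
next
  case (steps_step n U Y Z)
  then show ?case
    using steps_trans[OF steps_step.IH steps_single[OF annihilator_simple_step]] by simp
qed

lemma ann_in_steps:
  assumes "steps Reg n K K'" shows "steps E n (ann_in E K') (ann_in E K)"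
  using assms
proof (induction rule: steps.induct)
  case (steps_refl U)
  then show ?case using Reg.submoduleE(1)[OF steps_refl]
    by (intro steps.steps_refl submodule_ann_in[OF E_module]) auto
next
  case (steps_step n U Y Z)
  then show ?case
    using steps_trans[OF steps_step.IH steps_single[OF ann_in_simple_step]] by simp
qed

lemma ann_in_carrier: "ann_in E (carrier R) = {\<zero>\<^bsub>E\<^esub>}"
proof -
  have "e = \<zero>\<^bsub>E\<^esub>" if "e \<in> ann_in E (carrier R)" for e
    using that E.smult_one[of e] unfolding ann_in_def by auto
  then show ?thesis by (auto simp: ann_in_def)
qed

lemma annihilator_zero: "annihilator R E {\<zero>\<^bsub>E\<^esub>} = carrier R"
  by (auto simp: annihilator_def)

text \<open>Taking annihilators twice does not increase the number of simple steps, so a submodule of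
  minimal step number cannot be strictly contained in its double annihilator.\<close>

lemma ann_in_annihilator_of_steps:
  assumes "steps E n {\<zero>\<^bsub>E\<^esub>} N"
  shows "ann_in E (annihilator R E N) = N"
proof (rule ccontr)
  assume neq: "ann_in E (annihilator R E N) \<noteq> N"
  define l where "l = (LEAST k. steps E k {\<zero>\<^bsub>E\<^esub>} N)"
  have l: "steps E l {\<zero>\<^bsub>E\<^esub>} N" unfolding l_def using assms by (rule LeastI)
  have N: "submodule N R E" "{\<zero>\<^bsub>E\<^esub>} \<subseteq> N" using steps_submodule[OF l] by auto
  have "N \<subseteq> ann_in E (annihilator R E N)"
    using E.submoduleE(1)[OF N(1)] by (auto simp: ann_in_def annihilator_def)
  then have "N \<subset> ann_in E (annihilator R E N)" using neq by blast
  moreover have "steps E l {\<zero>\<^bsub>E\<^esub>} (ann_in E (annihilator R E N))"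
    using ann_in_steps[OF annihilator_steps[OF l]] by (simp add: annihilator_zero ann_in_carrier)
  ultimately obtain k where "k < l" "steps E k {\<zero>\<^bsub>E\<^esub>} N"
    using steps_psubset[OF E_module _ N] by blast
  then show False unfolding l_def using not_less_Least by blast
qed

section \<open>Powers of the maximal ideal\<close>

lemma ideal_power_0: "ideal_power R m 0 = carrier R"
  by (simp add: ideals_set_def)

lemma ideal_power_Suc: "ideal_power R m (Suc n) = ideal_prod R (ideal_power R m n) m"
  by (simp add: ideals_set_def)

lemma ideal_power_ideal: "ideal (ideal_power R m n) R"
proof (induction n)
  case 0
  show ?case unfolding ideal_power_0 by (rule oneideal)
next
  case (Suc n)
  then show ?case unfolding ideal_power_Suc by (rule ideal_prod_is_ideal[OF _ m_ideal])
qed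

lemma ideal_power_antimono: "i \<le> j \<Longrightarrow> ideal_power R m j \<subseteq> ideal_power R m i"
proof (rule lift_Suc_antimono_le[of "ideal_power R m"])
  fix n show "ideal_power R m (Suc n) \<subseteq> ideal_power R m n"
    using ideal_prod_inter[OF ideal_power_ideal m_ideal] unfolding ideal_power_Suc by blast
qed

lemma span_of_Reg: "span_of R Reg A = genideal R A"
  unfolding span_of_def genideal_def submodule_regular_iff ..

text \<open>Each factor of consecutive powers is killed by m and, R being Noetherian, finitely
  generated, so it is exhausted by finitely many simple steps.\<close>

lemma steps_ideal_power: "\<exists>l. steps Reg l (ideal_power R m n) (carrier R)"
proof (induction n)
  case 0
  show ?case unfolding ideal_power_0 using steps_refl[of "carrier R" Reg] Reg.carrier_is_submodule by auto
next
  case (Suc n)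
  then obtain l where l: "steps Reg l (ideal_power R m n) (carrier R)" by blast
  let ?P = "ideal_power R m n" and ?Q = "ideal_power R m (Suc n)"
  obtain A where A: "A \<subseteq> carrier R" "finite A" "?P = genideal R A"
    using finetely_gen[OF ideal_power_ideal] by blast
  have "\<exists>k. steps Reg k ?Q ?P"
  proof (rule steps_of_generators[OF Reg_module _ _ _ A(2)])
    show "submodule ?Q R Reg" "submodule ?P R Reg"
      using ideal_power_ideal submodule_regular_iff by blast+
    show "?Q \<subseteq> ?P" by (rule ideal_power_antimono) simp
    show "A \<subseteq> ?P" unfolding A(3) using genideal_self[OF A(1)] .
    have "span_of R Reg A \<subseteq> span_of R Reg (?Q \<union> A)" unfolding span_of_def by blast
    then show "?P \<subseteq> span_of R Reg (?Q \<union> A)" unfolding A(3) span_of_Reg .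
    fix a y assume ay: "a \<in> m" "y \<in> ?P"
    have "y \<otimes> a \<in> ?Q" unfolding ideal_power_Suc by (rule ideal_prod.prod[OF ay(2,1)])
    then show "a \<odot>\<^bsub>Reg\<^esub> y \<in> ?Q"
      using m_comm[OF ideal.Icarr[OF ideal_power_ideal ay(2)] m_carrier[OF ay(1)]] by simp
  qed
  then show ?case using steps_trans[OF l] by blast
qed

text \<open>The steps from m^n up to R turn into steps from zero up to ann (m^n) in E, and
  submodules inherit finiteness by \<open>steps_psubset\<close>.\<close>

lemma torsion_steps:
  assumes "submodule H R E" "H \<subseteq> ann_in E (ideal_power R m n)"
  shows "\<exists>l. steps E l {\<zero>\<^bsub>E\<^esub>} H"
proof -
  obtain l where "steps Reg l (ideal_power R m n) (carrier R)" using steps_ideal_power by blast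
  then have l: "steps E l {\<zero>\<^bsub>E\<^esub>} (ann_in E (ideal_power R m n))"
    using ann_in_steps ann_in_carrier by metis
  show ?thesis
  proof (cases "H = ann_in E (ideal_power R m n)")
    case False
    then show ?thesis using steps_psubset[OF E_module l assms(1)] assms(2) E.submoduleD(2)[OF assms(1)]
      by blast
  qed (use l in blast)
qed

section \<open>Torsion of E with respect to the maximal ideal\<close>

lemma ann_in_antimono: "K \<subseteq> K' \<Longrightarrow> ann_in E K' \<subseteq> ann_in E K"
  by (auto simp: ann_in_def)

lemma ann_in_ideal_power_mono: "i \<le> j \<Longrightarrow> ann_in E (ideal_power R m i) \<subseteq> ann_in E (ideal_power R m j)"
  by (intro ann_in_antimono ideal_power_antimono)

lemma ann_in_ideal_submodule: "ideal K R \<Longrightarrow> submodule (ann_in E K) R E"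
  using ideal.Icarr by (intro submodule_ann_in[OF E_module]) auto

lemma finite_subset_torsion:
  assumes "finite A" "\<And>a. a \<in> A \<Longrightarrow> \<exists>n. a \<in> ann_in E (ideal_power R m n)"
  shows "\<exists>n. A \<subseteq> ann_in E (ideal_power R m n)"
  using assms
proof (induction A)
  case (insert a A)
  then obtain n k where "A \<subseteq> ann_in E (ideal_power R m n)" "a \<in> ann_in E (ideal_power R m k)"
    by (metis insertCI)
  then show ?case using ann_in_ideal_power_mono[of n "max n k"] ann_in_ideal_power_mono[of k "max n k"]
    by (intro exI[of _ "max n k"]) auto
qed auto

text \<open>Take a counterexample x whose annihilator is maximal among counterexamples. If a x with
  a in m were again one, ann (a x) = ann x by maximality; but r x = s for some r, and a s = 0 puts r
  into ann (a x) and not into ann x. So m x consists of torsion elements, and as m is finitely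
  generated one power m^n kills m x, whence m^(n+1) kills x.\<close>

lemma torsion:
  assumes "e \<in> carrier E" shows "\<exists>n. e \<in> ann_in E (ideal_power R m n)"
proof (rule ccontr)
  define T where "T e \<longleftrightarrow> (\<exists>n. e \<in> ann_in E (ideal_power R m n))" for e
  assume "\<not> (\<exists>n. e \<in> ann_in E (ideal_power R m n))"
  then have ne: "{annihilator R E {e} | e. e \<in> carrier E \<and> \<not> T e} \<noteq> {}" (is "?S \<noteq> _")
    using assms unfolding T_def by blast
  obtain M where M: "M \<in> ?S" "\<And>I. I \<in> ?S \<Longrightarrow> M \<subseteq> I \<Longrightarrow> I = M"
    by (rule ideals_maximal_element[OF ne]) (use ideal_annihilator in auto)
  then obtain x where x: "M = annihilator R E {x}" "x \<in> carrier E" "\<not> T x" by blast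
  have Tm: "T (a \<odot>\<^bsub>E\<^esub> x)" if a: "a \<in> m" for a
  proof (rule ccontr)
    assume nT: "\<not> T (a \<odot>\<^bsub>E\<^esub> x)"
    note ac = m_carrier[OF a]
    have "M \<subseteq> annihilator R E {a \<odot>\<^bsub>E\<^esub> x}" unfolding x(1)
      using ac by (auto simp: annihilator_def E_smult_comm[OF _ ac x(2)])
    then have eq: "annihilator R E {a \<odot>\<^bsub>E\<^esub> x} = M" using M(2) nT ac x(2) by blast
    have "T \<zero>\<^bsub>E\<^esub>" unfolding T_def
      using E.submoduleD(2)[OF ann_in_ideal_submodule[OF ideal_power_ideal]] by blast
    then have "x \<noteq> \<zero>\<^bsub>E\<^esub>" using nT ac by auto
    then obtain r where r: "r \<in> carrier R" "r \<odot>\<^bsub>E\<^esub> x = s" using essential x(2) by blast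
    then have "r \<in> annihilator R E {a \<odot>\<^bsub>E\<^esub> x}"
      using E_smult_comm[OF r(1) ac x(2)] m_s[OF a] ac by (simp add: annihilator_def)
    then have "r \<in> annihilator R E {x}" using eq x(1) by simp
    then show False using r s_nonzero by (simp add: annihilator_def)
  qed
  obtain A where A: "A \<subseteq> carrier R" "finite A" "m = genideal R A"
    using finetely_gen[OF m_ideal] by blast
  then have Am: "A \<subseteq> m" using genideal_self by simp
  obtain n where n: "(\<lambda>a. a \<odot>\<^bsub>E\<^esub> x) ` A \<subseteq> ann_in E (ideal_power R m n)"
    using finite_subset_torsion[of "(\<lambda>a. a \<odot>\<^bsub>E\<^esub> x) ` A"] A(2) Tm Am unfolding T_def by blast
  have hom: "(\<lambda>a. a \<odot>\<^bsub>E\<^esub> x) \<in> mod_hom R Reg E"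
    using x(2) by (intro mod_homI) (auto simp: E.smult_l_distr E.smult_assoc1)
  have "submodule {a \<in> carrier Reg. a \<odot>\<^bsub>E\<^esub> x \<in> ann_in E (ideal_power R m n)} R Reg"
    by (rule submodule_vimage[OF Reg_module E_module hom ann_in_ideal_submodule[OF ideal_power_ideal]])
  \<comment> \<open>The coefficients a for which m^n kills a x form an ideal, so it suffices that it
    contains the generators A of m.\<close>
  then have "m \<subseteq> {a \<in> carrier Reg. a \<odot>\<^bsub>E\<^esub> x \<in> ann_in E (ideal_power R m n)}"
    using A n unfolding A(3) by (intro genideal_minimal) (auto simp: submodule_regular_iff)
  then have mx: "b \<odot>\<^bsub>E\<^esub> (a \<odot>\<^bsub>E\<^esub> x) = \<zero>\<^bsub>E\<^esub>" if "a \<in> m" "b \<in> ideal_power R m n" for a b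
    using that by (auto simp: ann_in_def)
  have "c \<odot>\<^bsub>E\<^esub> x = \<zero>\<^bsub>E\<^esub> \<and> c \<in> carrier R" if "c \<in> ideal_prod R (ideal_power R m n) m" for c
    using that
  proof (induction rule: ideal_prod.induct)
    case (prod i j)
    then show ?case using mx[of j i] m_carrier[of j] ideal.Icarr[OF ideal_power_ideal, of i n] x(2)
      by (simp add: E.smult_assoc1)
  next
    case (sum s1 s2)
    then show ?case using x(2) by (simp add: E.smult_l_distr)
  qed
  then have "x \<in> ann_in E (ideal_power R m (Suc n))"
    unfolding ideal_power_Suc using x(2) by (simp add: ann_in_def)
  then show False using x(3) unfolding T_def by blast
qed

lemma finitely_generated_torsion:
  assumes "submodule H R E" "finitely_generated R (E\<lparr>carrier := H\<rparr>)"
  shows "\<exists>n. H \<subseteq> ann_in E (ideal_power R m n)"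
proof -
  obtain A where A: "A \<subseteq> H" "finite A" "H = span_of R E A"
    using assms(2) finitely_generated_submodule_iff[OF E_module assms(1)] by blast
  obtain n where n: "A \<subseteq> ann_in E (ideal_power R m n)"
    using finite_subset_torsion[OF A(2)] torsion A(1) E.submoduleD(1)[OF assms(1)] by blast
  show ?thesis unfolding A(3)
    using span_of_least[OF ann_in_ideal_submodule[OF ideal_power_ideal] n] by blast
qed

lemma torsion_finite_length:
  assumes "submodule H R E" "H \<subseteq> ann_in E (ideal_power R m n)"
  shows "module_length R (E\<lparr>carrier := H\<rparr>) < \<infinity>"
proof -
  obtain l where l: "steps E l {\<zero>\<^bsub>E\<^esub>} H" using torsion_steps[OF assms] by blast
  have "k \<le> l" if C: "submodule_chain R (E\<lparr>carrier := H\<rparr>) k C" for k C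
  proof -
    have "submodule_chain R E k C" "C k \<subseteq> H" "submodule (C 0) R E"
      using C submodule_submodule[OF E_module assms(1)] by (auto simp: submodule_chain_def)
    then show ?thesis
      using steps_chain_bound[OF E_module l] E.submoduleD(2) by blast
  qed
  then show ?thesis unfolding module_length_finite_iff by blast
qed

text \<open>Chains of ideals above J are chains above m^n, and these are bounded by the number of
  steps from m^n to R.\<close>

lemma quotient_finite_length:
  assumes "ideal J R" "ideal_power R m n \<subseteq> J"
  shows "module_length R (quotient_module R Reg J) < \<infinity>"
proof -
  obtain l where l: "steps Reg l (ideal_power R m n) (carrier R)" using steps_ideal_power by blast
  show ?thesis
  proof (rule finite_length_quotient[OF Reg_module])
    show "submodule J R Reg" using assms(1) submodule_regular_iff by blast
    fix k C assume C: "submodule_chain R Reg k C" "J \<subseteq> C 0"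
    then have "C k \<subseteq> carrier R" using Reg.submoduleE(1)[of "C k"] by (simp add: submodule_chain_def)
    then show "k \<le> l" using steps_chain_bound[OF Reg_module l C(1)] C(2) assms(2) by blast
  qed
qed

section \<open>Double annihilators in E and the Artinian property\<close>

lemma annihilator_antimono: "S \<subseteq> T \<Longrightarrow> annihilator R E T \<subseteq> annihilator R E S"
  by (auto simp: annihilator_def)

lemma smult_minus_zero_iff:
  assumes "a \<in> carrier R" "b \<in> carrier R" "x \<in> carrier E"
  shows "(a \<ominus> b) \<odot>\<^bsub>E\<^esub> x = \<zero>\<^bsub>E\<^esub> \<longleftrightarrow> a \<odot>\<^bsub>E\<^esub> x = b \<odot>\<^bsub>E\<^esub> x"
proof -
  have "(a \<ominus> b) \<odot>\<^bsub>E\<^esub> x = a \<odot>\<^bsub>E\<^esub> x \<ominus>\<^bsub>E\<^esub> b \<odot>\<^bsub>E\<^esub> x"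
    using assms by (simp add: a_minus_def E.smult_l_distr E.smult_l_minus)
  then show ?thesis using assms E.minus_eq_zero_iff by simp
qed

text \<open>Let e be killed by ann N and by m^n. The part T n of N killed by m^n is the annihilator
  of K n, so it remains to see that each x in K n kills e. Completeness yields y in ann N with y - x
  in m^n, and then x e = y e = 0.\<close>

lemma ann_in_annihilator:
  assumes complete: "adically_complete R m" and N: "submodule N R E"
  shows "ann_in E (annihilator R E N) = N"
proof
  note Nc = E.submoduleD(1)[OF N]
  show "N \<subseteq> ann_in E (annihilator R E N)"
    using Nc by (auto simp: ann_in_def annihilator_def)
  let ?P = "\<lambda>k. ideal_power R m k"
  define T where "T k = N \<inter> ann_in E (?P k)" for k
  define K where "K k = annihilator R E (T k)" for k
  have T: "submodule (T k) R E" for k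
    using N ann_in_ideal_submodule[OF ideal_power_ideal, of k] unfolding T_def E.submodule_iff by auto
  have annK: "ann_in E (K k) = T k" for k
  proof -
    have "T k \<subseteq> ann_in E (?P k)" by (simp add: T_def)
    then obtain l where "steps E l {\<zero>\<^bsub>E\<^esub>} (T k)" using torsion_steps[OF T] by blast
    then show ?thesis unfolding K_def by (rule ann_in_annihilator_of_steps)
  qed
  have Kid: "ideal (K k) R" for k
    unfolding K_def by (rule ideal_annihilator[OF E.submoduleE(1)[OF T]])
  note Kc = ideal.Icarr[OF Kid] and Pc = ideal.Icarr[OF ideal_power_ideal]
  \<comment> \<open>\<open>K k = K (Suc k) + m^k\<close>, so an element of \<open>K n\<close> lifts along a Cauchy sequence whose limit
    annihilates all of \<open>N\<close>.\<close>
  have Kstep: "\<exists>x'\<in>K (Suc k). x' \<ominus> x \<in> ?P k" if x: "x \<in> K k" for k x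
  proof -
    let ?L = "K (Suc k) <+>\<^bsub>R\<^esub> ?P k"
    have L: "ideal ?L R" by (rule add_ideals[OF Kid ideal_power_ideal])
    have sub: "K (Suc k) \<subseteq> ?L" "?P k \<subseteq> ?L"
    proof -
      have "a = a \<oplus> \<zero>" if "a \<in> K (Suc k)" for a using Kc[OF that] by simp
      then show "K (Suc k) \<subseteq> ?L"
        using additive_subgroup.zero_closed[OF ideal.axioms(1)[OF ideal_power_ideal]]
        unfolding set_add_def' by blast
      have "a = \<zero> \<oplus> a" if "a \<in> ?P k" for a using Pc[OF that] by simp
      then show "?P k \<subseteq> ?L"
        using additive_subgroup.zero_closed[OF ideal.axioms(1)[OF Kid]]
        unfolding set_add_def' by blast
    qed
    \<comment> \<open>An element killed by the sum lies in T (k+1) and is killed by m^k, hence lies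
      in T k. Passing to annihilators gives K k \<subseteq> L, as the ideal L is its own double
      annihilator.\<close>
    have "ann_in E ?L \<subseteq> ann_in E (K (Suc k)) \<inter> ann_in E (?P k)"
      using ann_in_antimono[OF sub(1)] ann_in_antimono[OF sub(2)] by blast
    then have "ann_in E ?L \<subseteq> T k" unfolding annK by (auto simp: T_def)
    then have "K k \<subseteq> ?L" unfolding K_def
      using annihilator_antimono annihilator_ann_in[OF L] by (metis K_def)
    then obtain a b where ab: "x = a \<oplus> b" "a \<in> K (Suc k)" "b \<in> ?P k"
      using x unfolding set_add_def' by auto
    have "a \<ominus> x = \<ominus> b" using ab Kc[OF ab(2)] Pc[OF ab(3)]
      by (simp add: a_minus_def minus_add r_neg1 r_neg2)
    then have "a \<ominus> x \<in> ?P k"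
      using ab(3) additive_subgroup.a_inv_closed[OF ideal.axioms(1)[OF ideal_power_ideal]] by simp
    then show ?thesis using ab(2) by blast
  qed
  have lift: "\<exists>y\<in>annihilator R E N. y \<ominus> x \<in> ?P n" if x: "x \<in> K n" for n x
  proof -
    \<comment> \<open>The sequence stays at x up to index n and moves afterwards, so that its limit
      is still congruent to x modulo m^n.\<close>
    let ?Q = "\<lambda>k z. (k \<le> n \<longrightarrow> z = x) \<and> (n \<le> k \<longrightarrow> z \<in> K k)"
    have "\<exists>f. \<forall>k. ?Q k (f k) \<and> f (Suc k) \<ominus> f k \<in> ?P k"
    proof (rule dependent_nat_choice)
      show "\<exists>z. ?Q 0 z" using x by auto
      fix z k assume z: "?Q k z"
      show "\<exists>y. ?Q (Suc k) y \<and> y \<ominus> z \<in> ?P k"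
      proof (cases "Suc k \<le> n")
        case True
        have "x \<ominus> x = \<zero>" using Kc[OF x] by (simp add: a_minus_def r_neg)
        then have "x \<ominus> x \<in> ?P k"
          using additive_subgroup.zero_closed[OF ideal.axioms(1)[OF ideal_power_ideal]] by simp
        then have "?Q (Suc k) x \<and> x \<ominus> z \<in> ?P k" using z True x le_antisym[OF True] by auto
        then show ?thesis by blast
      next
        case False
        then have "z \<in> K k" using z by simp
        then show ?thesis using Kstep False by auto
      qed
    qed
    then obtain f where f: "\<And>k. ?Q k (f k)" "\<And>k. f (Suc k) \<ominus> f k \<in> ?P k" by blast
    have fc: "f k \<in> carrier R" for k using f(1)[of k] Kc x by (cases "k \<le> n") auto
    obtain y where y: "y \<in> carrier R" "\<And>k. y \<ominus> f k \<in> ?P k"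
      using complete f(2) fc unfolding adically_complete_def by metis
    have "y \<odot>\<^bsub>E\<^esub> u = \<zero>\<^bsub>E\<^esub>" if u: "u \<in> N" for u
    proof -
      note uc = Nc[OF u]
      obtain i where i: "u \<in> ann_in E (?P i)" using torsion[OF uc] by blast
      \<comment> \<open>The index must reach i for m^k to kill u, and n for \<open>f k\<close> to
        lie in K k.\<close>
      define k where "k = max n i"
      have uk: "u \<in> ann_in E (?P k)" using ann_in_ideal_power_mono[of i k] i unfolding k_def by auto
      then have "u \<in> T k" using u by (simp add: T_def)
      moreover have "f k \<in> K k" using f(1)[of k] by (simp add: k_def)
      ultimately have "f k \<odot>\<^bsub>E\<^esub> u = \<zero>\<^bsub>E\<^esub>" by (simp add: K_def annihilator_def)
      moreover have "(y \<ominus> f k) \<odot>\<^bsub>E\<^esub> u = \<zero>\<^bsub>E\<^esub>" using y(2) uk by (simp add: ann_in_def)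
      ultimately show ?thesis using smult_minus_zero_iff[OF y(1) fc uc] by metis
    qed
    then have "y \<in> annihilator R E N" using y(1) by (simp add: annihilator_def)
    moreover have "y \<ominus> x \<in> ?P n" using y(2)[of n] f(1)[of n] by simp
    ultimately show ?thesis by blast
  qed
  show "ann_in E (annihilator R E N) \<subseteq> N"
  proof
    fix e assume e: "e \<in> ann_in E (annihilator R E N)"
    then have ec: "e \<in> carrier E" by (simp add: ann_in_def)
    obtain n where n: "e \<in> ann_in E (?P n)" using torsion[OF ec] by blast
    have "x \<odot>\<^bsub>E\<^esub> e = \<zero>\<^bsub>E\<^esub>" if x: "x \<in> K n" for x
    proof -
      obtain y where y: "y \<in> annihilator R E N" "y \<ominus> x \<in> ?P n" using lift[OF x] by blast
      have "y \<odot>\<^bsub>E\<^esub> e = \<zero>\<^bsub>E\<^esub>" "(y \<ominus> x) \<odot>\<^bsub>E\<^esub> e = \<zero>\<^bsub>E\<^esub>" using e n y by (auto simp: ann_in_def)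
      moreover have "y \<in> carrier R" using y by (simp add: annihilator_def)
      moreover note Kc[OF x]
      ultimately show ?thesis using smult_minus_zero_iff ec by metis
    qed
    then have "e \<in> ann_in E (K n)" using ec by (simp add: ann_in_def)
    then show "e \<in> N" unfolding annK by (simp add: T_def)
  qed
qed

text \<open>The annihilators of a descending chain ascend and attain a maximal member; equality of
  annihilators gives equality of submodules by the double annihilator.\<close>

lemma artinian_E:
  assumes complete: "adically_complete R m"
  shows "artinian R E"
  unfolding artinian_def
proof (intro conjI allI impI E_module)
  fix N :: "nat \<Rightarrow> 'u set" assume N: "\<forall>n. submodule (N n) R E \<and> N (Suc n) \<subseteq> N n"
  have anti: "N n \<subseteq> N k" if "k \<le> n" for n k
    using lift_Suc_antimono_le[of N, OF _ that] N by simp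
  have sub: "submodule (N n) R E" for n using N by simp
  let ?S = "range (\<lambda>n. annihilator R E (N n))"
  obtain M where M: "M \<in> ?S" "\<And>I. I \<in> ?S \<Longrightarrow> M \<subseteq> I \<Longrightarrow> I = M"
    by (rule ideals_maximal_element[of ?S]) (use ideal_annihilator E.submoduleE(1)[OF sub] in auto)
  then obtain k where k: "M = annihilator R E (N k)" by blast
  have "N n = N k" if "n \<ge> k" for n
  proof -
    have "annihilator R E (N n) = annihilator R E (N k)"
      using M(2)[of "annihilator R E (N n)"] annihilator_antimono[OF anti[OF that]] unfolding k by blast
    then show ?thesis using ann_in_annihilator[OF complete sub] by metis
  qed
  then show "\<exists>k. \<forall>n\<ge>k. N n = N k" by blast
qed

text \<open>Choose t outside J with m t in J, and e in ann_E J with t e nonzero. A coefficient r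
  with r t e = 0 must lie in m, so ann e meets J + R t only in J. Since J + R t is strictly larger
  than J, irreducibility forces ann e = J.\<close>

lemma irreducible_eq_annihilator:
  assumes "irreducible_ideal R J" "ideal_power R m n \<subseteq> J"
  obtains e where "e \<in> carrier E" "annihilator R E {e} = J"
proof -
  have J: "ideal J R" using assms(1) by (simp add: irreducible_ideal_def)
  note Jc = ideal.Icarr[OF J]
  show thesis
  proof (cases "J = carrier R")
    case True
    \<comment> \<open>The unit ideal counts as irreducible here; it is the annihilator of
      zero.\<close>
    then show ?thesis using that[of "\<zero>\<^bsub>E\<^esub>"] annihilator_zero by simp
  next
    case False
    \<comment> \<open>With l = k + 1 minimal, any t in m^k outside J satisfies m t \<subseteq> m^l
      \<subseteq> J.\<close>
    define l where "l = (LEAST l. ideal_power R m l \<subseteq> J)"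
    have l: "ideal_power R m l \<subseteq> J" unfolding l_def using assms(2) by (rule LeastI)
    have "l \<noteq> 0" using l False Jc ideal_power_0 by (metis subsetI subset_antisym)
    then obtain k where k: "l = Suc k" using not0_implies_Suc by blast
    then have "\<not> ideal_power R m k \<subseteq> J" using not_less_Least[of k "\<lambda>l. ideal_power R m l \<subseteq> J"] unfolding l_def by auto
    then obtain t where t: "t \<in> ideal_power R m k" "t \<notin> J" by blast
    have tc: "t \<in> carrier R" using ideal.Icarr[OF ideal_power_ideal t(1)] .
    have mt: "a \<otimes> t \<in> J" if "a \<in> m" for a
    proof -
      have "t \<otimes> a \<in> ideal_power R m l" unfolding k ideal_power_Suc by (rule ideal_prod.prod[OF t(1) that])
      then show ?thesis using l m_comm[OF tc m_carrier[OF that]] by auto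
    qed
    obtain e where e: "e \<in> ann_in E J" "t \<odot>\<^bsub>E\<^esub> e \<noteq> \<zero>\<^bsub>E\<^esub>" using cogenerator[OF J tc t(2)] by blast
    have ec: "e \<in> carrier E" using e by (simp add: ann_in_def)
    let ?A = "annihilator R E {e}" and ?B = "adj R Reg J t"
    have A: "ideal ?A R" using ec by (intro ideal_annihilator) simp
    have Jsub: "submodule J R Reg" using J submodule_regular_iff by blast
    have B: "ideal ?B R" "J \<subseteq> ?B" "t \<in> ?B"
      using adj_submodule[OF Reg_module Jsub, of t] tc submodule_regular_iff by auto
    have JA: "J \<subseteq> ?A" using e(1) Jc by (auto simp: ann_in_def annihilator_def)
    have "?A \<inter> ?B \<subseteq> J"
    proof
      fix x assume x: "x \<in> ?A \<inter> ?B"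
      then obtain j r where jr: "x = j \<oplus> r \<otimes> t" "j \<in> J" "r \<in> carrier R" unfolding adj_def by auto
      show "x \<in> J"
      proof (cases "r \<in> m")
        case True
        then show ?thesis using jr mt additive_subgroup.a_closed[OF ideal.axioms(1)[OF J]] by simp
      next
        case False
        have "x \<odot>\<^bsub>E\<^esub> e = \<zero>\<^bsub>E\<^esub>" "j \<odot>\<^bsub>E\<^esub> e = \<zero>\<^bsub>E\<^esub>" using x JA jr(2) by (auto simp: annihilator_def)
        then have 0: "r \<odot>\<^bsub>E\<^esub> (t \<odot>\<^bsub>E\<^esub> e) = \<zero>\<^bsub>E\<^esub>"
          using jr Jc[OF jr(2)] tc ec by (simp add: E.smult_l_distr E.smult_assoc1)
        have i: "inv r \<in> carrier R" "inv r \<otimes> r = \<one>" using m_Units[OF jr(3) False] by auto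
        have "t \<odot>\<^bsub>E\<^esub> e = inv r \<odot>\<^bsub>E\<^esub> (r \<odot>\<^bsub>E\<^esub> (t \<odot>\<^bsub>E\<^esub> e))"
          using i jr(3) tc ec E.smult_assoc1[of "inv r" r "t \<odot>\<^bsub>E\<^esub> e"] by simp
        then show ?thesis using 0 e(2) i(1) by simp
      qed
    qed
    then have "J = ?A \<inter> ?B" using JA B by blast
    moreover have "J \<subset> ?B" using B t by blast
    ultimately have "\<not> J \<subset> ?A" using assms(1) A B unfolding irreducible_ideal_def by blast
    then have "?A = J" using JA by blast
    then show ?thesis using that ec by blast
  qed
qed

text \<open>With J = ann e, the map r \<mapsto> r e identifies R / J with R e. This submodule has
  annihilator J and is killed by a power of m, so it equals its double annihilator ann_E J.\<close>

lemma irreducible_quotient_iso: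
  assumes "irreducible_ideal R J" "ideal_power R m n \<subseteq> J"
  obtains h where "h \<in> mod_iso R (quotient_module R Reg J) (E\<lparr>carrier := ann_in E J\<rparr>)"
proof -
  have J: "ideal J R" using assms(1) by (simp add: irreducible_ideal_def)
  obtain e where e: "e \<in> carrier E" "annihilator R E {e} = J"
    using irreducible_eq_annihilator[OF assms] .
  let ?g = "\<lambda>r. r \<odot>\<^bsub>E\<^esub> e"
  have hom: "?g \<in> mod_hom R Reg E"
    using e(1) by (intro mod_homI) (auto simp: E.smult_l_distr E.smult_assoc1)
  let ?H = "?g ` carrier R"
  have H: "submodule ?H R E"
    using submodule_image[OF Reg_module E_module hom Reg.carrier_is_submodule] by simp
  have Je: "j \<odot>\<^bsub>E\<^esub> e = \<zero>\<^bsub>E\<^esub>" if "j \<in> J" for j using that e(2) by (auto simp: annihilator_def)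
  have annH: "annihilator R E ?H = J"
  proof
    show "annihilator R E ?H \<subseteq> J" unfolding e(2)[symmetric]
      by (rule annihilator_antimono) (use e(1) E.smult_one[OF e(1)] in \<open>auto intro!: image_eqI[of _ _ \<one>]\<close>)
    have "j \<odot>\<^bsub>E\<^esub> (r \<odot>\<^bsub>E\<^esub> e) = \<zero>\<^bsub>E\<^esub>" if "j \<in> J" "r \<in> carrier R" for j r
      using E_smult_comm[OF ideal.Icarr[OF J that(1)] that(2) e(1)] Je[OF that(1)] that(2) by simp
    then show "J \<subseteq> annihilator R E ?H"
      using ideal.Icarr[OF J] by (auto simp: annihilator_def)
  qed
  have "?H \<subseteq> ann_in E J" using annH E.submoduleE(1)[OF H] by (auto simp: annihilator_def ann_in_def)
  then have "?H \<subseteq> ann_in E (ideal_power R m n)" using ann_in_antimono[OF assms(2)] by blast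
  then obtain l where "steps E l {\<zero>\<^bsub>E\<^esub>} ?H" using torsion_steps[OF H] by blast
  then have eq: "ann_in E J = ?H" using ann_in_annihilator_of_steps annH by metis
  let ?EH = "E\<lparr>carrier := ?H\<rparr>"
  have gH: "?g \<in> mod_hom R Reg ?EH" using mod_hom_into_submodule[OF hom] by simp
  have "?g ` carrier Reg = carrier ?EH" "J = {x \<in> carrier Reg. ?g x = \<zero>\<^bsub>?EH\<^esub>}"
    using e(2) by (auto simp: annihilator_def)
  then obtain h where "h \<in> mod_iso R (quotient_module R Reg J) ?EH"
    using first_isomorphism[OF Reg_module submodule_module[OF E_module H] gH] by metis
  then show thesis using that eq by simp
qed

end

section \<open>Matlis duality from the injective hull of the residue field\<close>

lemma complete_noetherian_localD:
  assumes "complete_noetherian_local R m"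
  shows "local_ring R m" "noetherian_ring R" "adically_complete R m"
proof -
  show N: "noetherian_ring R" and "adically_complete R m"
    using assms by (auto simp: complete_noetherian_local_def)
  interpret cring R using assms by (simp add: complete_noetherian_local_def)
  interpret noetherian_ring R by (rule N)
  interpret m: maximalideal m R using assms by (simp add: complete_noetherian_local_def)
  have uniq: "n = m" if "maximalideal n R" for n
    using assms that by (simp add: complete_noetherian_local_def)
  show "local_ring R m"
  proof (unfold_locales)
    fix a assume a: "a \<in> carrier R" "a \<notin> m"
    have "cgenideal R a = carrier R"
    proof (rule ccontr)
      assume neq: "cgenideal R a \<noteq> carrier R"
      \<comment> \<open>A maximal proper ideal containing a would be a maximal ideal, hence m,
        although a is outside m.\<close>
      define S where "S = {I. ideal I R \<and> I \<noteq> carrier R \<and> a \<in> I}"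
      have "cgenideal R a \<in> S" using neq cgenideal_ideal[OF a(1)] cgenideal_self[OF a(1)]
        by (simp add: S_def)
      then have ne: "S \<noteq> {}" by auto
      have idl: "ideal I R" if "I \<in> S" for I using that by (simp add: S_def)
      obtain M where M: "M \<in> S" "\<And>I. I \<in> S \<Longrightarrow> M \<subseteq> I \<Longrightarrow> I = M"
        using ideals_maximal_element[OF ne idl] by metis
      have "maximalideal M R"
      proof (rule maximalidealI)
        show "ideal M R" "carrier R \<noteq> M" using M(1) by (auto simp: S_def)
        fix J assume J: "ideal J R" "M \<subseteq> J" "J \<subseteq> carrier R"
        then show "J = M \<or> J = carrier R" using M(1) M(2)[of J] by (auto simp: S_def)
      qed
      then show False using uniq M(1) a(2) by (auto simp: S_def)
    qed
    then have "\<one>\<^bsub>R\<^esub> \<in> cgenideal R a" by simp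
    then obtain r where "r \<in> carrier R" "r \<otimes>\<^bsub>R\<^esub> a = \<one>\<^bsub>R\<^esub>"
      unfolding cgenideal_def by auto
    then show "a \<in> Units R" using a(1) m_comm[of r a] unfolding Units_def by auto
  next
    show "\<one>\<^bsub>R\<^esub> \<notin> m" using m.I_notcarr m.one_imp_carrier by blast
  qed
qed

text \<open>On H = R z the rule z \<mapsto> s is well defined: the annihilator of z is contained in
  m because units cannot kill z, and m kills s.\<close>

lemma cyclic_map:
  fixes M :: "('a, 'b) module"
  assumes "local_ring R m" "module R M" "z \<in> carrier M" "z \<noteq> \<zero>\<^bsub>M\<^esub>"
    and "module R E" "s \<in> carrier E" "\<And>a. a \<in> m \<Longrightarrow> a \<odot>\<^bsub>E\<^esub> s = \<zero>\<^bsub>E\<^esub>"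
  obtains H g where "submodule H R M" "z \<in> H" "g \<in> mod_hom R (M\<lparr>carrier := H\<rparr>) E" "g z = s"
proof -
  interpret local_ring R m by fact
  interpret M: module R M by fact
  interpret E: module R E by fact
  let ?Reg = "regular_module R"
  note Reg = regular_is_module
  interpret Reg: module R ?Reg by (rule Reg)
  let ?p = "\<lambda>r. r \<odot>\<^bsub>M\<^esub> z" and ?q = "\<lambda>r. r \<odot>\<^bsub>E\<^esub> s"
  have p: "?p \<in> mod_hom R ?Reg M" and q: "?q \<in> mod_hom R ?Reg E"
    using assms(3,6) by (auto intro!: mod_homI simp: M.smult_l_distr M.smult_assoc1 E.smult_l_distr E.smult_assoc1)
  let ?H = "?p ` carrier R"
  have H: "submodule ?H R M"
    using submodule_image[OF Reg assms(2) p Reg.carrier_is_submodule] by simp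
  have zH: "z \<in> ?H" using M.smult_one[OF assms(3)] one_closed by (metis imageI)
  let ?MH = "M\<lparr>carrier := ?H\<rparr>"
  note MH = submodule_module[OF assms(2) H]
  define L where "L = {x \<in> carrier ?Reg. ?p x = \<zero>\<^bsub>?MH\<^esub>}"
  have pH: "?p \<in> mod_hom R ?Reg ?MH" using mod_hom_into_submodule[OF p] by simp
  have "?p ` carrier ?Reg = carrier ?MH" by simp
  then obtain h where L: "submodule L R ?Reg" and h: "h \<in> mod_iso R (quotient_module R ?Reg L) ?MH"
    "\<And>x. x \<in> carrier ?Reg \<Longrightarrow> h (L +>\<^bsub>?Reg\<^esub> x) = ?p x"
    using first_isomorphism[OF Reg MH pH _ L_def] by metis
  note Q = quotient_is_module[OF Reg L]
  have "?q x = \<zero>\<^bsub>E\<^esub>" if "x \<in> L" for x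
  proof -
    have x: "x \<in> carrier R" "x \<odot>\<^bsub>M\<^esub> z = \<zero>\<^bsub>M\<^esub>" using that by (auto simp: L_def)
    have "x \<in> m"
    proof (rule ccontr)
      assume "x \<notin> m"
      then have i: "inv\<^bsub>R\<^esub> x \<in> carrier R" "inv\<^bsub>R\<^esub> x \<otimes>\<^bsub>R\<^esub> x = \<one>\<^bsub>R\<^esub>" using m_Units[OF x(1)] by auto
      then have "z = inv\<^bsub>R\<^esub> x \<odot>\<^bsub>M\<^esub> (x \<odot>\<^bsub>M\<^esub> z)" using x(1) assms(3) M.smult_assoc1[of "inv\<^bsub>R\<^esub> x" x z] by simp
      then show False using x(2) i(1) assms(4) by simp
    qed
    then show ?thesis by (rule assms(7))
  qed
  then obtain k where k: "k \<in> mod_hom R (quotient_module R ?Reg L) E"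
    "\<And>x. x \<in> carrier ?Reg \<Longrightarrow> k (L +>\<^bsub>?Reg\<^esub> x) = ?q x"
    using quotient_map[OF Reg assms(5) L q] by metis
  let ?h' = "inv_into (carrier (quotient_module R ?Reg L)) h"
  have "(\<lambda>x. k (?h' x)) \<in> mod_hom R ?MH E"
    using mod_hom_comp[OF mod_isoD(1)[OF mod_iso_inv[OF Q h(1)]] k(1)] .
  moreover have "k (?h' z) = s"
  proof -
    have c: "L +>\<^bsub>?Reg\<^esub> \<one>\<^bsub>R\<^esub> \<in> carrier (quotient_module R ?Reg L)"
      unfolding quotient_carrier[OF Reg L] by (rule imageI) simp
    have "h (L +>\<^bsub>?Reg\<^esub> \<one>\<^bsub>R\<^esub>) = z" using h(2)[of "\<one>\<^bsub>R\<^esub>"] assms(3) by simp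
    then have "?h' z = L +>\<^bsub>?Reg\<^esub> \<one>\<^bsub>R\<^esub>" using inv_into_f_f[OF mod_isoD(2)[OF h(1)] c] by simp
    then show ?thesis using k(2)[of "\<one>\<^bsub>R\<^esub>"] assms(6) by simp
  qed
  ultimately show thesis using that H zH by blast
qed

text \<open>Adds to \<open>matlis\<close> what needs maps into E: \<open>baer\<close> says that each
  homomorphism from an ideal to E is multiplication by an element of E, and
  \<open>cogenerator_module\<close> separates points of arbitrary modules with elements in
  \<open>'u\<close>.\<close>

locale matlis_dual = matlis R m E s
  for R :: "('a, 'r) ring_scheme" (structure) and m and E :: "('a, 'u) module" and s +
  fixes \<iota> :: "'a \<Rightarrow> 'u"
  assumes complete: "adically_complete R m"
    and baer: "\<And>I f. ideal I R \<Longrightarrow> f \<in> mod_hom R ((regular_module R)\<lparr>carrier := I\<rparr>) E \<Longrightarrow>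
      \<exists>e\<in>carrier E. \<forall>x\<in>I. f x = x \<odot>\<^bsub>E\<^esub> e"
    and cogenerator_module: "\<And>(M :: ('a, 'u) module) z. module R M \<Longrightarrow> z \<in> carrier M \<Longrightarrow>
      z \<noteq> \<zero>\<^bsub>M\<^esub> \<Longrightarrow> \<exists>f\<in>mod_hom R M E. f z \<noteq> \<zero>\<^bsub>E\<^esub>"
    and \<iota>_inj: "inj_on \<iota> (carrier R)"

lemma matlis_dual_exists:
  fixes R :: "('a, 'r) ring_scheme" and E :: "('a, 'u) module" and \<iota> :: "'a \<Rightarrow> 'u"
  assumes R: "complete_noetherian_local R m" and \<iota>: "inj_on \<iota> (carrier R)"
    and hull: "injective_hull R (quotient_module R (regular_module R) m) E"
  shows "\<exists>s. matlis_dual R m E s \<iota>"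
proof -
  note RD = complete_noetherian_localD[OF R]
  interpret local_ring R m by (rule RD)
  interpret noetherian_ring R by (rule RD)
  let ?Reg = "regular_module R"
  let ?k = "quotient_module R ?Reg m"
  note Reg = regular_is_module
  interpret Reg: module R ?Reg by (rule Reg)
  have m: "submodule m R ?Reg" using m_ideal submodule_regular_iff by blast
  note k = quotient_is_module[OF Reg m] and k_carrier = quotient_carrier[OF Reg m]
    and k_zero = quotient_zero[OF Reg m] and proj = quotient_proj[OF Reg m]
  have inj: "injective_module R E" using hull by (simp add: injective_hull_def)
  then have E: "module R E" by (simp add: injective_module_def)
  interpret E: module R E by (rule E)
  have extend: "\<exists>h\<in>mod_hom R B E. \<forall>x\<in>carrier A. h (i x) = g x"
    if "module R A" "module R B" "i \<in> mod_hom R A B" "inj_on i (carrier A)" "g \<in> mod_hom R A E"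
    for A B :: "('a, 'u) module" and i g
    using inj that unfolding injective_module_def by blast
  obtain i where i: "i \<in> mod_hom R ?k E" "inj_on i (carrier ?k)"
    "\<And>N. submodule N R E \<Longrightarrow> N \<noteq> {\<zero>\<^bsub>E\<^esub>} \<Longrightarrow> N \<inter> i ` carrier ?k \<noteq> {\<zero>\<^bsub>E\<^esub>}"
    using hull unfolding injective_hull_def by blast
  \<comment> \<open>The image of 1 under the embedding of the residue field; its annihilator is
    exactly m.\<close>
  define s where "s = i (m +>\<^bsub>?Reg\<^esub> \<one>\<^bsub>R\<^esub>)"
  have kc: "m +>\<^bsub>?Reg\<^esub> x \<in> carrier ?k" if "x \<in> carrier R" for x
    unfolding k_carrier using that by (intro imageI) simp
  have s: "s \<in> carrier E" unfolding s_def by (rule mod_hom_closed[OF i(1) kc]) simp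
  have i_eq: "i (m +>\<^bsub>?Reg\<^esub> x) = x \<odot>\<^bsub>E\<^esub> s" if x: "x \<in> carrier R" for x
  proof -
    have "m +>\<^bsub>?Reg\<^esub> x = x \<odot>\<^bsub>?k\<^esub> (m +>\<^bsub>?Reg\<^esub> \<one>\<^bsub>R\<^esub>)"
      using mod_hom_smult[OF proj x, of "\<one>\<^bsub>R\<^esub>"] x by simp
    then show ?thesis unfolding s_def using mod_hom_smult[OF i(1) x kc[of "\<one>\<^bsub>R\<^esub>"]] by simp
  qed
  have coset_zero: "m +>\<^bsub>?Reg\<^esub> x = \<zero>\<^bsub>?k\<^esub> \<longleftrightarrow> x \<in> m" if "x \<in> carrier R" for x
    using rcoset_eq_self_iff[OF Reg m, of x] that k_zero by simp
  have i_zero: "i \<zero>\<^bsub>?k\<^esub> = \<zero>\<^bsub>E\<^esub>" by (rule mod_hom_zero[OF k E i(1)])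
  have xs: "x \<odot>\<^bsub>E\<^esub> s = \<zero>\<^bsub>E\<^esub> \<longleftrightarrow> x \<in> m" if x: "x \<in> carrier R" for x
  proof -
    have "\<zero>\<^bsub>?k\<^esub> \<in> carrier ?k" using kc[of "\<zero>\<^bsub>R\<^esub>"] coset_zero[of "\<zero>\<^bsub>R\<^esub>"]
        Reg.submoduleD(2)[OF m] by simp
    then have "i (m +>\<^bsub>?Reg\<^esub> x) = \<zero>\<^bsub>E\<^esub> \<longleftrightarrow> m +>\<^bsub>?Reg\<^esub> x = \<zero>\<^bsub>?k\<^esub>"
      using inj_on_eq_iff[OF i(2) kc[OF x]] i_zero by metis
    then show ?thesis using i_eq coset_zero x by simp
  qed
  have s0: "s \<noteq> \<zero>\<^bsub>E\<^esub>" using xs[of "\<one>\<^bsub>R\<^esub>"] one_notin_m s by simp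
  have ms: "a \<odot>\<^bsub>E\<^esub> s = \<zero>\<^bsub>E\<^esub>" if "a \<in> m" for a using xs[of a] that m_carrier by simp
  have ess: "\<exists>r\<in>carrier R. r \<odot>\<^bsub>E\<^esub> e = s" if e: "e \<in> carrier E" "e \<noteq> \<zero>\<^bsub>E\<^esub>" for e
  proof -
    \<comment> \<open>The cyclic submodule R e meets the residue field in a nonzero element x s.
      Here x is outside m, so dividing by x exhibits s as a multiple of e.\<close>
    let ?N = "(\<lambda>r. r \<odot>\<^bsub>E\<^esub> e) ` carrier R"
    have "(\<lambda>r. r \<odot>\<^bsub>E\<^esub> e) \<in> mod_hom R ?Reg E"
      using e(1) by (intro mod_homI) (auto simp: E.smult_l_distr E.smult_assoc1)
    then have N: "submodule ?N R E"
      using submodule_image[OF Reg E _ Reg.carrier_is_submodule] by auto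
    have "e \<in> ?N" using E.smult_one[OF e(1)] one_closed by (metis imageI)
    then have "?N \<inter> i ` carrier ?k \<noteq> {\<zero>\<^bsub>E\<^esub>}" using i(3)[OF N] e(2) by blast
    moreover have "\<zero>\<^bsub>E\<^esub> \<in> ?N" by (rule E.submoduleD(2)[OF N])
    moreover have "\<zero>\<^bsub>E\<^esub> \<in> i ` carrier ?k"
      using i_eq[of "\<zero>\<^bsub>R\<^esub>"] kc[of "\<zero>\<^bsub>R\<^esub>"] s by (metis E.smult_l_null zero_closed imageI)
    ultimately obtain w where w: "w \<in> ?N" "w \<in> i ` carrier ?k" "w \<noteq> \<zero>\<^bsub>E\<^esub>" by blast
    obtain r where r: "r \<in> carrier R" "w = r \<odot>\<^bsub>E\<^esub> e" using w(1) by blast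
    obtain x where x: "x \<in> carrier R" "w = x \<odot>\<^bsub>E\<^esub> s"
      using w(2) i_eq unfolding k_carrier by auto
    have "x \<notin> m" using xs x w(3) by blast
    then have u: "inv\<^bsub>R\<^esub> x \<in> carrier R" "inv\<^bsub>R\<^esub> x \<otimes>\<^bsub>R\<^esub> x = \<one>\<^bsub>R\<^esub>" using m_Units[OF x(1)] by auto
    have "s = inv\<^bsub>R\<^esub> x \<odot>\<^bsub>E\<^esub> (x \<odot>\<^bsub>E\<^esub> s)" using u x(1) s E.smult_assoc1[of "inv\<^bsub>R\<^esub> x" x s] by simp
    also have "\<dots> = (inv\<^bsub>R\<^esub> x \<otimes>\<^bsub>R\<^esub> r) \<odot>\<^bsub>E\<^esub> e" using u r x e(1) by (simp add: E.smult_assoc1)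
    finally show ?thesis using u r by auto
  qed
  have cogen: "\<exists>f\<in>mod_hom R M E. f z \<noteq> \<zero>\<^bsub>E\<^esub>"
    if M: "module R M" "z \<in> carrier M" "z \<noteq> \<zero>\<^bsub>M\<^esub>" for M :: "('a, 'u) module" and z
  proof -
    obtain H g where H: "submodule H R M" "z \<in> H" "g \<in> mod_hom R (M\<lparr>carrier := H\<rparr>) E" "g z = s"
      using cyclic_map[OF RD(1) M E s ms] by metis
    have "(\<lambda>x. x) \<in> mod_hom R (M\<lparr>carrier := H\<rparr>) M"
      using module.submoduleE(1)[OF M(1) H(1)] by (intro mod_hom_from_submodule mod_hom_id)
    moreover have "inj_on (\<lambda>x. x) (carrier (M\<lparr>carrier := H\<rparr>))" by simp
    ultimately obtain h where "h \<in> mod_hom R M E" "\<forall>x\<in>carrier (M\<lparr>carrier := H\<rparr>). h x = g x"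
      using extend[OF submodule_module[OF M(1) H(1)] M(1) _ _ H(3)] by metis
    moreover have "z \<in> carrier (M\<lparr>carrier := H\<rparr>)" using H(2) by simp
    ultimately show ?thesis using H(4) s0 by metis
  qed
  \<comment> \<open>The quotient R / K has elements of type \<open>'a set\<close>, so it is copied
    into \<open>'u\<close> before \<open>cogen\<close> applies. The required element of E is the
    image of the coset of 1.\<close>
  have cogen_ideal: "\<exists>e\<in>ann_in E K. x \<odot>\<^bsub>E\<^esub> e \<noteq> \<zero>\<^bsub>E\<^esub>"
    if K: "ideal K R" "x \<in> carrier R" "x \<notin> K" for K x
  proof -
    have Ks: "submodule K R ?Reg" using K submodule_regular_iff by blast
    let ?Q = "quotient_module R ?Reg K"
    note Q = quotient_is_module[OF Reg Ks]
    have "inj_on \<iota> (carrier ?Reg)" using \<iota> by simp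
    then obtain j :: "'a set \<Rightarrow> 'u" where j: "inj_on j (carrier ?Q)"
      using quotient_inj[OF Reg Ks] by metis
    note T = transport_module[OF Q j] and Tj = mod_isoD[OF transport_iso[OF j, of R]]
    note hom1 = mod_hom_comp[OF quotient_proj[OF Reg Ks] Tj(1)]
    have zero: "j (K +>\<^bsub>?Reg\<^esub> y) = \<zero>\<^bsub>transport ?Q j\<^esub> \<longleftrightarrow> y \<in> K" if y: "y \<in> carrier R" for y
    proof -
      have c: "K +>\<^bsub>?Reg\<^esub> y \<in> carrier ?Q" "\<zero>\<^bsub>?Q\<^esub> \<in> carrier ?Q"
        using y mod_hom_closed[OF quotient_proj[OF Reg Ks], of y] module.submoduleD(2)[OF Q module.carrier_is_submodule[OF Q]] by auto
      then have "j (K +>\<^bsub>?Reg\<^esub> y) = j \<zero>\<^bsub>?Q\<^esub> \<longleftrightarrow> K +>\<^bsub>?Reg\<^esub> y = \<zero>\<^bsub>?Q\<^esub>"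
        using j by (simp add: inj_on_eq_iff)
      then show ?thesis
        using rcoset_eq_self_iff[OF Reg Ks, of y] y quotient_zero[OF Reg Ks] mod_hom_zero[OF Q T Tj(1)] by simp
    qed
    have "j (K +>\<^bsub>?Reg\<^esub> x) \<in> carrier (transport ?Q j)" "j (K +>\<^bsub>?Reg\<^esub> x) \<noteq> \<zero>\<^bsub>transport ?Q j\<^esub>"
      using mod_hom_closed[OF hom1, of x] zero K by auto
    then obtain f where f: "f \<in> mod_hom R (transport ?Q j) E" "f (j (K +>\<^bsub>?Reg\<^esub> x)) \<noteq> \<zero>\<^bsub>E\<^esub>"
      using cogen[OF T] by blast
    define F where "F y = f (j (K +>\<^bsub>?Reg\<^esub> y))" for y
    have F: "F \<in> mod_hom R ?Reg E" unfolding F_def using mod_hom_comp[OF hom1 f(1)] .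
    have Fy: "F y = y \<odot>\<^bsub>E\<^esub> F \<one>\<^bsub>R\<^esub>" if "y \<in> carrier R" for y
      using mod_hom_smult[OF F that, of "\<one>\<^bsub>R\<^esub>"] that by simp
    have F1: "F \<one>\<^bsub>R\<^esub> \<in> carrier E" using mod_hom_closed[OF F] by simp
    have "y \<odot>\<^bsub>E\<^esub> F \<one>\<^bsub>R\<^esub> = \<zero>\<^bsub>E\<^esub>" if y: "y \<in> K" for y
    proof -
      have yc: "y \<in> carrier R" using ideal.Icarr[OF K(1) y] .
      have "F y = \<zero>\<^bsub>E\<^esub>" unfolding F_def using zero[OF yc] y mod_hom_zero[OF T E f(1)] by simp
      then show ?thesis using Fy[OF yc] by simp
    qed
    then have "F \<one>\<^bsub>R\<^esub> \<in> ann_in E K" using F1 by (simp add: ann_in_def)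
    moreover have "x \<odot>\<^bsub>E\<^esub> F \<one>\<^bsub>R\<^esub> \<noteq> \<zero>\<^bsub>E\<^esub>" using Fy[OF K(2)] f(2) F_def by metis
    ultimately show ?thesis by blast
  qed
  \<comment> \<open>Both I and R are copied into \<open>'u\<close> along \<open>\<iota>\<close>, f
    is extended from the copy of I to that of R by injectivity, and the extension is evaluated at
    1.\<close>
  have baer: "\<exists>e\<in>carrier E. \<forall>x\<in>I. f x = x \<odot>\<^bsub>E\<^esub> e"
    if I: "ideal I R" "f \<in> mod_hom R (?Reg\<lparr>carrier := I\<rparr>) E" for I f
  proof -
    have Is: "submodule I R ?Reg" using I submodule_regular_iff by blast
    have inj: "inj_on \<iota> (carrier ?Reg)" using \<iota> by simp
    note Tj = mod_isoD[OF transport_iso[OF inj, of R]] and T = transport_module[OF Reg inj]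
    let ?RI = "?Reg\<lparr>carrier := I\<rparr>"
    have Ic: "I \<subseteq> carrier R" using ideal.Icarr[OF I(1)] by auto
    then have inj': "inj_on \<iota> (carrier ?RI)" using \<iota> inj_on_subset by auto
    note RI = submodule_module[OF Reg Is]
    note T'j = transport_iso[OF inj', of R] and T' = transport_module[OF RI inj']
    let ?c = "inv_into I \<iota>"
    have c: "?c \<in> mod_iso R (transport ?RI \<iota>) ?RI" using mod_iso_inv[OF RI T'j] by simp
    note ch = mod_isoD(1)[OF c]
    have a: "(\<lambda>x. \<iota> (?c x)) \<in> mod_hom R (transport ?RI \<iota>) (transport ?Reg \<iota>)"
      using mod_hom_comp[OF ch mod_hom_comp[OF mod_hom_from_submodule[OF mod_hom_id] Tj(1)]] Ic by simp
    have "inj_on (\<lambda>x. \<iota> (?c x)) (carrier (transport ?RI \<iota>))"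
      using inj' by (auto simp: transport_def Let_def inj_on_def)
    then obtain h where h: "h \<in> mod_hom R (transport ?Reg \<iota>) E"
      "\<forall>x\<in>carrier (transport ?RI \<iota>). h (\<iota> (?c x)) = f (?c x)"
      using extend[OF T' T a _ mod_hom_comp[OF ch I(2)]] by blast
    have hI: "h (\<iota> x) = f x" if "x \<in> I" for x
    proof -
      have "\<iota> x \<in> carrier (transport ?RI \<iota>)" using that by (simp add: transport_def Let_def)
      then show ?thesis using h(2) that inj' by force
    qed
    define F where "F y = h (\<iota> y)" for y
    have F: "F \<in> mod_hom R ?Reg E" unfolding F_def using mod_hom_comp[OF Tj(1) h(1)] .
    have "F y = y \<odot>\<^bsub>E\<^esub> F \<one>\<^bsub>R\<^esub>" if "y \<in> carrier R" for y
      using mod_hom_smult[OF F that, of "\<one>\<^bsub>R\<^esub>"] that by simp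
    then have "\<forall>x\<in>I. f x = x \<odot>\<^bsub>E\<^esub> F \<one>\<^bsub>R\<^esub>" using hI Ic unfolding F_def by (metis subsetD)
    moreover have "F \<one>\<^bsub>R\<^esub> \<in> carrier E" using mod_hom_closed[OF F] by simp
    ultimately show ?thesis by blast
  qed
  have "matlis_dual R m E s \<iota>"
    by unfold_locales
      (use s s0 ms ess cogen cogen_ideal baer RD(3) \<iota> in auto)
  then show ?thesis by blast
qed

section \<open>Duals of selectors\<close>

lemma annihilator_iff: "r \<in> annihilator R M S \<longleftrightarrow> r \<in> carrier R \<and> (\<forall>x\<in>S. r \<odot>\<^bsub>M\<^esub> x = \<zero>\<^bsub>M\<^esub>)"
  by (simp add: annihilator_def)

lemma cl_carrier: "z \<in> cl R \<beta> M L \<Longrightarrow> z \<in> carrier M"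
  by (simp add: cl_def)

lemma restrict_in_hom_module:
  assumes "module R M" "f \<in> mod_hom R M N"
  shows "restrict f (carrier M) \<in> carrier (hom_module R M N)"
proof -
  interpret M: module R M by fact
  show ?thesis using assms(2) by (auto simp: hom_module_def mod_hom_def)
qed

context matlis_dual
begin

lemma E_artinian: "artinian R E"
  by (rule artinian_E[OF complete])

lemma E_in_artinian_modules: "E \<in> artinian_modules R"
  by (simp add: artinian_modules_def E_artinian)

lemma ideal_subset_carrier: "ideal I R \<Longrightarrow> I \<subseteq> carrier R"
  by (rule subsetI) (rule ideal.Icarr)

text \<open>The map p from E to D = Hom(I, E) is onto with kernel ann_E I, so the closure is the
  preimage under p of S, the selector at D. A point x of I is in the dual exactly if all functionals
  in S vanish at x, that is, if x kills the closure. Restricting to I loses nothing: the closure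
  contains ann_E I, whose annihilator is I.\<close>

lemma dual_selector_eq:
  fixes \<beta> :: "('a, 'u) module \<Rightarrow> 'u set"
  assumes \<beta>: "submodule_selector R \<beta>" and I: "ideal I R"
  shows "dual_selector R E \<beta> (Reg\<lparr>carrier := I\<rparr>) = annihilator R E (cl R \<beta> E (ann_in E I))"
proof -
  let ?RI = "Reg\<lparr>carrier := I\<rparr>" and ?L = "ann_in E I"
  let ?D = "hom_module R ?RI E"
  define p where "p e = (\<lambda>x\<in>I. x \<odot>\<^bsub>E\<^esub> e)" for e
  note Ic = ideal.Icarr[OF I]
  have Isub: "submodule I R Reg" using I submodule_regular_iff by blast
  note RI = submodule_module[OF Reg_module Isub]
  note I_closed = Reg.submoduleD[OF Isub, simplified]
  have D_carrier: "f \<in> carrier ?D \<longleftrightarrow> f \<in> mod_hom R ?RI E \<and> f \<in> extensional I" for f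
    by (simp add: hom_module_def)
  have p_D: "p e \<in> carrier ?D" if "e \<in> carrier E" for e
    unfolding D_carrier p_def using that Ic I_closed
    by (auto intro!: mod_homI simp: E.smult_l_distr E.smult_assoc1)
  have p_hom: "p \<in> mod_hom R E ?D"
  proof (rule mod_homI)
    fix e e' assume "e \<in> carrier E" "e' \<in> carrier E"
    then show "p (e \<oplus>\<^bsub>E\<^esub> e') = p e \<oplus>\<^bsub>?D\<^esub> p e'"
      using Ic by (auto simp: hom_module_def p_def E.smult_r_distr intro!: restrict_ext)
  next
    fix r e assume "r \<in> carrier R" "e \<in> carrier E"
    then show "p (r \<odot>\<^bsub>E\<^esub> e) = r \<odot>\<^bsub>?D\<^esub> p e"
      using Ic E_smult_comm by (auto simp: hom_module_def p_def intro!: restrict_ext)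
  qed (rule p_D)
  have p_surj: "p ` carrier E = carrier ?D"
  proof
    show "carrier ?D \<subseteq> p ` carrier E"
    proof
      fix f assume f: "f \<in> carrier ?D"
      then obtain e where e: "e \<in> carrier E" "\<forall>x\<in>I. f x = x \<odot>\<^bsub>E\<^esub> e"
        using baer[OF I] unfolding D_carrier by blast
      have "f = p e" using f e(2) unfolding D_carrier p_def
        by (intro extensionalityI[of f I]) auto
      then show "f \<in> p ` carrier E" using e(1) by blast
    qed
  qed (use p_D in auto)
  have p_zero: "p \<zero>\<^bsub>E\<^esub> = \<zero>\<^bsub>?D\<^esub>"
    using Ic by (auto simp: hom_module_def p_def intro!: restrict_ext)
  note D = surj_module[OF E_module p_hom p_surj p_zero]
  interpret D: module R ?D by (rule D)
  have ker: "?L = {e \<in> carrier E. p e = \<zero>\<^bsub>?D\<^esub>}"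
  proof -
    have "p e = \<zero>\<^bsub>?D\<^esub> \<longleftrightarrow> (\<forall>x\<in>I. x \<odot>\<^bsub>E\<^esub> e = \<zero>\<^bsub>E\<^esub>)" for e
    proof
      assume "p e = \<zero>\<^bsub>?D\<^esub>"
      then have "p e x = \<zero>\<^bsub>E\<^esub>" if "x \<in> I" for x using that by (simp add: hom_module_def)
      then show "\<forall>x\<in>I. x \<odot>\<^bsub>E\<^esub> e = \<zero>\<^bsub>E\<^esub>" by (simp add: p_def)
    next
      assume "\<forall>x\<in>I. x \<odot>\<^bsub>E\<^esub> e = \<zero>\<^bsub>E\<^esub>"
      then show "p e = \<zero>\<^bsub>?D\<^esub>" by (auto simp: hom_module_def p_def intro!: restrict_ext)
    qed
    then show ?thesis by (auto simp: ann_in_def)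
  qed
  have D_art: "artinian R ?D" by (rule artinian_surj[OF E_artinian D p_hom p_surj])
  \<comment> \<open>Choosing preimages under p injects Hom(I, E), whose elements are functions, into
    \<open>'u\<close>.\<close>
  have D_inj: "inj_on (inv_into (carrier E) p) (carrier ?D)"
    using p_surj by (intro inj_on_inv_into) auto
  define S where "S = selector_at R \<beta> ?D"
  have S: "submodule S R ?D" unfolding S_def by (rule selector_at_submodule[OF \<beta> D_art D_inj])
  have cl_iff: "e \<in> cl R \<beta> E ?L \<longleftrightarrow> p e \<in> S" if "e \<in> carrier E" for e
    unfolding S_def by (rule cl_surj[OF \<beta> E_module D p_hom p_surj ker that])
  let ?Q = "quotient_module R ?D S"
  note Q = quotient_is_module[OF D S]
  \<comment> \<open>Evaluation at x factors through the projection from D to D / S exactly if it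
    vanishes on S.\<close>
  have bidual: "biduality_map R E ?RI x \<in> (\<lambda>\<psi>. \<lambda>f\<in>carrier ?D. \<psi> (S +>\<^bsub>?D\<^esub> f)) ` carrier (hom_module R ?Q E)
      \<longleftrightarrow> (\<forall>f\<in>S. f x = \<zero>\<^bsub>E\<^esub>)" if x: "x \<in> I" for x
  proof
    assume "biduality_map R E ?RI x \<in> (\<lambda>\<psi>. \<lambda>f\<in>carrier ?D. \<psi> (S +>\<^bsub>?D\<^esub> f)) ` carrier (hom_module R ?Q E)"
    then obtain \<psi> where \<psi>: "\<psi> \<in> mod_hom R ?Q E"
      "biduality_map R E ?RI x = (\<lambda>f\<in>carrier ?D. \<psi> (S +>\<^bsub>?D\<^esub> f))"
      by (auto simp: hom_module_def)
    have "f x = \<zero>\<^bsub>E\<^esub>" if f: "f \<in> S" for f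
    proof -
      have fc: "f \<in> carrier ?D" by (rule D.submoduleD(1)[OF S f])
      have "S +>\<^bsub>?D\<^esub> f = \<zero>\<^bsub>?Q\<^esub>"
        using rcoset_eq_self_iff[OF D S fc] f quotient_zero[OF D S] by simp
      moreover have "f x = \<psi> (S +>\<^bsub>?D\<^esub> f)"
        using fun_cong[OF \<psi>(2), of f] fc by (simp add: biduality_map_def)
      ultimately show ?thesis using mod_hom_zero[OF Q E_module \<psi>(1)] by simp
    qed
    then show "\<forall>f\<in>S. f x = \<zero>\<^bsub>E\<^esub>" by blast
  next
    assume kill: "\<forall>f\<in>S. f x = \<zero>\<^bsub>E\<^esub>"
    have "(\<lambda>f. f x) \<in> mod_hom R ?D E"
    proof (rule mod_homI)
      fix f assume "f \<in> carrier ?D"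
      then show "f x \<in> carrier E" unfolding D_carrier using mod_hom_closed[of f R ?RI E x] x by simp
    qed (use x in \<open>auto simp: hom_module_def\<close>)
    then obtain h where h: "h \<in> mod_hom R ?Q E" "\<And>f. f \<in> carrier ?D \<Longrightarrow> h (S +>\<^bsub>?D\<^esub> f) = f x"
      using quotient_map[OF D E_module S _ kill[rule_format]] by metis
    define \<psi> where "\<psi> = restrict h (carrier ?Q)"
    have \<psi>: "\<psi> \<in> carrier (hom_module R ?Q E)"
      unfolding \<psi>_def by (rule restrict_in_hom_module[OF Q h(1)])
    have eq: "biduality_map R E ?RI x = (\<lambda>f\<in>carrier ?D. \<psi> (S +>\<^bsub>?D\<^esub> f))"
      unfolding biduality_map_def
    proof (rule restrict_ext)
      fix f assume f: "f \<in> carrier ?D"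
      then have "S +>\<^bsub>?D\<^esub> f \<in> carrier ?Q" unfolding quotient_carrier[OF D S] by blast
      then show "f x = \<psi> (S +>\<^bsub>?D\<^esub> f)" using h(2)[OF f] by (simp add: \<psi>_def)
    qed
    show "biduality_map R E ?RI x \<in> (\<lambda>\<psi>. \<lambda>f\<in>carrier ?D. \<psi> (S +>\<^bsub>?D\<^esub> f)) ` carrier (hom_module R ?Q E)"
      unfolding image_iff using eq \<psi> by (rule bexI)
  qed
  have L: "submodule ?L R E" by (rule ann_in_ideal_submodule[OF I])
  have "?L \<subseteq> cl R \<beta> E ?L"
    using cl_superset[OF \<beta> E_module L artinian_quotient[OF E_artinian L], of "\<lambda>x. x"] by auto
  then have ann_le: "annihilator R E (cl R \<beta> E ?L) \<subseteq> I"
    using annihilator_antimono annihilator_ann_in[OF I] by blast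
  have kill_iff: "(\<forall>f\<in>S. f x = \<zero>\<^bsub>E\<^esub>) \<longleftrightarrow> x \<in> annihilator R E (cl R \<beta> E ?L)" if x: "x \<in> I" for x
  proof
    assume kill: "\<forall>f\<in>S. f x = \<zero>\<^bsub>E\<^esub>"
    have "x \<odot>\<^bsub>E\<^esub> e = \<zero>\<^bsub>E\<^esub>" if e: "e \<in> cl R \<beta> E ?L" for e
    proof -
      have "p e \<in> S" using cl_iff[OF cl_carrier[OF e]] e by blast
      then have "p e x = \<zero>\<^bsub>E\<^esub>" using kill by blast
      then show ?thesis using x by (simp add: p_def)
    qed
    then show "x \<in> annihilator R E (cl R \<beta> E ?L)" using Ic[OF x] by (simp add: annihilator_iff)
  next
    assume ann: "x \<in> annihilator R E (cl R \<beta> E ?L)"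
    show "\<forall>f\<in>S. f x = \<zero>\<^bsub>E\<^esub>"
    proof
      fix f assume f: "f \<in> S"
      then obtain e where e: "e \<in> carrier E" "f = p e"
        using D.submoduleD(1)[OF S f] p_surj by blast
      then have "e \<in> cl R \<beta> E ?L" using cl_iff f by blast
      then show "f x = \<zero>\<^bsub>E\<^esub>" using ann x e(2) by (simp add: annihilator_iff p_def)
    qed
  qed
  have "x \<in> dual_selector R E \<beta> ?RI \<longleftrightarrow> x \<in> I \<and> x \<in> annihilator R E (cl R \<beta> E ?L)" for x
    using bidual[of x] kill_iff[of x] unfolding dual_selector_def Let_def S_def[symmetric] by auto
  then show ?thesis using ann_le by blast
qed

lemma annihilator_cl_test:
  fixes M :: "('a, 'u) module"
  assumes "module R M" "x \<in> carrier R"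
    and "\<And>f z. f \<in> mod_hom R M E \<Longrightarrow> z \<in> cl R \<beta> M L \<Longrightarrow> x \<odot>\<^bsub>E\<^esub> f z = \<zero>\<^bsub>E\<^esub>"
  shows "x \<in> annihilator R M (cl R \<beta> M L)"
proof -
  interpret M: module R M by fact
  have "x \<odot>\<^bsub>M\<^esub> z = \<zero>\<^bsub>M\<^esub>" if z: "z \<in> cl R \<beta> M L" for z
  proof (rule ccontr)
    assume nz: "x \<odot>\<^bsub>M\<^esub> z \<noteq> \<zero>\<^bsub>M\<^esub>"
    note zc = cl_carrier[OF z]
    obtain f where f: "f \<in> mod_hom R M E" "f (x \<odot>\<^bsub>M\<^esub> z) \<noteq> \<zero>\<^bsub>E\<^esub>"
      using cogenerator_module[OF assms(1) _ nz] zc assms(2) by auto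
    then show False using assms(3)[OF f(1) z] mod_hom_smult[OF f(1) assms(2) zc] by simp
  qed
  then show ?thesis using assms(2) by (simp add: annihilator_iff)
qed

lemma ann_in_quotient_artinian:
  assumes "artinian R M" "ideal I R"
  shows "submodule (ann_in M I) R M" "artinian R (quotient_module R M (ann_in M I))"
proof -
  show s: "submodule (ann_in M I) R M"
    by (rule submodule_ann_in[OF artinian_module[OF assms(1)] ideal_subset_carrier[OF assms(2)]])
  show "artinian R (quotient_module R M (ann_in M I))" by (rule artinian_quotient[OF assms(1) s])
qed

lemma cl_ann_hom:
  fixes j :: "'c \<Rightarrow> 'u" and \<beta> :: "('a, 'u) module \<Rightarrow> 'u set"
  assumes "submodule_selector R \<beta>" "functorial R \<beta>" "ideal I R" "artinian R M" "artinian R N"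
    "inj_on j (carrier N)" "f \<in> mod_hom R M N" "z \<in> cl R \<beta> M (ann_in M I)"
  shows "f z \<in> cl R \<beta> N (ann_in N I)"
proof (rule cl_hom[OF assms(1,2) _ _ _ _ _ assms(6,7) _ assms(8)])
  show "module R M" "module R N" using assms(4,5) by (auto intro: artinian_module)
  show "submodule (ann_in M I) R M" "submodule (ann_in N I) R N"
    "artinian R (quotient_module R N (ann_in N I))"
    using ann_in_quotient_artinian assms(3-5) by blast+
  fix x assume "x \<in> ann_in M I"
  then show "f x \<in> ann_in N I"
    by (rule ann_in_hom[OF artinian_module[OF assms(4)] artinian_module[OF assms(5)] assms(7)
          ideal_subset_carrier[OF assms(3)]])
qed

lemma finitely_generated_submodule_finite_length:
  assumes "submodule H R E" "finitely_generated R (E\<lparr>carrier := H\<rparr>)"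
  shows "module_length R (E\<lparr>carrier := H\<rparr>) < \<infinity>"
  using finitely_generated_torsion[OF assms] torsion_finite_length[OF assms(1)] by blast

lemma quotient_Reg:
  fixes J
  assumes J: "ideal J R"
  shows "submodule J R Reg" "module R (quotient_module R Reg J)"
    "\<exists>j :: 'a set \<Rightarrow> 'u. inj_on j (carrier (quotient_module R Reg J))"
proof -
  show s: "submodule J R Reg" using J submodule_regular_iff by blast
  show "module R (quotient_module R Reg J)" by (rule quotient_is_module[OF Reg_module s])
  have "inj_on \<iota> (carrier Reg)" using \<iota>_inj by simp
  then show "\<exists>j :: 'a set \<Rightarrow> 'u. inj_on j (carrier (quotient_module R Reg J))"
    using quotient_inj[OF Reg_module s] by metis
qed

section \<open>Comparing the intersections for a fixed selector and ideal\<close>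

context
  fixes \<alpha> :: "('a, 'u) module \<Rightarrow> 'u set" and I
  assumes sel: "submodule_selector R \<alpha>" and fun_sel: "functorial R \<alpha>" and I: "ideal I R"
begin

text \<open>One inclusion holds because E itself is Artinian and occurs in the family; for the
  other, every map from M to E carries the closure in M into the closure in E.\<close>

lemma annihilator_cl_artinian:
  "annihilator R E (cl R \<alpha> E (ann_in E I))
    = (\<Inter>M \<in> (artinian_modules R :: ('a, 'u) module set). annihilator R M (cl R \<alpha> M (ann_in M I)))"
proof
  show "(\<Inter>M \<in> (artinian_modules R :: ('a, 'u) module set). annihilator R M (cl R \<alpha> M (ann_in M I)))
      \<subseteq> annihilator R E (cl R \<alpha> E (ann_in E I))"
    by (rule INF_lower[of E _ "\<lambda>M. annihilator R M (cl R \<alpha> M (ann_in M I))",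
          OF E_in_artinian_modules])
  show "annihilator R E (cl R \<alpha> E (ann_in E I))
      \<subseteq> (\<Inter>M \<in> (artinian_modules R :: ('a, 'u) module set). annihilator R M (cl R \<alpha> M (ann_in M I)))"
  proof (intro INT_greatest subsetI)
    fix M :: "('a, 'u) module" and x
    assume M: "M \<in> artinian_modules R" and x: "x \<in> annihilator R E (cl R \<alpha> E (ann_in E I))"
    then have Ma: "artinian R M" and xc: "x \<in> carrier R"
      by (auto simp: artinian_modules_def annihilator_iff)
    show "x \<in> annihilator R M (cl R \<alpha> M (ann_in M I))"
    proof (rule annihilator_cl_test[OF artinian_module[OF Ma] xc])
      fix f z assume f: "f \<in> mod_hom R M E" and z: "z \<in> cl R \<alpha> M (ann_in M I)"
      have "f z \<in> cl R \<alpha> E (ann_in E I)"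
        using cl_ann_hom[OF sel fun_sel I Ma E_artinian _ f z, of "\<lambda>x. x"] by simp
      then show "x \<odot>\<^bsub>E\<^esub> f z = \<zero>\<^bsub>E\<^esub>" using x by (simp add: annihilator_iff)
    qed
  qed
qed

text \<open>Everything is expressed in one copy N of E / ann_E I in \<open>'u\<close>, with
  projection g. As ann_H I is H \<inter> ker g, the closure in H corresponds to the selector at the
  submodule g(H) of N. So both sides are about finitely generated submodules of N, and these are
  exactly the images of such submodules of E.\<close>

lemma cl_finitistic_E:
  "z \<in> cl R (finitistic R \<alpha>) E (ann_in E I) \<longleftrightarrow>
    (\<exists>H. submodule H R E \<and> finitely_generated R (E\<lparr>carrier := H\<rparr>) \<and>
      z \<in> cl R \<alpha> (E\<lparr>carrier := H\<rparr>) (ann_in (E\<lparr>carrier := H\<rparr>) I))"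
proof -
  let ?L = "ann_in E I"
  note L = ann_in_quotient_artinian[OF E_artinian I]
  let ?Q = "quotient_module R E ?L"
  note Q = quotient_is_module[OF E_module L(1)]
  obtain j :: "'u set \<Rightarrow> 'u" where j: "inj_on j (carrier ?Q)"
    using quotient_inj[OF E_module L(1), of "\<lambda>x. x"] by auto
  define N where "N = transport ?Q j"
  define g where "g x = j (?L +>\<^bsub>E\<^esub> x)" for x
  note jN = transport_iso[OF j, of R, folded N_def] and Nm = transport_module[OF Q j, folded N_def]
  have N: "N \<in> artinian_modules R"
    using artinian_iso[OF L(2) Nm jN] by (simp add: artinian_modules_def)
  interpret N: module R N by (rule Nm)
  have g: "g \<in> mod_hom R E N" unfolding g_def
    by (rule mod_hom_comp[OF quotient_proj[OF E_module L(1)] mod_isoD(1)[OF jN]])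
  have g_surj: "g ` carrier E = carrier N"
    using mod_isoD(3)[OF jN] unfolding g_def quotient_carrier[OF E_module L(1)] by (simp add: image_image)
  have g_zero: "g x = \<zero>\<^bsub>N\<^esub> \<longleftrightarrow> x \<in> ?L" if x: "x \<in> carrier E" for x
  proof -
    have c: "?L +>\<^bsub>E\<^esub> x \<in> carrier ?Q" "\<zero>\<^bsub>?Q\<^esub> \<in> carrier ?Q"
      using x mod_hom_closed[OF quotient_proj[OF E_module L(1)]]
        module.submoduleD(2)[OF Q module.carrier_is_submodule[OF Q]] by auto
    have "g x = \<zero>\<^bsub>N\<^esub> \<longleftrightarrow> j (?L +>\<^bsub>E\<^esub> x) = j \<zero>\<^bsub>?Q\<^esub>"
      unfolding g_def using mod_hom_zero[OF Q Nm mod_isoD(1)[OF jN]] by simp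
    also have "\<dots> \<longleftrightarrow> ?L +>\<^bsub>E\<^esub> x = \<zero>\<^bsub>?Q\<^esub>" using j c by (simp add: inj_on_eq_iff)
    also have "\<dots> \<longleftrightarrow> x \<in> ?L"
      using rcoset_eq_self_iff[OF E_module L(1) x] quotient_zero[OF E_module L(1)] by simp
    finally show ?thesis .
  qed
  have ker: "?L = {x \<in> carrier E. g x = \<zero>\<^bsub>N\<^esub>}"
    using g_zero by (auto simp: ann_in_def)
  have big: "z \<in> cl R (finitistic R \<alpha>) E ?L \<longleftrightarrow> g z \<in> finitistic R \<alpha> N" if z: "z \<in> carrier E" for z
    using cl_surj[OF finitistic_selector[OF sel fun_sel] E_module Nm g g_surj ker z]
      selector_at_self[OF finitistic_selector[OF sel fun_sel] N] by simp
  have small: "z \<in> cl R \<alpha> (E\<lparr>carrier := H\<rparr>) (ann_in (E\<lparr>carrier := H\<rparr>) I)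
      \<longleftrightarrow> g z \<in> \<alpha> (N\<lparr>carrier := g ` H\<rparr>)" if H: "submodule H R E" and z: "z \<in> H" for H z
  proof -
    note Hc = E.submoduleE(1)[OF H] and gH = submodule_image[OF E_module Nm g H]
    have gr: "g \<in> mod_hom R (E\<lparr>carrier := H\<rparr>) (N\<lparr>carrier := g ` H\<rparr>)"
      by (rule mod_hom_restrict[OF g Hc subset_refl])
    have k: "ann_in (E\<lparr>carrier := H\<rparr>) I
        = {x \<in> carrier (E\<lparr>carrier := H\<rparr>). g x = \<zero>\<^bsub>N\<lparr>carrier := g ` H\<rparr>\<^esub>}"
      unfolding ann_in_submodule[OF Hc] using g_zero Hc by auto
    show ?thesis
      using cl_surj[OF sel submodule_module[OF E_module H] submodule_module[OF Nm gH] gr _ k] z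
        selector_at_self[OF sel artinian_modules_submodule[OF N gH]] by simp
  qed
  show ?thesis
  proof
    assume z: "z \<in> cl R (finitistic R \<alpha>) E ?L"
    note zc = cl_carrier[OF z]
    obtain K where K: "submodule K R N" "finitely_generated R (N\<lparr>carrier := K\<rparr>)"
      "g z \<in> \<alpha> (N\<lparr>carrier := K\<rparr>)"
      using z big[OF zc] unfolding finitistic_elem by blast
    have gzK: "g z \<in> K"
      using submodule_selectorD(2)[OF sel artinian_modules_submodule[OF N K(1)] K(3)] by simp
    obtain B where B: "B \<subseteq> K" "finite B" "K = span_of R N B"
      using K(2) finitely_generated_submodule_iff[OF Nm K(1)] by blast
    have "B \<subseteq> g ` carrier E" using B(1) N.submoduleE(1)[OF K(1)] g_surj by blast
    then obtain A where A: "A \<subseteq> carrier E" "finite A" "B = g ` A"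
      using finite_subset_image[OF B(2)] by metis
    \<comment> \<open>Adding \<open>z\<close> to the lifted generators keeps the image equal to \<open>K\<close>.\<close>
    define H where "H = span_of R E (insert z A)"
    have zA: "insert z A \<subseteq> carrier E" using zc A(1) by simp
    have H: "submodule H R E" "finitely_generated R (E\<lparr>carrier := H\<rparr>)"
      using span_of_submodule[OF E_module zA] finitely_generated_span_of[OF E_module zA] A(2)
      unfolding H_def by auto
    have zH: "z \<in> H" unfolding H_def using span_of_superset[of "insert z A"] by auto
    have "g ` H = span_of R N (g ` insert z A)"
      unfolding H_def using span_of_image[OF E_module Nm g zA] by simp
    also have "\<dots> = K"
    proof
      show "span_of R N (g ` insert z A) \<subseteq> K"
        by (rule span_of_least[OF K(1)]) (use gzK A(3) B(1) in auto)
      show "K \<subseteq> span_of R N (g ` insert z A)"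
        unfolding B(3) A(3) span_of_def by blast
    qed
    finally have "g z \<in> \<alpha> (N\<lparr>carrier := g ` H\<rparr>)" using K(3) by simp
    then show "\<exists>H. submodule H R E \<and> finitely_generated R (E\<lparr>carrier := H\<rparr>) \<and>
      z \<in> cl R \<alpha> (E\<lparr>carrier := H\<rparr>) (ann_in (E\<lparr>carrier := H\<rparr>) I)"
      using small[OF H(1) zH] H by metis
  next
    assume "\<exists>H. submodule H R E \<and> finitely_generated R (E\<lparr>carrier := H\<rparr>) \<and>
      z \<in> cl R \<alpha> (E\<lparr>carrier := H\<rparr>) (ann_in (E\<lparr>carrier := H\<rparr>) I)"
    then obtain H where H: "submodule H R E" "finitely_generated R (E\<lparr>carrier := H\<rparr>)"
      "z \<in> cl R \<alpha> (E\<lparr>carrier := H\<rparr>) (ann_in (E\<lparr>carrier := H\<rparr>) I)" by blast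
    have zH: "z \<in> H" using cl_carrier[OF H(3)] by simp
    note Hc = E.submoduleE(1)[OF H(1)]
    have "g z \<in> \<alpha> (N\<lparr>carrier := g ` H\<rparr>)" using small[OF H(1) zH] H(3) by blast
    moreover have "submodule (g ` H) R N" by (rule submodule_image[OF E_module Nm g H(1)])
    moreover have "finitely_generated R (N\<lparr>carrier := g ` H\<rparr>)"
      using finitely_generated_image[OF H(2) Nm mod_hom_from_submodule[OF g Hc]] by simp
    ultimately have "g z \<in> finitistic R \<alpha> N" by (metis finitisticI)
    then show "z \<in> cl R (finitistic R \<alpha>) E ?L" using big zH Hc by blast
  qed
qed

lemma annihilator_cl_finitistic:
  "annihilator R E (cl R (finitistic R \<alpha>) E (ann_in E I))
    = (\<Inter>M \<in> {E\<lparr>carrier := H\<rparr> | H. submodule H R E \<and> finitely_generated R (E\<lparr>carrier := H\<rparr>)}.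
        annihilator R M (cl R \<alpha> M (ann_in M I)))" (is "?l = ?r")
proof -
  let ?C = "\<lambda>H. cl R \<alpha> (E\<lparr>carrier := H\<rparr>) (ann_in (E\<lparr>carrier := H\<rparr>) I)"
  have r: "x \<in> ?r \<longleftrightarrow> (\<forall>H. submodule H R E \<and> finitely_generated R (E\<lparr>carrier := H\<rparr>) \<longrightarrow>
      x \<in> carrier R \<and> (\<forall>z\<in>?C H. x \<odot>\<^bsub>E\<^esub> z = \<zero>\<^bsub>E\<^esub>))" for x
    unfolding annihilator_def by auto
  have l: "x \<in> ?l \<longleftrightarrow> x \<in> carrier R \<and> (\<forall>H. submodule H R E \<and> finitely_generated R (E\<lparr>carrier := H\<rparr>) \<longrightarrow>
      (\<forall>z\<in>?C H. x \<odot>\<^bsub>E\<^esub> z = \<zero>\<^bsub>E\<^esub>))" for x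
    unfolding annihilator_iff Ball_def cl_finitistic_E by metis
  \<comment> \<open>The family on the right is nonempty, which places its intersection inside the
    ring.\<close>
  have ex: "submodule (span_of R E {}) R E" "finitely_generated R (E\<lparr>carrier := span_of R E {}\<rparr>)"
    using span_of_submodule[OF E_module] finitely_generated_span_of[OF E_module] by auto
  have "x \<in> ?l \<longleftrightarrow> x \<in> ?r" for x unfolding l r using ex by metis
  then show ?thesis by (rule Set.set_eqI)
qed

text \<open>Finitely generated submodules of E have finite length, being killed by a power of m.
  Conversely, a map from a module of finite length to E factors through its image, which is finitely
  generated.\<close>

lemma inter_finitely_generated_eq_finite_length:
  "(\<Inter>M \<in> {E\<lparr>carrier := H\<rparr> | H. submodule H R E \<and> finitely_generated R (E\<lparr>carrier := H\<rparr>)}.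
        annihilator R M (cl R \<alpha> M (ann_in M I)))
    = (\<Inter>M \<in> {M :: ('a, 'u) module. module R M \<and> module_length R M < \<infinity>}.
        annihilator R M (cl R \<alpha> M (ann_in M I)))" (is "?l = ?r")
proof
  show "?r \<subseteq> ?l"
    using submodule_module[OF E_module] finitely_generated_submodule_finite_length
    by (intro INF_superset_mono) auto
  show "?l \<subseteq> ?r"
  proof (intro INT_greatest subsetI)
    fix M :: "('a, 'u) module" and x
    assume "M \<in> {M. module R M \<and> module_length R M < \<infinity>}" and x: "x \<in> ?l"
    then have M: "module R M" "module_length R M < \<infinity>" by auto
    note Ma = finite_length_artinian[OF M]
    have xH: "x \<in> annihilator R (E\<lparr>carrier := H\<rparr>) (cl R \<alpha> (E\<lparr>carrier := H\<rparr>) (ann_in (E\<lparr>carrier := H\<rparr>) I))"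
      if "submodule H R E" "finitely_generated R (E\<lparr>carrier := H\<rparr>)" for H
      using x that by blast
    \<comment> \<open>Membership in the ring is read off from the zero submodule.\<close>
    have "x \<in> carrier R"
      using xH[OF span_of_submodule[OF E_module, of "{}"]] finitely_generated_span_of[OF E_module, of "{}"]
      by (simp add: annihilator_iff)
    then show "x \<in> annihilator R M (cl R \<alpha> M (ann_in M I))"
    proof (rule annihilator_cl_test[OF M(1)])
      fix f z assume f: "f \<in> mod_hom R M E" and z: "z \<in> cl R \<alpha> M (ann_in M I)"
      let ?H = "f ` carrier M"
      have H: "submodule ?H R E"
        using submodule_image[OF M(1) E_module f module.carrier_is_submodule[OF M(1)]] .
      have fg: "finitely_generated R (E\<lparr>carrier := ?H\<rparr>)"
        by (rule finitely_generated_image[OF finite_length_finitely_generated[OF M] E_module f])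
      have "f z \<in> cl R \<alpha> (E\<lparr>carrier := ?H\<rparr>) (ann_in (E\<lparr>carrier := ?H\<rparr>) I)"
        using cl_ann_hom[OF sel fun_sel I Ma artinian_submodule[OF E_artinian H] _
            mod_hom_into_submodule[OF f subset_refl] z, of "\<lambda>x. x"] by simp
      then show "x \<odot>\<^bsub>E\<^esub> f z = \<zero>\<^bsub>E\<^esub>" using xH[OF H fg] by (simp add: annihilator_iff)
    qed
  qed
qed

text \<open>Up to isomorphism R / J is one of the modules on the left; the copy in \<open>'u\<close>
  is needed because its elements are cosets.\<close>

lemma finite_length_le_quotient:
  assumes J: "ideal J R" and len: "module_length R (quotient_module R Reg J) < \<infinity>"
  shows "(\<Inter>M \<in> {M :: ('a, 'u) module. module R M \<and> module_length R M < \<infinity>}.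
            annihilator R M (cl R \<alpha> M (ann_in M I)))
    \<subseteq> annihilator R (quotient_module R Reg J)
        (cl R \<alpha> (quotient_module R Reg J) (ann_in (quotient_module R Reg J) I))"
proof
  let ?Q = "quotient_module R Reg J"
  note Q = quotient_Reg[OF J]
  fix x assume x: "x \<in> (\<Inter>M \<in> {M :: ('a, 'u) module. module R M \<and> module_length R M < \<infinity>}.
            annihilator R M (cl R \<alpha> M (ann_in M I)))"
  obtain j :: "'a set \<Rightarrow> 'u" where j: "inj_on j (carrier ?Q)" using Q(3) by blast
  let ?M = "transport ?Q j"
  note M = transport_module[OF Q(2) j] and jM = transport_iso[OF j, of R]
  note jD = mod_isoD[OF jM]
  have lenM: "module_length R ?M < \<infinity>" by (rule finite_length_surj[OF Q(2) M jD(1,3) len])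
  then have xM: "x \<in> annihilator R ?M (cl R \<alpha> ?M (ann_in ?M I))" using x M by blast
  then have xc: "x \<in> carrier R" by (simp add: annihilator_iff)
  interpret Q: module R ?Q by (rule Q(2))
  have "x \<odot>\<^bsub>?Q\<^esub> z = \<zero>\<^bsub>?Q\<^esub>" if z: "z \<in> cl R \<alpha> ?Q (ann_in ?Q I)" for z
  proof -
    note zc = cl_carrier[OF z]
    have "j z \<in> cl R \<alpha> ?M (ann_in ?M I)"
      using cl_ann_hom[OF sel fun_sel I finite_length_artinian[OF Q(2) len]
          finite_length_artinian[OF M lenM] _ jD(1) z, of "\<lambda>x. x"] by simp
    then have "j (x \<odot>\<^bsub>?Q\<^esub> z) = j \<zero>\<^bsub>?Q\<^esub>"
      using xM mod_hom_smult[OF jD(1) xc zc] mod_hom_zero[OF Q(2) M jD(1)] by (simp add: annihilator_iff)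
    then show ?thesis using jD(2) zc xc by (simp add: inj_on_eq_iff)
  qed
  then show "x \<in> annihilator R ?Q (cl R \<alpha> ?Q (ann_in ?Q I))" using xc by (simp add: annihilator_iff)
qed

text \<open>The composite of the projections R \<rightarrow> R / J \<rightarrow> (R / J) / ann I has
  kernel (J : I). Hence (J : I)^cl is the preimage of the closure in R / J, and r kills that closure
  exactly if r multiplies (J : I)^cl into J.\<close>

lemma annihilator_cl_quotient:
  assumes J: "ideal J R"
  shows "annihilator R (quotient_module R Reg J)
      (cl R \<alpha> (quotient_module R Reg J) (ann_in (quotient_module R Reg J) I))
    = colon R J (cl R \<alpha> Reg (colon R J I))"
proof -
  let ?Q = "quotient_module R Reg J"
  note Q = quotient_Reg[OF J]
  let ?A = "ann_in ?Q I"
  have A: "submodule ?A R ?Q" by (rule submodule_ann_in[OF Q(2) ideal_subset_carrier[OF I]])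
  let ?P = "quotient_module R ?Q ?A"
  note P = quotient_is_module[OF Q(2) A]
  let ?p = "\<lambda>x. J +>\<^bsub>Reg\<^esub> x"
  note p = quotient_proj[OF Reg_module Q(1)] and Q_carrier = quotient_carrier[OF Reg_module Q(1)]
  have pc: "?p x \<in> carrier ?Q" if "x \<in> carrier R" for x using mod_hom_closed[OF p] that by simp
  have p_zero: "?p x = \<zero>\<^bsub>?Q\<^esub> \<longleftrightarrow> x \<in> J" if "x \<in> carrier R" for x
    using rcoset_eq_self_iff[OF Reg_module Q(1), of x] quotient_zero[OF Reg_module Q(1)] that by simp
  have p_smult: "r \<odot>\<^bsub>?Q\<^esub> ?p x = \<zero>\<^bsub>?Q\<^esub> \<longleftrightarrow> r \<otimes> x \<in> J" if "r \<in> carrier R" "x \<in> carrier R" for r x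
    using mod_hom_smult[OF p that(1), of x] that p_zero[of "r \<otimes> x"] by simp
  let ?g = "\<lambda>x. ?A +>\<^bsub>?Q\<^esub> ?p x"
  have g: "?g \<in> mod_hom R Reg ?P" by (rule mod_hom_comp[OF p quotient_proj[OF Q(2) A]])
  have g_surj: "?g ` carrier Reg = carrier ?P"
    unfolding quotient_carrier[OF Q(2) A] Q_carrier image_image ..
  have "?g x = \<zero>\<^bsub>?P\<^esub> \<longleftrightarrow> (\<forall>r\<in>I. x \<otimes> r \<in> J)" if x: "x \<in> carrier R" for x
  proof -
    have "?g x = \<zero>\<^bsub>?P\<^esub> \<longleftrightarrow> ?p x \<in> ?A"
      using rcoset_eq_self_iff[OF Q(2) A pc[OF x]] quotient_zero[OF Q(2) A] by simp
    also have "\<dots> \<longleftrightarrow> (\<forall>r\<in>I. r \<otimes> x \<in> J)"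
      unfolding ann_in_def using pc[OF x] p_smult[OF ideal.Icarr[OF I] x] by simp
    also have "\<dots> \<longleftrightarrow> (\<forall>r\<in>I. x \<otimes> r \<in> J)" using m_comm[OF x ideal.Icarr[OF I]] by simp
    finally show ?thesis .
  qed
  then have ker: "colon R J I = {x \<in> carrier Reg. ?g x = \<zero>\<^bsub>?P\<^esub>}" unfolding colon_def by auto
  have iff: "x \<in> cl R \<alpha> Reg (colon R J I) \<longleftrightarrow> ?p x \<in> cl R \<alpha> ?Q ?A" if x: "x \<in> carrier R" for x
  proof -
    have "x \<in> cl R \<alpha> Reg (colon R J I) \<longleftrightarrow> ?g x \<in> selector_at R \<alpha> ?P"
      using cl_surj[OF sel Reg_module P g g_surj ker] x by simp
    also have "\<dots> \<longleftrightarrow> ?p x \<in> cl R \<alpha> ?Q ?A" using pc[OF x] by (simp add: cl_def)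
    finally show ?thesis .
  qed
  show ?thesis
  proof (intro Set.set_eqI iffI)
    fix r assume r: "r \<in> annihilator R ?Q (cl R \<alpha> ?Q ?A)"
    then have rc: "r \<in> carrier R" by (simp add: annihilator_iff)
    have "r \<otimes> x \<in> J" if x: "x \<in> cl R \<alpha> Reg (colon R J I)" for x
    proof -
      have xc: "x \<in> carrier R" using cl_carrier[OF x] by simp
      then have "r \<odot>\<^bsub>?Q\<^esub> ?p x = \<zero>\<^bsub>?Q\<^esub>" using r iff[OF xc] x by (simp add: annihilator_iff)
      then show ?thesis using p_smult[OF rc xc] by blast
    qed
    then show "r \<in> colon R J (cl R \<alpha> Reg (colon R J I))" using rc by (simp add: colon_def)
  next
    fix r assume r: "r \<in> colon R J (cl R \<alpha> Reg (colon R J I))"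
    then have rc: "r \<in> carrier R" by (simp add: colon_def)
    have "r \<odot>\<^bsub>?Q\<^esub> w = \<zero>\<^bsub>?Q\<^esub>" if w: "w \<in> cl R \<alpha> ?Q ?A" for w
    proof -
      obtain x where x: "x \<in> carrier R" "w = ?p x" using cl_carrier[OF w] unfolding Q_carrier by auto
      then have "r \<otimes> x \<in> J" using r w iff[OF x(1)] by (simp add: colon_def)
      then show ?thesis using p_smult[OF rc x(1)] x(2) by simp
    qed
    then show "r \<in> annihilator R ?Q (cl R \<alpha> ?Q ?A)" using rc by (simp add: annihilator_iff)
  qed
qed

text \<open>The isomorphism of R / J with ann_E J embeds H into R / J, and the embedding maps
  closure into closure. What kills the closure in R / J thus kills the one in H.\<close>

lemma irreducible_quotient_le_torsion:
  assumes J: "irreducible_ideal R J" "ideal_power R m n \<subseteq> J" and H: "submodule H R E" "H \<subseteq> ann_in E J"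
  shows "annihilator R (quotient_module R Reg J)
      (cl R \<alpha> (quotient_module R Reg J) (ann_in (quotient_module R Reg J) I))
    \<subseteq> annihilator R (E\<lparr>carrier := H\<rparr>) (cl R \<alpha> (E\<lparr>carrier := H\<rparr>) (ann_in (E\<lparr>carrier := H\<rparr>) I))"
proof
  let ?Q = "quotient_module R Reg J"
  have Ji: "ideal J R" using J(1) by (simp add: irreducible_ideal_def)
  note Q = quotient_Reg[OF Ji]
  interpret Q: module R ?Q by (rule Q(2))
  obtain j :: "'a set \<Rightarrow> 'u" where j: "inj_on j (carrier ?Q)" using Q(3) by blast
  have Qa: "artinian R ?Q" by (rule finite_length_artinian[OF Q(2) quotient_finite_length[OF Ji J(2)]])
  let ?T = "E\<lparr>carrier := ann_in E J\<rparr>" and ?H = "E\<lparr>carrier := H\<rparr>"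
  note T = submodule_module[OF E_module ann_in_ideal_submodule[OF Ji]]
  obtain h where h: "h \<in> mod_iso R ?Q ?T" using irreducible_quotient_iso[OF J] .
  note hD = mod_isoD[OF h]
  let ?h' = "inv_into (carrier ?Q) h"
  note Hc = E.submoduleE(1)[OF H(1)]
  have incl: "(\<lambda>x. x) \<in> mod_hom R ?H ?T" using H(2) by (auto simp: mod_hom_def)
  have h': "?h' \<in> mod_hom R ?H ?Q" using mod_hom_comp[OF incl mod_isoD(1)[OF mod_iso_inv[OF Q(2) h]]] .
  fix x assume x: "x \<in> annihilator R ?Q (cl R \<alpha> ?Q (ann_in ?Q I))"
  then have xc: "x \<in> carrier R" by (simp add: annihilator_iff)
  have "x \<odot>\<^bsub>E\<^esub> z = \<zero>\<^bsub>E\<^esub>" if z: "z \<in> cl R \<alpha> ?H (ann_in ?H I)" for z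
  proof -
    have zH: "z \<in> H" using cl_carrier[OF z] by simp
    have "?h' z \<in> cl R \<alpha> ?Q (ann_in ?Q I)"
      by (rule cl_ann_hom[OF sel fun_sel I artinian_submodule[OF E_artinian H(1)] Qa j h' z])
    then have 0: "x \<odot>\<^bsub>?Q\<^esub> ?h' z = \<zero>\<^bsub>?Q\<^esub>" using x by (simp add: annihilator_iff)
    have hz: "h (?h' z) = z" using hD(3) zH H(2) by (intro f_inv_into_f) auto
    have zc: "?h' z \<in> carrier ?Q" using mod_hom_closed[OF h'] zH by simp
    have "x \<odot>\<^bsub>E\<^esub> z = h (x \<odot>\<^bsub>?Q\<^esub> ?h' z)" using mod_hom_smult[OF hD(1) xc zc] hz by simp
    then show ?thesis using 0 mod_hom_zero[OF Q(2) T hD(1)] by simp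
  qed
  then show "x \<in> annihilator R ?H (cl R \<alpha> ?H (ann_in ?H I))" using xc by (simp add: annihilator_iff)
qed

text \<open>Both halves of cofinality enter. A finitely generated H is killed by some m^n, hence by
  a \<open>J t\<close> inside m^n; and this \<open>J t\<close> contains a power of m, as the
  comparison with R / J requires.\<close>

lemma irreducible_sequence_le:
  fixes J :: "nat \<Rightarrow> 'a set"
  assumes J: "\<And>t. irreducible_ideal R (J t)" and cof: "cofinal_with_powers R m J"
  shows "(\<Inter>t. colon R (J t) (cl R \<alpha> Reg (colon R (J t) I)))
    \<subseteq> (\<Inter>M \<in> {E\<lparr>carrier := H\<rparr> | H. submodule H R E \<and> finitely_generated R (E\<lparr>carrier := H\<rparr>)}.
        annihilator R M (cl R \<alpha> M (ann_in M I)))"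
proof (intro INT_greatest)
  fix M assume "M \<in> {E\<lparr>carrier := H\<rparr> | H. submodule H R E \<and> finitely_generated R (E\<lparr>carrier := H\<rparr>)}"
  then obtain H where M: "M = E\<lparr>carrier := H\<rparr>" and H: "submodule H R E" "finitely_generated R (E\<lparr>carrier := H\<rparr>)"
    by blast
  obtain n where n: "H \<subseteq> ann_in E (ideal_power R m n)" using finitely_generated_torsion[OF H] by blast
  obtain t where t: "J t \<subseteq> ideal_power R m n" using cof unfolding cofinal_with_powers_def by blast
  obtain k where k: "ideal_power R m k \<subseteq> J t" using cof unfolding cofinal_with_powers_def by blast
  have Ji: "ideal (J t) R" using J by (simp add: irreducible_ideal_def)
  have "H \<subseteq> ann_in E (J t)" using n ann_in_antimono[OF t] by blast
  then have "colon R (J t) (cl R \<alpha> Reg (colon R (J t) I)) \<subseteq> annihilator R M (cl R \<alpha> M (ann_in M I))"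
    unfolding M using irreducible_quotient_le_torsion[OF J k H(1)] annihilator_cl_quotient[OF Ji] by simp
  then show "(\<Inter>t. colon R (J t) (cl R \<alpha> Reg (colon R (J t) I))) \<subseteq> annihilator R M (cl R \<alpha> M (ann_in M I))"
    by blast
qed

end

end

theorem theorem3p3:
  fixes R :: "('a, 'r) ring_scheme" and m I :: "'a set"
    and E :: "('a, 'u) module" and \<alpha> :: "('a, 'u) module \<Rightarrow> 'u set"
  assumes "infinite (UNIV :: 'u set)" and "\<exists>\<iota> :: 'a \<Rightarrow> 'u. inj_on \<iota> (carrier R)"
    and "complete_noetherian_local R m"
    and "injective_hull R (quotient_module R (regular_module R) m) E"
    and "submodule_selector R \<alpha>" and "functorial R \<alpha>"
    and "closure_operation R (cl R \<alpha>)"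
    and "closure_operation R (cl R (finitistic R \<alpha>))"
    and "ideal I R"
  shows
    "dual_selector R E \<alpha> ((regular_module R)\<lparr>carrier := I\<rparr>)
       = annihilator R E (cl R \<alpha> E (ann_in E I))
     \<and> annihilator R E (cl R \<alpha> E (ann_in E I))
       = (\<Inter>M \<in> (artinian_modules R :: ('a, 'u) module set).
            annihilator R M (cl R \<alpha> M (ann_in M I)))
     \<and> (\<Inter>M \<in> (artinian_modules R :: ('a, 'u) module set).
            annihilator R M (cl R \<alpha> M (ann_in M I)))
       \<subseteq> dual_selector R E (finitistic R \<alpha>) ((regular_module R)\<lparr>carrier := I\<rparr>)
     \<and> dual_selector R E (finitistic R \<alpha>) ((regular_module R)\<lparr>carrier := I\<rparr>)
       = annihilator R E (cl R (finitistic R \<alpha>) E (ann_in E I))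
     \<and> annihilator R E (cl R (finitistic R \<alpha>) E (ann_in E I))
       = (\<Inter>M \<in> {E\<lparr>carrier := H\<rparr> | H.
                  submodule H R E \<and> finitely_generated R (E\<lparr>carrier := H\<rparr>)}.
            annihilator R M (cl R \<alpha> M (ann_in M I)))
     \<and> (\<Inter>M \<in> {E\<lparr>carrier := H\<rparr> | H.
                  submodule H R E \<and> finitely_generated R (E\<lparr>carrier := H\<rparr>)}.
            annihilator R M (cl R \<alpha> M (ann_in M I)))
       = (\<Inter>M \<in> {M :: ('a, 'u) module. module R M \<and> module_length R M < \<infinity>}.
            annihilator R M (cl R \<alpha> M (ann_in M I)))
     \<and> (\<Inter>M \<in> {M :: ('a, 'u) module. module R M \<and> module_length R M < \<infinity>}.
            annihilator R M (cl R \<alpha> M (ann_in M I)))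
       \<subseteq> (\<Inter>M \<in> {quotient_module R (regular_module R) J | J.
                  ideal J R \<and> module_length R (quotient_module R (regular_module R) J) < \<infinity>}.
            annihilator R M (cl R \<alpha> M (ann_in M I)))
     \<and> (\<Inter>M \<in> {quotient_module R (regular_module R) J | J.
                  ideal J R \<and> module_length R (quotient_module R (regular_module R) J) < \<infinity>}.
            annihilator R M (cl R \<alpha> M (ann_in M I)))
       = (\<Inter>J \<in> {J. ideal J R
                  \<and> module_length R (quotient_module R (regular_module R) J) < \<infinity>}.
            colon R J (cl R \<alpha> (regular_module R) (colon R J I)))
     \<and> (approximately_gorenstein R m \<longrightarrow>
          (\<Inter>M \<in> {M :: ('a, 'u) module. module R M \<and> module_length R M < \<infinity>}.
              annihilator R M (cl R \<alpha> M (ann_in M I)))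
          = (\<Inter>M \<in> {quotient_module R (regular_module R) J | J.
                    ideal J R \<and> module_length R (quotient_module R (regular_module R) J) < \<infinity>}.
              annihilator R M (cl R \<alpha> M (ann_in M I)))
          \<and> (\<forall>J :: nat \<Rightarrow> 'a set.
               antimono J \<and> (\<forall>t. irreducible_ideal R (J t)) \<and> cofinal_with_powers R m J \<longrightarrow>
               dual_selector R E (finitistic R \<alpha>) ((regular_module R)\<lparr>carrier := I\<rparr>)
               = (\<Inter>t. colon R (J t) (cl R \<alpha> (regular_module R) (colon R (J t) I)))))"
proof -
  obtain \<iota> :: "'a \<Rightarrow> 'u" where \<iota>: "inj_on \<iota> (carrier R)" using assms(2) by blast
  obtain s where "matlis_dual R m E s \<iota>" using matlis_dual_exists[OF assms(3) \<iota> assms(4)] by blast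
  then interpret matlis_dual R m E s \<iota> .
  note ctx = assms(5,6,9)
  let ?fl = "{M :: ('a, 'u) module. module R M \<and> module_length R M < \<infinity>}"
  let ?fg = "{E\<lparr>carrier := H\<rparr> | H. submodule H R E \<and> finitely_generated R (E\<lparr>carrier := H\<rparr>)}"
  let ?J = "{J. ideal J R \<and> module_length R (quotient_module R Reg J) < \<infinity>}"
  let ?q = "{quotient_module R Reg J | J. ideal J R \<and> module_length R (quotient_module R Reg J) < \<infinity>}"
  \<comment> \<open>The same expression is named twice because modules with elements in
    \<open>'u\<close> and quotients of R have different types.\<close>
  define an where "an M = annihilator R M (cl R \<alpha> M (ann_in M I))" for M :: "('a, 'u) module"
  define anq where "anq M = annihilator R M (cl R \<alpha> M (ann_in M I))" for M :: "('a, 'a set) module"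
  define co where "co J = colon R J (cl R \<alpha> Reg (colon R J I))" for J
  have 1: "dual_selector R E \<alpha> (Reg\<lparr>carrier := I\<rparr>) = an E"
    unfolding an_def by (rule dual_selector_eq[OF assms(5,9)])
  have 2: "an E = (\<Inter>M\<in>artinian_modules R. an M)"
    unfolding an_def by (rule annihilator_cl_artinian[OF ctx])
  have 4: "dual_selector R E (finitistic R \<alpha>) (Reg\<lparr>carrier := I\<rparr>)
      = annihilator R E (cl R (finitistic R \<alpha>) E (ann_in E I))"
    by (rule dual_selector_eq[OF finitistic_selector[OF assms(5,6)] assms(9)])
  have 3: "an E \<subseteq> annihilator R E (cl R (finitistic R \<alpha>) E (ann_in E I))"
    unfolding an_def
    by (intro annihilator_antimono cl_mono_selector finitistic_le[OF assms(5,6)])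
  have 5: "annihilator R E (cl R (finitistic R \<alpha>) E (ann_in E I)) = (\<Inter>M\<in>?fg. an M)"
    unfolding an_def by (rule annihilator_cl_finitistic[OF ctx])
  have 6: "(\<Inter>M\<in>?fg. an M) = (\<Inter>M\<in>?fl. an M)"
    unfolding an_def by (rule inter_finitely_generated_eq_finite_length[OF ctx])
  have 7: "(\<Inter>M\<in>?fl. an M) \<subseteq> (\<Inter>M\<in>?q. anq M)"
    using finite_length_le_quotient[OF ctx] unfolding an_def anq_def by blast
  have q: "anq (quotient_module R Reg J) = co J" if "ideal J R" for J
    unfolding anq_def co_def by (rule annihilator_cl_quotient[OF ctx that])
  have 8: "(\<Inter>M\<in>?q. anq M) = (\<Inter>J\<in>?J. co J)"
  proof -
    have "?q = quotient_module R Reg ` ?J" by auto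
    then have "(\<Inter>M\<in>?q. anq M) = (\<Inter>J\<in>?J. anq (quotient_module R Reg J))"
      by (metis image_image)
    also have "\<dots> = (\<Inter>J\<in>?J. co J)" using q by (intro INF_cong) auto
    finally show ?thesis .
  qed
  \<comment> \<open>Each \<open>J t\<close> has finite colength, so the intersection along the
    sequence lies between the one over all J and the one over finitely generated submodules of E. By
    6 and 7 the latter is contained in the former, which closes the cycle.\<close>
  have seq: "(\<Inter>J\<in>?J. co J) \<subseteq> (\<Inter>t. co (J t)) \<and> (\<Inter>t. co (J t)) \<subseteq> (\<Inter>M\<in>?fg. an M)"
    if J: "\<And>t. irreducible_ideal R (J t)" and cof: "cofinal_with_powers R m J" for J :: "nat \<Rightarrow> 'a set"
  proof
    have "J t \<in> ?J" for t
      using J[of t] cof quotient_finite_length[of "J t"]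
      unfolding irreducible_ideal_def cofinal_with_powers_def by blast
    then show "(\<Inter>J\<in>?J. co J) \<subseteq> (\<Inter>t. co (J t))" by blast
    show "(\<Inter>t. co (J t)) \<subseteq> (\<Inter>M\<in>?fg. an M)"
      unfolding co_def an_def by (rule irreducible_sequence_le[OF ctx J cof])
  qed
  have 9: "(\<Inter>M\<in>?fl. an M) = (\<Inter>M\<in>?q. anq M)" if ag: "approximately_gorenstein R m"
  proof -
    obtain J :: "nat \<Rightarrow> 'a set" where J: "\<forall>t. irreducible_ideal R (J t)" "cofinal_with_powers R m J"
      using ag unfolding approximately_gorenstein_def by metis
    have "(\<Inter>M\<in>?q. anq M) \<subseteq> (\<Inter>M\<in>?fl. an M)"
      unfolding 8 6[symmetric] using seq[OF J(1)[rule_format] J(2)] by (elim conjE) (rule subset_trans)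
    with 7 show ?thesis by (rule subset_antisym)
  qed
  have 10: "dual_selector R E (finitistic R \<alpha>) (Reg\<lparr>carrier := I\<rparr>) = (\<Inter>t. co (J t))"
    if J: "\<forall>t. irreducible_ideal R (J t)" "cofinal_with_powers R m J" for J :: "nat \<Rightarrow> 'a set"
  proof -
    note s = seq[OF J(1)[rule_format] J(2)]
    have "(\<Inter>M\<in>?fg. an M) \<subseteq> (\<Inter>t. co (J t))"
      using 7 conjunct1[OF s] unfolding 8 6 by (rule subset_trans)
    then have "(\<Inter>M\<in>?fg. an M) = (\<Inter>t. co (J t))"
      using conjunct2[OF s] by (rule subset_antisym)
    then show ?thesis unfolding 4 5 .
  qed
  show ?thesis unfolding an_def[symmetric] anq_def[symmetric] co_def[symmetric]
  proof (intro conjI impI allI)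
    show "(\<Inter>M\<in>artinian_modules R. an M) \<subseteq> dual_selector R E (finitistic R \<alpha>) (Reg\<lparr>carrier := I\<rparr>)"
      using 3 unfolding 2 4 .
  qed (rule 1 2 4 5 6 7 8 | (rule 9, assumption) | (elim conjE, rule 10, assumption+))+
qed

end
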